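(* Let $k \ge 1$. The decision problems $\mathrm{detTILING}(\exp_{k+1}(n), \exp_k(n))$ and $\mathrm{detTILING}( *, \exp_k(n))$ are both $k\mathsf{EXPSPACE}$-complete.
   Context: Define $\exp_0(n) = n$ and $\exp_k(n) = 2^{\exp_{k-1}(n)}$ for $k \ge 1$. $k\mathsf{EXPSPACE}$ is the class of problems decidable by a deterministic Turing machine in space $\exp_k(p(n))$ for some polynomial $p$. Fix a countable set $\mathcal{C}$ of colors containing a distinguished color $\mathit{white}$. A tile type is a 4-tuple $t = \langle \mathit{left}(t), \mathit{top}(t), \mathit{right}(t), \mathit{bottom}(t)\rangle \in \mathcal{C}^4$. For a finite set $T$ of tile types, a $T$-tiling of the $H \times W$ rectangle is a function $\tau : \{1,\dots,H\}\times\{1,\dots,W\} \to T$ such that: (1) $\mathit{left}(\tau(i,1)) = \mathit{right}(\tau(i,W)) = \mathit{white}$ for all $i$; (2) $\mathit{top}(\tau(1,j)) = \mathit{bottom}(\tau(H,j)) = \mathit{white}$ for all $j$; (3) $\mathit{right}(\tau(i,j)) = \mathit{left}(\tau(i,j+1))$ for all $i$ and all $j \le W-1$; (4) $\mathit{bottom}(\tau(i,j)) = \mathit{top}(\tau(i+1,j))$ for all $i \le H-1$ and all $j$. A set $T$ of tile types is deterministic if there is a partition $\mathcal{C} = \mathit{Col} \sqcup \mathit{Col}'$ with $\mathit{white} \in \mathit{Col}$ such that: for every $t \in T$, $\mathit{top}(t) \in \mathit{Col}$ iff $\mathit{bottom}(t) \in \mathit{Col}'$; for all $c \in \mathit{Col}$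 and $c' \in \mathcal{C}$ there is at most one $t \in T$ with $\mathit{left}(t) = c$ and $\mathit{top}(t) = c'$; for all $c \in \mathit{Col}'$ and $c' \in \mathcal{C}$ there is at most one $t \in T$ with $\mathit{right}(t) = c$ and $\mathit{top}(t) = c'$. $\mathrm{detTILING}(h(n), w(n))$: input an integer $n$ in unary, a finite deterministic set $T$ of tile types and a tile $t_0$; answer yes iff there is a $T$-tiling $\tau$ of the $h(n) \times w(n)$ rectangle with $\tau(1,1) = t_0$. $\mathrm{detTILING}( *, w(n))$: same input; answer yes iff there exist an integer $h$ and a $T$-tiling $\tau$ of the $h \times w(n)$ rectangle with $\tau(1,1)=t_0$. *)

theory Defs
  imports Main
begin

fun expk :: "nat \<Rightarrow> nat \<Rightarrow> nat" where
  "expk 0 n = n"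
| "expk (Suc k) n = 2 ^ expk k n"

type_synonym tile = "nat \<times> nat \<times> nat \<times> nat"  (* left, top, right, bottom *)

definition white :: nat where "white = 0"

fun tleft :: "tile \<Rightarrow> nat" where "tleft (l, t, r, b) = l"
fun ttop :: "tile \<Rightarrow> nat" where "ttop (l, t, r, b) = t"
fun tright :: "tile \<Rightarrow> nat" where "tright (l, t, r, b) = r"
fun tbottom :: "tile \<Rightarrow> nat" where "tbottom (l, t, r, b) = b"

definition is_tiling :: "tile set \<Rightarrow> nat \<Rightarrow> nat \<Rightarrow> (nat \<Rightarrow> nat \<Rightarrow> tile) \<Rightarrow> bool" where
  "is_tiling T H W \<tau> \<longleftrightarrow>
     (\<forall>i\<in>{1..H}. \<forall>j\<in>{1..W}. \<tau> i j \<in> T) \<and>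
     (\<forall>i\<in>{1..H}. tleft (\<tau> i 1) = white \<and> tright (\<tau> i W) = white) \<and>
     (\<forall>j\<in>{1..W}. ttop (\<tau> 1 j) = white \<and> tbottom (\<tau> H j) = white) \<and>
     (\<forall>i\<in>{1..H}. \<forall>j\<in>{1..<W}. tright (\<tau> i j) = tleft (\<tau> i (j+1))) \<and>
     (\<forall>i\<in>{1..<H}. \<forall>j\<in>{1..W}. tbottom (\<tau> i j) = ttop (\<tau> (i+1) j))"

definition deterministic :: "tile set \<Rightarrow> bool" where
  "deterministic T \<longleftrightarrow> (\<exists>Col :: nat set. white \<in> Col \<and>
     (\<forall>t\<in>T. ttop t \<in> Col \<longleftrightarrow> tbottom t \<notin> Col) \<and>
     (\<forall>c\<in>Col. \<forall>c'. \<forall>t1\<in>T. \<forall>t2\<in>T.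
        tleft t1 = c \<and> ttop t1 = c' \<and> tleft t2 = c \<and> ttop t2 = c' \<longrightarrow> t1 = t2) \<and>
     (\<forall>c\<in>-Col. \<forall>c'. \<forall>t1\<in>T. \<forall>t2\<in>T.
        tright t1 = c \<and> ttop t1 = c' \<and> tright t2 = c \<and> ttop t2 = c' \<longrightarrow> t1 = t2))"

fun bits :: "nat \<Rightarrow> bool list" where
  "bits n = (if n = 0 then [] else odd n # bits (n div 2))"

definition enc_nat :: "nat \<Rightarrow> bool list" where
  "enc_nat m = concat (map (\<lambda>b. [True, b]) (bits m)) @ [False, False]"

fun enc_tile :: "tile \<Rightarrow> bool list" where
  "enc_tile (l, t, r, b) = enc_nat l @ enc_nat t @ enc_nat r @ enc_nat b"

definition enc_inst :: "nat \<Rightarrow> tile list \<Rightarrow> tile \<Rightarrow> bool list" where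
  "enc_inst n Ts t0 = replicate n True @ [False] @ concat (map enc_tile Ts) @ [False, True] @ enc_tile t0"

definition detTILING :: "(nat \<Rightarrow> nat) \<Rightarrow> (nat \<Rightarrow> nat) \<Rightarrow> bool list set" where
  "detTILING h w = {enc_inst n Ts t0 | n Ts t0. deterministic (set Ts) \<and>
      (\<exists>\<tau>. is_tiling (set Ts) (h n) (w n) \<tau> \<and> \<tau> 1 1 = t0)}"

definition detTILING_star :: "(nat \<Rightarrow> nat) \<Rightarrow> bool list set" where
  "detTILING_star w = {enc_inst n Ts t0 | n Ts t0. deterministic (set Ts) \<and>
      (\<exists>H \<tau>. H \<ge> 1 \<and> is_tiling (set Ts) H (w n) \<tau> \<and> \<tau> 1 1 = t0)}"

datatype dir = MoveL | Stay | MoveR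

(* states 0..nstates-1; 0 = start, 1 = accept, 2 = reject;
   symbols 0..nsyms-1; 0 = blank, 1 = input bit False, 2 = input bit True *)
record tm =
  nstates :: nat
  nsyms :: nat
  delta :: "nat \<Rightarrow> nat \<Rightarrow> nat \<times> nat \<times> dir"

type_synonym conf = "nat \<times> (nat \<Rightarrow> nat) \<times> nat"  (* state, tape, head *)

definition wf_tm :: "tm \<Rightarrow> bool" where
  "wf_tm M \<longleftrightarrow> 3 \<le> nstates M \<and> 3 \<le> nsyms M \<and>
     (\<forall>q < nstates M. \<forall>a < nsyms M. case delta M q a of (q', a', d) \<Rightarrow>
        q' < nstates M \<and> a' < nsyms M)"

definition sym_of :: "bool \<Rightarrow> nat" where "sym_of b = (if b then 2 else 1)"

definition init_conf :: "bool list \<Rightarrow> conf" where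
  "init_conf w = (0, \<lambda>i. if i < length w then sym_of (w ! i) else 0, 0)"

fun move :: "dir \<Rightarrow> nat \<Rightarrow> nat" where
  "move MoveL h = h - 1"
| "move Stay h = h"
| "move MoveR h = h + 1"

definition halted :: "nat \<Rightarrow> bool" where "halted q \<longleftrightarrow> q = 1 \<or> q = 2"

fun step :: "tm \<Rightarrow> conf \<Rightarrow> conf" where
  "step M (q, tp, h) = (if halted q then (q, tp, h) else
     (case delta M q (tp h) of (q', a, d) \<Rightarrow> (q', tp(h := a), move d h)))"

definition run :: "tm \<Rightarrow> bool list \<Rightarrow> nat \<Rightarrow> conf" where
  "run M w t = (step M ^^ t) (init_conf w)"

definition cstate :: "conf \<Rightarrow> nat" where "cstate c = fst c"
definition ctape :: "conf \<Rightarrow> nat \<Rightarrow> nat" where "ctape c = fst (snd c)"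
definition chead :: "conf \<Rightarrow> nat" where "chead c = snd (snd c)"

definition decides_in_space :: "tm \<Rightarrow> bool list set \<Rightarrow> (nat \<Rightarrow> nat) \<Rightarrow> bool" where
  "decides_in_space M L s \<longleftrightarrow> wf_tm M \<and> (\<forall>w.
     (\<exists>t. halted (cstate (run M w t)) \<and> (cstate (run M w t) = 1 \<longleftrightarrow> w \<in> L)) \<and>
     (\<forall>t. chead (run M w t) < s (length w)))"

definition computes_in_time :: "tm \<Rightarrow> (bool list \<Rightarrow> bool list) \<Rightarrow> (nat \<Rightarrow> nat) \<Rightarrow> bool" where
  "computes_in_time M f T \<longleftrightarrow> wf_tm M \<and> (\<forall>w. \<exists>t \<le> T (length w).
     cstate (run M w t) = 1 \<and>
     (\<forall>i < length (f w). ctape (run M w t) i = sym_of (f w ! i)) \<and>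
     ctape (run M w t) (length (f w)) = 0)"

definition is_poly :: "(nat \<Rightarrow> nat) \<Rightarrow> bool" where
  "is_poly p \<longleftrightarrow> (\<exists>cs :: nat list. \<forall>n. p n = (\<Sum>i<length cs. cs ! i * n ^ i))"

definition kEXPSPACE :: "nat \<Rightarrow> bool list set set" where
  "kEXPSPACE k = {L. \<exists>M p. is_poly p \<and> decides_in_space M L (\<lambda>n. expk k (p n))}"

definition poly_reducible :: "bool list set \<Rightarrow> bool list set \<Rightarrow> bool" where
  "poly_reducible L1 L2 \<longleftrightarrow> (\<exists>f M p. is_poly p \<and> computes_in_time M f p \<and>
     (\<forall>w. w \<in> L1 \<longleftrightarrow> f w \<in> L2))"

definition complete_for :: "bool list set \<Rightarrow> bool list set set \<Rightarrow> bool" where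
  "complete_for L C \<longleftrightarrow> L \<in> C \<and> (\<forall>L' \<in> C. poly_reducible L' L)"

end

theory Submission
  imports Defs "HOL-Library.FuncSet" "HOL-Computational_Algebra.Polynomial"
begin

text \<open>Hardness: the rows of a tiling are the successive configurations of a space bounded machine. Its
  run is deterministic, but the head moves in both directions, so the tiles left of the head must
  propagate information from right to left and those right of the head from left to right. The two
  colour classes of a deterministic tile set allow exactly this. A halting run takes at most
  exponentially many steps in its space bound, hence fits below height \<open>expk (k + 1)\<close>, and for
  unrestricted height every tiling still ends with an accepting configuration.

  Membership: a deterministic tile set may still admit several successors of a row, since tiles are
  constrained only from one side. A tiling is a path between rows, each of which is a number with
  \<open>expk k (n)\<close> digits, and Savitch's recursion decides reachability in space polynomial in the
  length of a row. This recursion is written with arithmetic on numbers of one fixed width, which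
  a program on finitely many stacks, and therefore a single-tape machine, can perform in place. The
  width need not be computed in advance: it grows until the computation does not overflow.\<close>

section \<open>Turing machines over arbitrary finite alphabets\<close>

text \<open>Both problems are instances of one language \<open>tiling_lang star k\<close>, where
  \<open>star\<close> selects unrestricted height. On the membership side space is never estimated
  program by program: a function in \<open>cmp\<close> keeps a fixed number of values below
  \<open>N = 2 ^ s\<close>, so the space is \<open>s\<close>. The price is that every intermediate
  value must stay below \<open>N\<close>. Even constants are limited to 0 to 3, since
  \<open>s\<close> may be 2, powers are divided out one factor at a time, and whatever may overflow
  saturates. A row of width \<open>W\<close> over colours below \<open>x\<close> takes at most
  \<open>x * W\<close> bits, and the game tree has at most \<open>2 * (x * W) * (x * W + 1)\<close>
  levels when the height is unrestricted. This is polynomial in \<open>expk k (n + 1)\<close>, and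
  for \<open>k \<ge> 1\<close> a fixed power of \<open>expk k m\<close> is absorbed by
  \<open>expk k (c * m)\<close>. On the hardness side the first row spells the input, which takes
  one colour per position. These colours become powers of two, whose codes a stack program can write
  from a unary counter.\<close>

fun abstract_step :: "('q \<Rightarrow> 'a \<Rightarrow> 'q \<times> 'a \<times> dir) \<Rightarrow> 'q \<Rightarrow> 'q \<Rightarrow>
    'q \<times> (nat \<Rightarrow> 'a) \<times> nat \<Rightarrow> 'q \<times> (nat \<Rightarrow> 'a) \<times> nat" where
  "abstract_step \<delta> qa qr (q, tp, h) = (if q = qa \<or> q = qr then (q, tp, h) else
     (case \<delta> q (tp h) of (q', a, d) \<Rightarrow> (q', tp(h := a), move d h)))"

text \<open>The shift by 3 keeps all other elements clear of the prescribed values. The guards admit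
  coinciding points, so that fewer values can be prescribed.\<close>

lemma finite_inj_prescribed:
  assumes "finite X"
  shows "\<exists>e :: 'x \<Rightarrow> nat. inj_on e X \<and> e x0 = 0 \<and> (x1 \<noteq> x0 \<longrightarrow> e x1 = 1) \<and>
    (x2 \<noteq> x0 \<and> x2 \<noteq> x1 \<longrightarrow> e x2 = 2)"
proof -
  obtain g :: "'x \<Rightarrow> nat" where g: "inj_on g X"
    using finite_imp_inj_to_nat_seg[OF assms] by blast
  let ?e = "\<lambda>x. if x = x0 then 0 else if x = x1 then 1 else if x = x2 then 2 else g x + 3"
  have "inj_on ?e X"
    using g by (auto simp: inj_on_def)
  then show ?thesis
    by (intro exI[of _ ?e]) auto
qed

text \<open>Machines are built over convenient states and symbols; a numbering then gives the start,
  accepting and rejecting states, the blank and the input bits the values reserved for them.\<close>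

lemma tm_of_abstract:
  fixes \<delta> :: "'q \<Rightarrow> 'a \<Rightarrow> 'q \<times> 'a \<times> dir"
  assumes fin: "finite Q" "finite A"
    and cl: "\<forall>q\<in>Q. \<forall>a\<in>A. fst (\<delta> q a) \<in> Q \<and> fst (snd (\<delta> q a)) \<in> A"
    and Q: "q0 \<in> Q" "qa \<in> Q" "qr \<in> Q" "q0 \<noteq> qa" "q0 \<noteq> qr" "qa \<noteq> qr"
    and A: "b0 \<in> A" "b1 \<in> A" "b2 \<in> A" "b0 \<noteq> b1" "b0 \<noteq> b2" "b1 \<noteq> b2"
  obtains M eq ea where "wf_tm M"
    and "\<And>q. q \<in> Q \<Longrightarrow> eq q = 1 \<longleftrightarrow> q = qa" "\<And>q. q \<in> Q \<Longrightarrow> eq q = 2 \<longleftrightarrow> q = qr"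
    and "ea b0 = 0" "ea b1 = 1" "ea b2 = 2"
    and "\<And>w n q tp h. (abstract_step \<delta> qa qr ^^ n)
        (q0, (\<lambda>i. if i < length w then (if w ! i then b2 else b1) else b0), 0) = (q, tp, h) \<Longrightarrow>
        run M w n = (eq q, (\<lambda>i. ea (tp i)), h) \<and> q \<in> Q"
proof -
  note closed = cl[rule_format]
  obtain eq where eq: "inj_on eq Q" "eq q0 = 0" "eq qa = 1" "eq qr = (2::nat)"
    using finite_inj_prescribed[OF fin(1), of q0 qa qr] Q by auto
  obtain ea where ea: "inj_on ea A" "ea b0 = 0" "ea b1 = 1" "ea b2 = (2::nat)"
    using finite_inj_prescribed[OF fin(2), of b0 b1 b2] A by auto
  \<comment> \<open>The numbering may leave gaps below its maximum; well-formedness asks for a legal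
    transition there as well.\<close>
  define dl where "dl q a = (if q \<in> eq ` Q \<and> a \<in> ea ` A then
      (case \<delta> (inv_into Q eq q) (inv_into A ea a) of (q', a', d) \<Rightarrow> (eq q', ea a', d))
      else (0, 0, Stay))" for q a
  define M where "M = \<lparr>nstates = Suc (Max (eq ` Q)), nsyms = Suc (Max (ea ` A)), delta = dl\<rparr>"
  have Qb: "eq q \<le> Max (eq ` Q)" if "q \<in> Q" for q
    using fin(1) that by simp
  have Ab: "ea a \<le> Max (ea ` A)" if "a \<in> A" for a
    using fin(2) that by simp
  have "2 \<le> Max (eq ` Q)" "2 \<le> Max (ea ` A)"
    using Qb[OF Q(3)] Ab[OF A(3)] eq ea by auto
  moreover have "case dl q a of (q', a', d) \<Rightarrow> q' < Suc (Max (eq ` Q)) \<and> a' < Suc (Max (ea ` A))"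
    for q a
  proof (cases "q \<in> eq ` Q \<and> a \<in> ea ` A")
    case True
    then have "inv_into Q eq q \<in> Q" "inv_into A ea a \<in> A"
      by (auto intro: inv_into_into)
    from closed[OF this] show ?thesis
      using True Qb Ab by (auto simp: dl_def less_Suc_eq_le split: prod.split)
  qed (auto simp: dl_def)
  ultimately have wf: "wf_tm M"
    by (auto simp: wf_tm_def M_def)
  have dl: "dl (eq q) (ea a) = (case \<delta> q a of (q', a', d) \<Rightarrow> (eq q', ea a', d))"
    if "q \<in> Q" "a \<in> A" for q a
    using that eq(1) ea(1) by (simp add: dl_def)
  have e1: "eq q = 1 \<longleftrightarrow> q = qa" if "q \<in> Q" for q
    using eq Q that by (metis inj_onD)
  have e2: "eq q = 2 \<longleftrightarrow> q = qr" if "q \<in> Q" for q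
    using eq Q that by (metis inj_onD)
  have sim: "(abstract_step \<delta> qa qr ^^ n)
        (q0, (\<lambda>i. if i < length w then (if w ! i then b2 else b1) else b0), 0) = (q, tp, h) \<Longrightarrow>
        run M w n = (eq q, (\<lambda>i. ea (tp i)), h) \<and> q \<in> Q \<and> range tp \<subseteq> A" for w n q tp h
  proof (induction n arbitrary: q tp h)
    case 0
    then show ?case
      using eq ea Q A by (auto simp: run_def init_conf_def sym_of_def)
  next
    case (Suc n)
    obtain q1 tp1 h1 where c1: "(abstract_step \<delta> qa qr ^^ n)
        (q0, (\<lambda>i. if i < length w then (if w ! i then b2 else b1) else b0), 0) = (q1, tp1, h1)"
      by (rule prod_cases3)
    note IH = Suc.IH[OF c1]
    have st: "abstract_step \<delta> qa qr (q1, tp1, h1) = (q, tp, h)"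
      using Suc.prems c1 by simp
    have r: "run M w (Suc n) = step M (eq q1, (\<lambda>i. ea (tp1 i)), h1)"
      using IH by (simp add: run_def)
    show ?case
    proof (cases "q1 = qa \<or> q1 = qr")
      case True
      then show ?thesis
        using st r IH e1 e2 by (auto simp: halted_def)
    next
      case False
      obtain q' a d where d: "\<delta> q1 (tp1 h1) = (q', a, d)"
        by (rule prod_cases3)
      have "tp1 h1 \<in> A"
        using IH by auto
      then have "q' \<in> Q" "a \<in> A"
        using closed[of q1 "tp1 h1"] IH d by auto
      moreover have "\<not> halted (eq q1)"
        using False IH e1 e2 by (auto simp: halted_def)
      moreover have "q = q'" "tp = tp1(h1 := a)" "h = move d h1"
        using st False d by auto
      moreover have "(\<lambda>i. ea ((tp1(h1 := a)) i)) = (\<lambda>i. ea (tp1 i))(h1 := ea a)"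
        by auto
      moreover have "delta M (eq q1) (ea (tp1 h1)) = (eq q', ea a, d)"
        using dl[of q1 "tp1 h1"] IH \<open>tp1 h1 \<in> A\<close> d by (simp add: M_def)
      ultimately show ?thesis
        using r IH by (auto simp del: fun_upd_apply) (auto split: if_splits)
    qed
  qed
  show thesis
    by (rule that[of M eq ea]) (use wf e1 e2 ea sim in blast)+
qed

section \<open>A while language on stacks of bits\<close>

datatype com = Skip | Push nat bool | Pop nat | Seq com com (infixr ";;" 60)
  | If3 nat com com com | While nat com

type_synonym stacks = "nat \<Rightarrow> bool list"

definition fits :: "nat option \<Rightarrow> nat \<Rightarrow> bool" where
  "fits B n \<longleftrightarrow> (case B of None \<Rightarrow> True | Some b \<Rightarrow> n \<le> b)"

(* The optional bound limits the height of the stacks during the whole execution. *)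
inductive exec :: "nat option \<Rightarrow> com \<Rightarrow> stacks \<Rightarrow> nat \<Rightarrow> stacks \<Rightarrow> bool" for B where
  exec_Skip: "exec B Skip \<sigma> (Suc 0) \<sigma>"
| exec_Push: "fits B (Suc (length (\<sigma> r))) \<Longrightarrow> exec B (Push r b) \<sigma> (Suc 0) (\<sigma>(r := b # \<sigma> r))"
| exec_Pop: "exec B (Pop r) \<sigma> (Suc 0) (\<sigma>(r := tl (\<sigma> r)))"
| exec_Seq: "exec B c \<sigma> t \<sigma>' \<Longrightarrow> exec B d \<sigma>' u \<sigma>'' \<Longrightarrow> exec B (c ;; d) \<sigma> (Suc (t + u)) \<sigma>''"
| exec_If_Nil: "\<sigma> r = [] \<Longrightarrow> exec B c \<sigma> t \<sigma>' \<Longrightarrow> exec B (If3 r c d d') \<sigma> (Suc t) \<sigma>'"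
| exec_If_False: "\<sigma> r = False # xs \<Longrightarrow> exec B d \<sigma> t \<sigma>' \<Longrightarrow> exec B (If3 r c d d') \<sigma> (Suc t) \<sigma>'"
| exec_If_True: "\<sigma> r = True # xs \<Longrightarrow> exec B d' \<sigma> t \<sigma>' \<Longrightarrow> exec B (If3 r c d d') \<sigma> (Suc t) \<sigma>'"
| exec_While_Nil: "\<sigma> r = [] \<Longrightarrow> exec B (While r c) \<sigma> (Suc 0) \<sigma>"
| exec_While: "\<sigma> r \<noteq> [] \<Longrightarrow> exec B c \<sigma> t \<sigma>' \<Longrightarrow> exec B (While r c) \<sigma>' u \<sigma>'' \<Longrightarrow>
    exec B (While r c) \<sigma> (Suc (t + u)) \<sigma>''"

lemma exec_mono: "exec (Some B) c \<sigma> t \<sigma>' \<Longrightarrow> B \<le> B' \<Longrightarrow> exec (Some B') c \<sigma> t \<sigma>'"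
  by (induction rule: exec.induct) (auto intro: exec.intros simp: fits_def)

lemma exec_length_le: "exec None c \<sigma> t \<sigma>' \<Longrightarrow> length (\<sigma>' r) \<le> length (\<sigma> r) + t"
proof (induction arbitrary: r rule: exec.induct)
  case (exec_Seq c \<sigma> t \<sigma>' d u \<sigma>'')
  show ?case using exec_Seq.IH(1)[of r] exec_Seq.IH(2)[of r] by simp
next
  case (exec_While \<sigma> ra c t \<sigma>' u \<sigma>'')
  show ?case using exec_While.IH(1)[of r] exec_While.IH(2)[of r] by simp
qed (auto simp: le_SucI)

text \<open>A stack grows by at most one bit per time unit. The reduction is analysed by time only
  and gets from here the height bound that the compiler asks for.\<close>

lemma exec_space_le_time:
  "exec None c \<sigma> t \<sigma>' \<Longrightarrow> (\<And>r. length (\<sigma> r) + t \<le> b) \<Longrightarrow> exec (Some b) c \<sigma> t \<sigma>'"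
proof (induction rule: exec.induct)
  case (exec_Push \<sigma> r b')
  have "Suc (length (\<sigma> r)) \<le> b" using exec_Push.prems[of r] by simp
  then show ?case by (intro exec.exec_Push) (simp add: fits_def)
next
  case (exec_Seq c \<sigma> t \<sigma>' d u \<sigma>'')
  have "length (\<sigma> r) + t \<le> b" for r using exec_Seq.prems[of r] by simp
  moreover have "length (\<sigma>' r) + u \<le> b" for r
    using exec_Seq.prems[of r] exec_length_le[OF exec_Seq.hyps(1), of r] by simp
  ultimately show ?case using exec_Seq.IH by (auto intro: exec.exec_Seq)
next
  case (exec_While \<sigma> ra c t \<sigma>' u \<sigma>'')
  have "length (\<sigma> r) + t \<le> b" for r using exec_While.prems[of r] by simp
  moreover have "length (\<sigma>' r) + u \<le> b" for r
    using exec_While.prems[of r] exec_length_le[OF exec_While.hyps(2), of r] by simp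
  ultimately show ?case using exec_While.IH exec_While.hyps(1) by (auto intro: exec.exec_While)
next
  case (exec_If_Nil \<sigma> r c t \<sigma>' d d')
  have "length (\<sigma> r) + t \<le> b" for r using exec_If_Nil.prems[of r] by simp
  then show ?case using exec_If_Nil by (auto intro: exec.exec_If_Nil)
next
  case (exec_If_False \<sigma> r xs d t \<sigma>' c d')
  have "length (\<sigma> r) + t \<le> b" for r using exec_If_False.prems[of r] by simp
  then show ?case using exec_If_False by (auto intro: exec.exec_If_False)
next
  case (exec_If_True \<sigma> r xs d' t \<sigma>' c d)
  have "length (\<sigma> r) + t \<le> b" for r using exec_If_True.prems[of r] by simp
  then show ?case using exec_If_True by (auto intro: exec.exec_If_True)
qed (auto intro: exec.intros)

section \<open>Compilation to a single-tape machine\<close>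

text \<open>Each stack occupies one track of the tape with its top in cell 0. A continuation, that is,
  the list of commands still to be executed, serves as the control state; only finitely many
  continuations are reachable.\<close>

type_synonym cell = "bool \<times> (nat \<Rightarrow> bool option)"

text \<open>A push walks right in \<open>PushR\<close>, carrying the bit displaced from the previous
  cell, and \<open>Ret\<close> brings the head home. A pop walks to the end of the track in
  \<open>PopR\<close> and shifts the track on the way back in \<open>PopL\<close>, again carrying
  the content of one cell.\<close>

datatype control = Start | Accept | Reject | Ctl "com list" | PushR nat "bool option" "com list"
  | Ret "com list" | PopR nat "com list" | PopL nat "bool option" "com list"

fun ctl :: "com \<Rightarrow> com list \<Rightarrow> cell \<Rightarrow> control \<times> cell \<times> dir" where
  "ctl Skip k s = (Ctl k, s, Stay)"
| "ctl (Push r b) k s = (PushR r (Some b) k, s, Stay)"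
| "ctl (Pop r) k s = (PopR r k, s, Stay)"
| "ctl (c ;; d) k s = (Ctl (c # d # k), s, Stay)"
| "ctl (If3 r c d e) k s =
    (Ctl ((case snd s r of None \<Rightarrow> c | Some b \<Rightarrow> if b then e else d) # k), s, Stay)"
| "ctl (While r c) k s = (if snd s r = None then Ctl k else Ctl (c # While r c # k), s, Stay)"

text \<open>Cell 0 carries a mark by which the head finds its way home. It is set in the first step
  and erased in the last, after which a cell that uses only track 0 is an input symbol again. The
  answer is the emptiness of stack 1.\<close>

fun stack_delta :: "com \<Rightarrow> control \<Rightarrow> cell \<Rightarrow> control \<times> cell \<times> dir" where
  "stack_delta c0 Start (m, f) = (Ctl [c0], (True, f), Stay)"
| "stack_delta c0 (Ctl []) (m, f) = (if f 1 = None then Accept else Reject, (False, f), Stay)"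
| "stack_delta c0 (Ctl (c # k)) s = ctl c k s"
| "stack_delta c0 (PushR r x k) (m, f) =
    (if f r = None then (Ret k, (m, f(r := x)), Stay) else (PushR r (f r) k, (m, f(r := x)), MoveR))"
| "stack_delta c0 (Ret k) (m, f) = (if m then (Ctl k, (m, f), Stay) else (Ret k, (m, f), MoveL))"
| "stack_delta c0 (PopR r k) (m, f) =
    (if f r = None then (PopL r None k, (m, f), if m then Stay else MoveL)
     else (PopR r k, (m, f), MoveR))"
| "stack_delta c0 (PopL r x k) (m, f) =
    (if m then (Ctl k, (m, f(r := x)), Stay) else (PopL r (f r) k, (m, f(r := x)), MoveL))"
| "stack_delta c0 q s = (q, s, Stay)"

abbreviation "stack_step c0 \<equiv> abstract_step (stack_delta c0) Accept Reject"

text \<open>Time and head position are bounded together, since the same compiler serves the space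
  bounded decision procedure and the polynomial time reduction.\<close>

definition reaches :: "com \<Rightarrow> nat \<Rightarrow> nat \<Rightarrow> control \<times> (nat \<Rightarrow> cell) \<times> nat \<Rightarrow>
    control \<times> (nat \<Rightarrow> cell) \<times> nat \<Rightarrow> bool" where
  "reaches c0 B N x y \<longleftrightarrow> (\<exists>n \<le> N. (stack_step c0 ^^ n) x = y \<and>
     (\<forall>i \<le> n. snd (snd ((stack_step c0 ^^ i) x)) \<le> B))"

lemma reaches_refl: "h \<le> B \<Longrightarrow> reaches c0 B 0 (q, tp, h) (q, tp, h)"
  by (simp add: reaches_def)

lemma reaches_mono: "reaches c0 B N x y \<Longrightarrow> N \<le> N' \<Longrightarrow> reaches c0 B N' x y"
  unfolding reaches_def by (elim exE conjE, rule exI, intro conjI, erule (1) order_trans)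

lemma reaches_trans:
  assumes "reaches c0 B N x y" "reaches c0 B N' y z" "N + N' \<le> N''"
  shows "reaches c0 B N'' x z"
proof -
  obtain n where n: "n \<le> N" "(stack_step c0 ^^ n) x = y"
    "\<And>i. i \<le> n \<Longrightarrow> snd (snd ((stack_step c0 ^^ i) x)) \<le> B"
    using assms(1) by (auto simp: reaches_def)
  obtain m where m: "m \<le> N'" "(stack_step c0 ^^ m) y = z"
    "\<And>i. i \<le> m \<Longrightarrow> snd (snd ((stack_step c0 ^^ i) y)) \<le> B"
    using assms(2) by (auto simp: reaches_def)
  have shift: "(stack_step c0 ^^ (j + n)) x = (stack_step c0 ^^ j) y" for j
    using n(2) by (simp add: funpow_add)
  have "snd (snd ((stack_step c0 ^^ i) x)) \<le> B" if "i \<le> m + n" for i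
  proof (cases "i \<le> n")
    case False
    then show ?thesis using shift[of "i - n"] m(3)[of "i - n"] that by auto
  qed (use n(3) in auto)
  moreover have "(stack_step c0 ^^ (m + n)) x = z"
    using shift m(2) by simp
  ultimately show ?thesis
    unfolding reaches_def using n(1) m(1) assms(3) by (intro exI[of _ "m + n"]) auto
qed

lemma reaches_step:
  assumes "stack_step c0 (q, tp, h) = y" "h \<le> B" "snd (snd y) \<le> B"
  shows "reaches c0 B 1 (q, tp, h) y"
proof -
  have "snd (snd ((stack_step c0 ^^ i) (q, tp, h))) \<le> B" if "i \<le> 1" for i
    using that assms by (cases i) auto
  then show ?thesis
    unfolding reaches_def using assms by (intro exI[of _ 1]) auto
qed

lemma reaches_Cons:
  assumes "stack_step c0 (q, tp, h) = (q', tp', h')" "h \<le> B" "reaches c0 B N (q', tp', h') z"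
  shows "reaches c0 B (Suc N) (q, tp, h) z"
proof (rule reaches_trans[OF reaches_step[OF assms(1,2)] assms(3)])
  obtain n where "\<forall>i \<le> n. snd (snd ((stack_step c0 ^^ i) (q', tp', h'))) \<le> B"
    using assms(3) by (auto simp: reaches_def)
  then show "snd (snd (q', tp', h')) \<le> B"
    by (metis funpow_0 le0)
qed simp

section \<open>Sweeps over a track of the tape\<close>

definition nth_opt :: "bool list \<Rightarrow> nat \<Rightarrow> bool option" where
  "nth_opt xs i = (if i < length xs then Some (xs ! i) else None)"

lemma nth_opt_simps [simp]:
  "nth_opt [] i = None" "nth_opt (x # xs) 0 = Some x" "nth_opt (x # xs) (Suc i) = nth_opt xs i"
  by (simp_all add: nth_opt_def)

definition write_track :: "nat \<Rightarrow> nat \<Rightarrow> bool list \<Rightarrow> (nat \<Rightarrow> cell) \<Rightarrow> nat \<Rightarrow> cell" where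
  "write_track r i xs tp j = (if i \<le> j then (fst (tp j), (snd (tp j))(r := nth_opt xs (j - i))) else tp j)"

lemma write_track_shift:
  "write_track r i (x # xs) tp =
   (write_track r (Suc i) xs tp)(i := (fst (tp i), (snd (tp i))(r := Some x)))"
proof
  fix j
  show "write_track r i (x # xs) tp j =
   ((write_track r (Suc i) xs tp)(i := (fst (tp i), (snd (tp i))(r := Some x)))) j"
  proof (cases "Suc i \<le> j")
    case True
    then have "j - i = Suc (j - Suc i)" by simp
    then show ?thesis using True by (simp add: write_track_def)
  qed (auto simp: write_track_def)
qed

lemma write_track_below:
  "write_track r (Suc i) xs (tp(i := s)) = (write_track r (Suc i) xs tp)(i := s)"
  by (auto simp: write_track_def fun_eq_iff)

text \<open>Generalised to the part of the track from cell \<open>i\<close> on, so that induction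
  applies: the bit in the control is the one just displaced from cell \<open>i - 1\<close>, or the
  pushed bit when \<open>i = 0\<close>.\<close>

lemma push_right:
  "i + length xs \<le> B \<Longrightarrow> reaches c0 B (Suc (length xs)) (PushR r (Some b) k, write_track r i xs tp, i)
     (Ret k, write_track r i (b # xs) tp, i + length xs)"
proof (induction xs arbitrary: i b tp)
  case Nil
  have "(write_track r i [] tp)(i := (fst (tp i), (snd (tp i))(r := Some b))) = write_track r i [b] tp"
    by (auto simp: write_track_def fun_eq_iff nth_opt_def)
  then have "stack_step c0 (PushR r (Some b) k, write_track r i [] tp, i) =
    (Ret k, write_track r i [b] tp, i)"
    by (simp add: write_track_def[of r i "[]" tp i])
  from reaches_step[OF this] show ?case using Nil by simp
next
  case (Cons x xs)
  let ?tp = "tp(i := (fst (tp i), (snd (tp i))(r := Some b)))"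
  have "stack_step c0 (PushR r (Some b) k, write_track r i (x # xs) tp, i) =
     (PushR r (Some x) k, write_track r (Suc i) xs ?tp, Suc i)"
    by (simp add: write_track_shift write_track_below)
  from reaches_Cons[OF this _ Cons.IH[of "Suc i" x ?tp]]
  have "reaches c0 B (Suc (Suc (length xs))) (PushR r (Some b) k, write_track r i (x # xs) tp, i)
     (Ret k, write_track r (Suc i) (x # xs) ?tp, Suc i + length xs)"
    using Cons.prems by (simp del: fun_upd_apply)
  moreover have "write_track r (Suc i) (x # xs) ?tp = write_track r i (b # x # xs) tp"
    by (simp add: write_track_shift[of r i] write_track_below)
  ultimately show ?case by (simp del: fun_upd_apply)
qed

lemma return_left:
  "(\<And>j. fst (tp j) \<longleftrightarrow> j = 0) \<Longrightarrow> i \<le> B \<Longrightarrow>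
    reaches c0 B (Suc i) (Ret k, tp, i) (Ctl k, tp, 0)"
proof (induction i)
  case 0
  have "stack_step c0 (Ret k, tp, 0) = (Ctl k, tp, 0)"
    using 0(1)[of 0] by (cases "tp 0") auto
  from reaches_step[OF this] show ?case by simp
next
  case (Suc i)
  have "stack_step c0 (Ret k, tp, Suc i) = (Ret k, tp, i)"
    using Suc.prems(1)[of "Suc i"] by (cases "tp (Suc i)") auto
  from reaches_Cons[OF this _ Suc.IH] show ?case using Suc.prems by simp
qed

lemma pop_right:
  "i + length xs \<le> B \<Longrightarrow> reaches c0 B (length xs) (PopR r k, write_track r i xs tp, i)
     (PopR r k, write_track r i xs tp, i + length xs)"
proof (induction xs arbitrary: i tp)
  case Nil
  then show ?case by (simp add: reaches_refl)
next
  case (Cons x xs)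
  let ?tp = "tp(i := (fst (tp i), (snd (tp i))(r := Some x)))"
  have eq: "write_track r (Suc i) xs ?tp = write_track r i (x # xs) tp"
    by (simp add: write_track_shift write_track_below)
  have "stack_step c0 (PopR r k, write_track r i (x # xs) tp, i) =
     (PopR r k, write_track r (Suc i) xs ?tp, Suc i)"
    by (simp add: write_track_shift write_track_below)
  from reaches_Cons[OF this _ Cons.IH[of "Suc i" ?tp]]
  show ?case using Cons.prems unfolding eq by simp
qed

text \<open>The sweep writes into each cell what it has just read one cell further right. Started
  with \<open>None\<close> at the last occupied cell, it removes the top of the stack.\<close>

lemma pop_left:
  "(\<And>j. fst (tp j) \<longleftrightarrow> j = 0) \<Longrightarrow> i \<le> B \<Longrightarrow>
    reaches c0 B (Suc i) (PopL r x k, tp, i)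
      (Ctl k, (\<lambda>j. (fst (tp j), if j < i then (snd (tp j))(r := snd (tp (Suc j)) r)
         else if j = i then (snd (tp j))(r := x) else snd (tp j))), 0)"
proof (induction i arbitrary: x tp)
  case 0
  have "stack_step c0 (PopL r x k, tp, 0) = (Ctl k, tp(0 := (fst (tp 0), (snd (tp 0))(r := x))), 0)"
    using 0(1)[of 0] by (cases "tp 0") auto
  moreover have "tp(0 := (fst (tp 0), (snd (tp 0))(r := x))) = (\<lambda>j. (fst (tp j), if j < 0 then (snd (tp j))(r := snd (tp (Suc j)) r)
         else if j = 0 then (snd (tp j))(r := x) else snd (tp j)))"
    by (auto simp: fun_eq_iff)
  ultimately have "stack_step c0 (PopL r x k, tp, 0) = (Ctl k, (\<lambda>j. (fst (tp j), if j < 0 then (snd (tp j))(r := snd (tp (Suc j)) r)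
         else if j = 0 then (snd (tp j))(r := x) else snd (tp j))), 0)"
    by simp
  from reaches_step[OF this] show ?case by simp
next
  case (Suc i)
  let ?tp = "tp(Suc i := (fst (tp (Suc i)), (snd (tp (Suc i)))(r := x)))"
  have st: "stack_step c0 (PopL r x k, tp, Suc i) = (PopL r (snd (tp (Suc i)) r) k, ?tp, i)"
    using Suc.prems(1)[of "Suc i"] by (cases "tp (Suc i)") auto
  have m: "fst (?tp j) \<longleftrightarrow> j = 0" for j
    using Suc.prems(1)[of j] Suc.prems(1)[of "Suc i"] by auto
  have eq: "(\<lambda>j. (fst (?tp j), if j < i then (snd (?tp j))(r := snd (?tp (Suc j)) r)
         else if j = i then (snd (?tp j))(r := snd (tp (Suc i)) r) else snd (?tp j))) =
    (\<lambda>j. (fst (tp j), if j < Suc i then (snd (tp j))(r := snd (tp (Suc j)) r)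
         else if j = Suc i then (snd (tp j))(r := x) else snd (tp j)))"
    by (auto simp: fun_eq_iff less_Suc_eq)
  from reaches_Cons[OF st _ Suc.IH[OF m, of "snd (tp (Suc i)) r", unfolded eq]]
  show ?case using Suc.prems by simp
qed

definition tape_of :: "stacks \<Rightarrow> nat \<Rightarrow> cell" where
  "tape_of \<sigma> i = (i = 0, \<lambda>r. nth_opt (\<sigma> r) i)"

lemma tape_of_update: "tape_of (\<sigma>(r := xs)) = write_track r 0 xs (tape_of \<sigma>)"
  by (auto simp: tape_of_def write_track_def fun_eq_iff)

lemma fst_tape_of [simp]: "fst (tape_of \<sigma> j) \<longleftrightarrow> j = 0"
  by (simp add: tape_of_def)

lemma snd_tape_of_None: "snd (tape_of \<sigma> 0) r = None \<longleftrightarrow> \<sigma> r = []"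
  by (simp add: tape_of_def nth_opt_def)

text \<open>A push or pop takes two sweeps over its track and a constant number of control moves;
  \<open>2 * B + 6\<close> is one generous cost for every kind of command.\<close>

lemma sim_Push:
  assumes "length (\<sigma> r) \<le> B"
  shows "reaches c0 B (2 * B + 6) (Ctl (Push r b # k), tape_of \<sigma>, 0) (Ctl k, tape_of (\<sigma>(r := b # \<sigma> r)), 0)"
proof -
  have "reaches c0 B (Suc (length (\<sigma> r))) (PushR r (Some b) k, tape_of \<sigma>, 0)
     (Ret k, tape_of (\<sigma>(r := b # \<sigma> r)), length (\<sigma> r))"
    using push_right[of 0 "\<sigma> r" B c0 r b k "tape_of \<sigma>"] assms tape_of_update[of \<sigma> r "\<sigma> r"]
    by (simp add: tape_of_update)
  then have "reaches c0 B (Suc (length (\<sigma> r)) + Suc (length (\<sigma> r))) (PushR r (Some b) k, tape_of \<sigma>, 0)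
     (Ctl k, tape_of (\<sigma>(r := b # \<sigma> r)), 0)"
    by (rule reaches_trans[OF _ return_left]) (use assms in auto)
  then have "reaches c0 B (Suc (Suc (length (\<sigma> r)) + Suc (length (\<sigma> r)))) (Ctl (Push r b # k), tape_of \<sigma>, 0)
     (Ctl k, tape_of (\<sigma>(r := b # \<sigma> r)), 0)"
    by (rule reaches_Cons[rotated 2]) auto
  then show ?thesis
    by (rule reaches_trans[OF _ reaches_refl]) (use assms in auto)
qed

lemma sim_Pop:
  assumes "length (\<sigma> r) \<le> B"
  shows "reaches c0 B (2 * B + 6) (Ctl (Pop r # k), tape_of \<sigma>, 0) (Ctl k, tape_of (\<sigma>(r := tl (\<sigma> r))), 0)"
proof -
  let ?l = "length (\<sigma> r)"
  have 1: "reaches c0 B ?l (PopR r k, tape_of \<sigma>, 0) (PopR r k, tape_of \<sigma>, ?l)"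
    using pop_right[of 0 "\<sigma> r" B c0 r k "tape_of \<sigma>"] assms tape_of_update[of \<sigma> r "\<sigma> r"] by simp
  \<comment> \<open>On an empty stack the head is at cell 0 already and stays there, in accordance
    with the truncated \<open>?l - 1\<close>.\<close>
  have 2: "stack_step c0 (PopR r k, tape_of \<sigma>, ?l) = (PopL r None k, tape_of \<sigma>, ?l - 1)"
    by (auto simp: tape_of_def nth_opt_def fun_eq_iff)
  have eq: "(\<lambda>j. (fst (tape_of \<sigma> j), if j < ?l - 1 then (snd (tape_of \<sigma> j))(r := snd (tape_of \<sigma> (Suc j)) r)
         else if j = ?l - 1 then (snd (tape_of \<sigma> j))(r := None) else snd (tape_of \<sigma> j)))
     = tape_of (\<sigma>(r := tl (\<sigma> r)))"
    by (auto simp: fun_eq_iff tape_of_def nth_opt_def nth_tl)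
  have 3: "reaches c0 B (Suc (?l - 1)) (PopL r None k, tape_of \<sigma>, ?l - 1)
      (Ctl k, tape_of (\<sigma>(r := tl (\<sigma> r))), 0)"
    using pop_left[of "tape_of \<sigma>" "?l - 1" B c0 r None k] assms unfolding eq by simp
  have "reaches c0 B (Suc (Suc (?l - 1))) (PopR r k, tape_of \<sigma>, ?l) (Ctl k, tape_of (\<sigma>(r := tl (\<sigma> r))), 0)"
    by (rule reaches_Cons[OF 2 assms 3])
  from reaches_trans[OF 1 this order_refl] 
  have "reaches c0 B (Suc (?l + Suc (Suc (?l - 1)))) (Ctl (Pop r # k), tape_of \<sigma>, 0) (Ctl k, tape_of (\<sigma>(r := tl (\<sigma> r))), 0)"
    by (rule reaches_Cons[rotated 2]) auto
  then show ?thesis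
    by (rule reaches_trans[OF _ reaches_refl]) (use assms in auto)
qed

lemma sim_control:
  assumes "ctl c k (tape_of \<sigma> 0) = (Ctl k', tape_of \<sigma> 0, Stay)"
    and "reaches c0 B N (Ctl k', tape_of \<sigma>, 0) y" "Suc N \<le> N'"
  shows "reaches c0 B N' (Ctl (c # k), tape_of \<sigma>, 0) y"
proof -
  have "stack_step c0 (Ctl (c # k), tape_of \<sigma>, 0) = (Ctl k', tape_of \<sigma>, 0)"
    using assms(1) by simp
  from reaches_Cons[OF this _ assms(2)] have r: "reaches c0 B (Suc N) (Ctl (c # k), tape_of \<sigma>, 0) y"
    by simp
  then show ?thesis
    by (rule reaches_mono) (rule assms(3))
qed

lemma sim_exec:
  "exec (Some B) c \<sigma> t \<sigma>' \<Longrightarrow> (\<And>r. length (\<sigma> r) \<le> B) \<Longrightarrow>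
    reaches c0 B (t * (2 * B + 6)) (Ctl (c # k), tape_of \<sigma>, 0) (Ctl k, tape_of \<sigma>', 0) \<and>
    (\<forall>r. length (\<sigma>' r) \<le> B)"
proof (induction arbitrary: k rule: exec.induct)
  case (exec_Skip \<sigma>)
  show ?case
    by (auto intro!: sim_control[OF _ reaches_refl] simp: exec_Skip)
next
  case (exec_Push \<sigma> r b)
  then have "\<forall>ra. length ((\<sigma>(r := b # \<sigma> r)) ra) \<le> B" by (simp add: fits_def)
  moreover have "reaches c0 B (Suc 0 * (2 * B + 6)) (Ctl (Push r b # k), tape_of \<sigma>, 0)
      (Ctl k, tape_of (\<sigma>(r := b # \<sigma> r)), 0)"
    using sim_Push[of \<sigma> r B c0 b k] exec_Push.prems[of r] by (simp del: fun_upd_apply)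
  ultimately show ?case by blast
next
  case (exec_Pop r \<sigma>)
  then have "\<forall>ra. length ((\<sigma>(r := tl (\<sigma> r))) ra) \<le> B" by (simp add: le_diff_conv le_SucI)
  moreover have "reaches c0 B (Suc 0 * (2 * B + 6)) (Ctl (Pop r # k), tape_of \<sigma>, 0)
      (Ctl k, tape_of (\<sigma>(r := tl (\<sigma> r))), 0)"
    using sim_Pop[of \<sigma> r B c0 k] exec_Pop[of r] by (simp del: fun_upd_apply)
  ultimately show ?case by blast
next
  case (exec_Seq c \<sigma> t \<sigma>' d u \<sigma>'')
  from reaches_trans[OF conjunct1[OF exec_Seq.IH(1)] conjunct1[OF exec_Seq.IH(2)] order_refl]
  have "reaches c0 B (t * (2 * B + 6) + u * (2 * B + 6)) (Ctl (c # d # k), tape_of \<sigma>, 0) (Ctl k, tape_of \<sigma>'', 0)"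
    using exec_Seq.prems exec_Seq.IH(1) by blast
  then have "reaches c0 B (Suc (t + u) * (2 * B + 6)) (Ctl ((c ;; d) # k), tape_of \<sigma>, 0) (Ctl k, tape_of \<sigma>'', 0)"
    by (rule sim_control[rotated]) (auto simp: algebra_simps)
  then show ?case using exec_Seq by blast
next
  case (exec_If_Nil \<sigma> r c t \<sigma>' d d')
  have "reaches c0 B (Suc t * (2 * B + 6)) (Ctl (If3 r c d d' # k), tape_of \<sigma>, 0) (Ctl k, tape_of \<sigma>', 0)"
    by (rule sim_control[OF _ conjunct1[OF exec_If_Nil.IH]])
      (use exec_If_Nil in \<open>auto simp: tape_of_def\<close>)
  then show ?case using exec_If_Nil by blast
next
  case (exec_If_False \<sigma> r xs d t \<sigma>' c d')
  have "reaches c0 B (Suc t * (2 * B + 6)) (Ctl (If3 r c d d' # k), tape_of \<sigma>, 0) (Ctl k, tape_of \<sigma>', 0)"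
    by (rule sim_control[OF _ conjunct1[OF exec_If_False.IH]])
      (use exec_If_False in \<open>auto simp: tape_of_def\<close>)
  then show ?case using exec_If_False by blast
next
  case (exec_If_True \<sigma> r xs d' t \<sigma>' c d)
  have "reaches c0 B (Suc t * (2 * B + 6)) (Ctl (If3 r c d d' # k), tape_of \<sigma>, 0) (Ctl k, tape_of \<sigma>', 0)"
    by (rule sim_control[OF _ conjunct1[OF exec_If_True.IH]])
      (use exec_If_True in \<open>auto simp: tape_of_def\<close>)
  then show ?case using exec_If_True by blast
next
  case (exec_While_Nil \<sigma> r c)
  have "reaches c0 B (Suc 0 * (2 * B + 6)) (Ctl (While r c # k), tape_of \<sigma>, 0) (Ctl k, tape_of \<sigma>, 0)"
    by (rule sim_control[OF _ reaches_refl]) (use exec_While_Nil in \<open>auto simp: tape_of_def\<close>)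
  then show ?case using exec_While_Nil by blast
next
  case (exec_While \<sigma> r c t \<sigma>' u \<sigma>'')
  from reaches_trans[OF conjunct1[OF exec_While.IH(1)] conjunct1[OF exec_While.IH(2)] order_refl]
  have "reaches c0 B (t * (2 * B + 6) + u * (2 * B + 6)) (Ctl (c # While r c # k), tape_of \<sigma>, 0) (Ctl k, tape_of \<sigma>'', 0)"
    using exec_While.prems exec_While.IH(1) by blast
  then have "reaches c0 B (Suc (t + u) * (2 * B + 6)) (Ctl (While r c # k), tape_of \<sigma>, 0) (Ctl k, tape_of \<sigma>'', 0)"
    by (rule sim_control[rotated])
      (use exec_While.hyps snd_tape_of_None[of \<sigma> r] in \<open>auto simp: algebra_simps\<close>)
  then show ?case using exec_While by blast
qed

text \<open>Every list in this set still begins with a part of \<open>c\<close>; what remains after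
  \<open>c\<close>, namely \<open>k\<close>, has to be added separately. The body of a loop is
  followed by the loop itself, so iterating it creates no new lists.\<close>

fun conts :: "com \<Rightarrow> com list \<Rightarrow> com list set" where
  "conts (c ;; d) k = insert ((c ;; d) # k) (conts c (d # k) \<union> conts d k)"
| "conts (If3 r c d e) k = insert (If3 r c d e # k) (conts c k \<union> conts d k \<union> conts e k)"
| "conts (While r c) k = insert (While r c # k) (conts c (While r c # k))"
| "conts c k = {c # k}"

lemma finite_conts: "finite (conts c k)"
  by (induction c arbitrary: k) auto

lemma conts_self: "c # k \<in> conts c k"
  by (cases c) auto

fun regs :: "com \<Rightarrow> nat set" where
  "regs Skip = {}"
| "regs (Push r b) = {r}"
| "regs (Pop r) = {r}"
| "regs (c ;; d) = regs c \<union> regs d"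
| "regs (If3 r c d e) = insert r (regs c \<union> regs d \<union> regs e)"
| "regs (While r c) = insert r (regs c)"

lemma finite_regs: "finite (regs c)"
  by (induction c) auto

definition controls :: "nat set \<Rightarrow> com list set \<Rightarrow> control set" where
  "controls X K = {Start, Accept, Reject} \<union> Ctl ` K \<union> Ret ` K \<union>
     (\<Union>r\<in>X. \<Union>k\<in>K. insert (PopR r k) (range (\<lambda>x. PushR r x k) \<union> range (\<lambda>x. PopL r x k)))"

lemma controlsI:
  "Start \<in> controls X K" "Accept \<in> controls X K" "Reject \<in> controls X K"
  "k \<in> K \<Longrightarrow> Ctl k \<in> controls X K" "k \<in> K \<Longrightarrow> Ret k \<in> controls X K"
  "r \<in> X \<Longrightarrow> k \<in> K \<Longrightarrow> PopR r k \<in> controls X K"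
  "r \<in> X \<Longrightarrow> k \<in> K \<Longrightarrow> PushR r x k \<in> controls X K"
  "r \<in> X \<Longrightarrow> k \<in> K \<Longrightarrow> PopL r x k \<in> controls X K"
  unfolding controls_def by blast+

lemma conts_closed:
  "k' \<in> conts c k \<Longrightarrow> regs c \<subseteq> X \<Longrightarrow> k \<in> K \<Longrightarrow> conts c k \<subseteq> K \<Longrightarrow>
    \<exists>d l. k' = d # l \<and> fst (ctl d l s) \<in> controls X K \<and> fst (snd (ctl d l s)) = s \<and> regs d \<subseteq> X"
proof (induction c arbitrary: k)
  case (Seq c d)
  have "d # k \<in> K" "c # d # k \<in> K"
    using conts_self Seq.prems by auto
  then show ?case using Seq by (auto simp: controlsI)
next
  case (If3 r c d e)
  have "c # k \<in> K" "d # k \<in> K" "e # k \<in> K"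
    using conts_self If3.prems by auto
  then show ?case using If3 by (auto simp: controlsI split: option.split)
next
  case (While r c)
  have "While r c # k \<in> K" "c # While r c # k \<in> K"
    using conts_self While.prems by auto
  then show ?case using While by (auto simp: controlsI)
qed (auto simp: controlsI)

definition cells :: "nat set \<Rightarrow> cell set" where
  "cells X = UNIV \<times> {f. \<forall>r. r \<notin> X \<longrightarrow> f r = None}"

lemma finite_cells: "finite X \<Longrightarrow> finite (cells X)"
  unfolding cells_def
  using finite_set_of_finite_funs[of X "UNIV :: bool option set" None] by simp

lemma finite_controls: "finite X \<Longrightarrow> finite K \<Longrightarrow> finite (controls X K)"
  unfolding controls_def by simp

lemma stack_delta_closed:
  assumes "regs c0 \<subseteq> X" "q \<in> controls X (insert [] (conts c0 []))" "s \<in> cells X"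
  shows "fst (stack_delta c0 q s) \<in> controls X (insert [] (conts c0 [])) \<and>
    fst (snd (stack_delta c0 q s)) \<in> cells X"
proof -
  let ?K = "insert [] (conts c0 [])"
  obtain m f where s: "s = (m, f)" "\<And>r. r \<notin> X \<Longrightarrow> f r = None"
    using assms(3) by (cases s) (auto simp: cells_def)
  consider "q = Start" | "q = Accept" | "q = Reject" | "q = Ctl []"
    | k where "q = Ctl k" "k \<in> conts c0 []" | k where "q = Ret k" "k \<in> ?K"
    | r k where "q = PopR r k" "r \<in> X" "k \<in> ?K" | r x k where "q = PushR r x k" "r \<in> X" "k \<in> ?K"
    | r x k where "q = PopL r x k" "r \<in> X" "k \<in> ?K"
    using assms(2) by (auto simp: controls_def)
  then show ?thesis
  proof cases
    case 1
    then show ?thesis using s conts_self[of c0 "[]"] by (simp add: controlsI cells_def)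
  next
    case 5
    obtain d l where "k = d # l" "fst (ctl d l s) \<in> controls X ?K" "fst (snd (ctl d l s)) = s"
      using conts_closed[OF 5(2) assms(1), of ?K s] by blast
    then show ?thesis using 5(1) assms(3) by simp
  qed (use s in \<open>simp_all add: controlsI cells_def\<close>)
qed

definition init_stacks :: "bool list \<Rightarrow> stacks" where
  "init_stacks w r = (if r = 0 then w else [])"

text \<open>The output is promised only if all stacks but 0 end up empty: then each cell without the
  mark is the plain symbol of a bit or a blank.\<close>

theorem compile_stacks:
  obtains M where "wf_tm M"
    and "\<And>w B t \<sigma>. exec (Some B) c0 (init_stacks w) t \<sigma> \<Longrightarrow> length w \<le> B \<Longrightarrow>
      \<exists>n \<le> t * (2 * B + 6) + 2. cstate (run M w n) = (if \<sigma> 1 = [] then 1 else 2) \<and>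
        (\<forall>i. chead (run M w i) \<le> B) \<and>
        ((\<forall>r > 0. \<sigma> r = []) \<longrightarrow> (\<forall>i < length (\<sigma> 0). ctape (run M w n) i = sym_of (\<sigma> 0 ! i)) \<and>
           ctape (run M w n) (length (\<sigma> 0)) = 0)"
proof -
  define X where "X = insert 0 (regs c0)"
  let ?K = "insert [] (conts c0 [])"
  have X: "finite X" "regs c0 \<subseteq> X" "0 \<in> X"
    using finite_regs by (auto simp: X_def)
  define bl :: cell where "bl = (False, \<lambda>r. None)"
  define bb :: "bool \<Rightarrow> cell" where "bb b = (False, (\<lambda>r. None)(0 := Some b))" for b
  have bb: "bl \<in> cells X" "bb b \<in> cells X" "bl \<noteq> bb b" "bb False \<noteq> bb True" for b
    using X by (auto simp: bl_def bb_def cells_def fun_eq_iff)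
  have st: "Start \<in> controls X ?K" "Accept \<in> controls X ?K" "Reject \<in> controls X ?K"
    "Start \<noteq> Accept" "Start \<noteq> Reject" "Accept \<noteq> Reject"
    by (auto simp: controls_def)
  have fc: "finite (controls X ?K)"
    using X finite_controls finite_conts by simp
  have cl: "\<forall>q\<in>controls X ?K. \<forall>a\<in>cells X. fst (stack_delta c0 q a) \<in> controls X ?K \<and>
      fst (snd (stack_delta c0 q a)) \<in> cells X"
    using stack_delta_closed[OF X(2)] by blast
  let ?tp0 = "\<lambda>w i. if i < length w then (if w ! i then bb True else bb False) else bl"
  obtain M eq ea where M: "wf_tm M"
    and eq: "\<And>q. q \<in> controls X ?K \<Longrightarrow> eq q = 1 \<longleftrightarrow> q = Accept"
            "\<And>q. q \<in> controls X ?K \<Longrightarrow> eq q = 2 \<longleftrightarrow> q = Reject"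
    and ea: "ea bl = 0" "ea (bb False) = 1" "ea (bb True) = 2"
    and sim: "\<And>w n q tp h. (stack_step c0 ^^ n) (Start, ?tp0 w, 0) = (q, tp, h) \<Longrightarrow>
        run M w n = (eq q, (\<lambda>i. ea (tp i)), h) \<and> q \<in> controls X ?K"
    by (rule tm_of_abstract[OF fc finite_cells[OF X(1)] cl st
            bb(1) bb(2)[of False] bb(2)[of True] bb(3)[of False] bb(3)[of True] bb(4)],
        rule that, (assumption | blast)+)
  show thesis
  proof (rule that[OF M])
    fix w B t \<sigma>
    assume ex: "exec (Some B) c0 (init_stacks w) t \<sigma>" and len: "length w \<le> B"
    have tp: "(?tp0 w)(0 := (True, snd (?tp0 w 0))) = tape_of (init_stacks w)"
      by (auto simp: fun_eq_iff tape_of_def init_stacks_def bl_def bb_def nth_opt_def)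
    have first: "stack_step c0 (Start, ?tp0 w, 0) = (Ctl [c0], tape_of (init_stacks w), 0)"
      unfolding tp[symmetric] by (cases "?tp0 w 0") auto
    let ?tp1 = "(tape_of \<sigma>)(0 := (False, snd (tape_of \<sigma> 0)))"
    let ?q = "if \<sigma> 1 = [] then Accept else Reject"
    have last: "stack_step c0 (Ctl [], tape_of \<sigma>, 0) = (?q, ?tp1, 0)"
      using snd_tape_of_None[of \<sigma> 1] by (cases "tape_of \<sigma> 0") auto
    have "reaches c0 B (t * (2 * B + 6)) (Ctl [c0], tape_of (init_stacks w), 0) (Ctl [], tape_of \<sigma>, 0)"
      using sim_exec[OF ex, of c0 "[]"] len by (auto simp: init_stacks_def)
    from reaches_Cons[OF first _ reaches_trans[OF this reaches_step[OF last] order_refl]]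
    have "reaches c0 B (t * (2 * B + 6) + 2) (Start, ?tp0 w, 0) (?q, ?tp1, 0)"
      by simp
    then obtain n where n: "n \<le> t * (2 * B + 6) + 2" "(stack_step c0 ^^ n) (Start, ?tp0 w, 0) = (?q, ?tp1, 0)"
      and heads: "\<And>i. i \<le> n \<Longrightarrow> snd (snd ((stack_step c0 ^^ i) (Start, ?tp0 w, 0))) \<le> B"
      by (auto simp: reaches_def)
    \<comment> \<open>The head bound is claimed for all times, so the halted configuration must be
      seen to persist beyond step \<open>n\<close>.\<close>
    have halt: "(stack_step c0 ^^ i) (?q, ?tp1, 0) = (?q, ?tp1, 0)" for i
    proof (induction i)
      case (Suc i)
      have "stack_step c0 (?q, ?tp1, 0) = (?q, ?tp1, 0)" by (simp del: fun_upd_apply)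
      then show ?case by (simp only: funpow.simps o_apply Suc.IH)
    qed (simp only: funpow_0)
    have hd: "chead (run M w i) \<le> B" for i
    proof -
      obtain q tp h where c: "(stack_step c0 ^^ i) (Start, ?tp0 w, 0) = (q, tp, h)"
        by (rule prod_cases3)
      have "h \<le> B"
      proof (cases "i \<le> n")
        case True
        then show ?thesis using heads[of i] c by simp
      next
        case False
        then have "(stack_step c0 ^^ i) (Start, ?tp0 w, 0) = (?q, ?tp1, 0)"
          using halt[of "i - n"] n(2) funpow_add[of "i - n" n "stack_step c0"] by simp
        then show ?thesis using c by simp
      qed
      then show ?thesis using sim[OF c] by (simp add: chead_def)
    qed
    note run = sim[OF n(2)]
    have "cstate (run M w n) = (if \<sigma> 1 = [] then 1 else 2)"
      using run eq st by (auto simp: cstate_def)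
    moreover have "(\<forall>i < length (\<sigma> 0). ctape (run M w n) i = sym_of (\<sigma> 0 ! i)) \<and>
           ctape (run M w n) (length (\<sigma> 0)) = 0" if e: "\<forall>r > 0. \<sigma> r = []"
    proof -
      have "\<sigma> = init_stacks (\<sigma> 0)"
        using e by (auto simp: init_stacks_def fun_eq_iff)
      moreover have "((tape_of (init_stacks v))(0 := (False, snd (tape_of (init_stacks v) 0)))) i =
          (case nth_opt v i of None \<Rightarrow> bl | Some b \<Rightarrow> bb b)" for v i
        by (cases "i = 0")
          (auto simp: tape_of_def bl_def bb_def fun_eq_iff nth_opt_def init_stacks_def)
      ultimately have "?tp1 i = (case nth_opt (\<sigma> 0) i of None \<Rightarrow> bl | Some b \<Rightarrow> bb b)" for i
        by metis
      then have "ctape (run M w n) i = (case nth_opt (\<sigma> 0) i of None \<Rightarrow> 0 | Some b \<Rightarrow> sym_of b)" for i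
        using run ea by (auto simp: ctape_def sym_of_def split: option.split)
      then show ?thesis by (auto simp: nth_opt_def)
    qed
    ultimately show "\<exists>n \<le> t * (2 * B + 6) + 2. cstate (run M w n) = (if \<sigma> 1 = [] then 1 else 2) \<and>
        (\<forall>i. chead (run M w i) \<le> B) \<and>
        ((\<forall>r > 0. \<sigma> r = []) \<longrightarrow> (\<forall>i < length (\<sigma> 0). ctape (run M w n) i = sym_of (\<sigma> 0 ! i)) \<and>
           ctape (run M w n) (length (\<sigma> 0)) = 0)"
      using n(1) hd by blast
  qed
qed

section \<open>Derived commands\<close>

text \<open>On the membership side space is the only resource; the existence of a running time
  merely records termination.\<close>

definition goes :: "nat option \<Rightarrow> com \<Rightarrow> stacks \<Rightarrow> stacks \<Rightarrow> bool" where
  "goes B c \<sigma> \<sigma>' \<longleftrightarrow> (\<exists>t. exec B c \<sigma> t \<sigma>')"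

lemma goes_Skip: "goes B Skip \<sigma> \<sigma>"
  unfolding goes_def by (blast intro: exec.intros)

lemma goes_Push: "fits B (Suc (length (\<sigma> r))) \<Longrightarrow> goes B (Push r b) \<sigma> (\<sigma>(r := b # \<sigma> r))"
  unfolding goes_def by (blast intro: exec.intros)

lemma goes_Pop: "goes B (Pop r) \<sigma> (\<sigma>(r := tl (\<sigma> r)))"
  unfolding goes_def by (blast intro: exec.intros)

lemma goes_PushI: "fits B (Suc (length (\<sigma> r))) \<Longrightarrow> \<sigma>(r := b # \<sigma> r) = \<sigma>' \<Longrightarrow> goes B (Push r b) \<sigma> \<sigma>'"
  using goes_Push by blast

lemma goes_PopI: "\<sigma>(r := tl (\<sigma> r)) = \<sigma>' \<Longrightarrow> goes B (Pop r) \<sigma> \<sigma>'"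
  using goes_Pop by blast

lemma goes_Seq: "goes B c \<sigma> \<sigma>' \<Longrightarrow> goes B d \<sigma>' \<sigma>'' \<Longrightarrow> goes B (c ;; d) \<sigma> \<sigma>''"
  unfolding goes_def by (blast intro: exec.intros)

lemma goes_If3:
  "goes B (case \<sigma> r of [] \<Rightarrow> c | b # _ \<Rightarrow> if b then e else d) \<sigma> \<sigma>' \<Longrightarrow> goes B (If3 r c d e) \<sigma> \<sigma>'"
  unfolding goes_def by (auto split: list.splits if_splits intro: exec.intros)

lemma goes_While_Nil: "\<sigma> r = [] \<Longrightarrow> goes B (While r c) \<sigma> \<sigma>"
  unfolding goes_def by (blast intro: exec.intros)

lemma goes_While: "\<sigma> r \<noteq> [] \<Longrightarrow> goes B c \<sigma> \<sigma>' \<Longrightarrow> goes B (While r c) \<sigma>' \<sigma>'' \<Longrightarrow> goes B (While r c) \<sigma> \<sigma>''"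
  unfolding goes_def by (blast intro: exec.intros)

lemma goes_mono: "goes (Some B) c \<sigma> \<sigma>' \<Longrightarrow> B \<le> B' \<Longrightarrow> goes (Some B') c \<sigma> \<sigma>'"
  unfolding goes_def by (blast intro: exec_mono)

definition drain :: "nat \<Rightarrow> com \<Rightarrow> com \<Rightarrow> com" where
  "drain r cF cT = While r (If3 r Skip (Pop r ;; cF) (Pop r ;; cT))"

text \<open>\<open>S pre ys\<close> is the loop invariant: the stacks after \<open>pre\<close> has
  been processed, with \<open>ys\<close> left on stack \<open>r\<close>. The body is entered with
  the current bit already popped.\<close>

lemma goes_drain:
  assumes body: "\<And>pre x ys. xs = pre @ x # ys \<Longrightarrow>
      goes B (if x then cT else cF) ((S pre (x # ys))(r := ys)) (S (pre @ [x]) ys)"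
    and r: "\<And>pre ys. S pre ys r = ys"
  shows "goes B (drain r cF cT) (S [] xs) (S xs [])"
proof -
  have "xs = pre @ ys \<Longrightarrow> goes B (drain r cF cT) (S pre ys) (S xs [])" for pre ys
  proof (induction ys arbitrary: pre)
    case Nil
    then show ?case using r by (auto simp: drain_def intro: goes_While_Nil)
  next
    case (Cons x ys)
    have "goes B (Pop r) (S pre (x # ys)) ((S pre (x # ys))(r := ys))"
      using goes_Pop[of B r "S pre (x # ys)"] r by simp
    note goes_Seq[OF this body[OF Cons.prems]]
    then have "goes B (If3 r Skip (Pop r ;; cF) (Pop r ;; cT)) (S pre (x # ys)) (S (pre @ [x]) ys)"
      by (intro goes_If3) (auto simp: r split: if_splits)
    moreover have "goes B (drain r cF cT) (S (pre @ [x]) ys) (S xs [])"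
      using Cons by simp
    ultimately show ?case
      unfolding drain_def by (rule goes_While[rotated]) (simp add: r)
  qed
  then show ?thesis by blast
qed

definition clear :: "nat \<Rightarrow> com" where
  "clear r = drain r Skip Skip"

lemma goes_clear: "goes B (clear r) \<sigma> (\<sigma>(r := []))"
  using goes_drain[where S = "\<lambda>pre ys. \<sigma>(r := ys)" and xs = "\<sigma> r" and B = B and cT = Skip and cF = Skip
      and r = r] goes_Skip
  by (simp add: clear_def)

definition mv :: "nat \<Rightarrow> nat \<Rightarrow> com" where
  "mv a b = drain a (Push b False) (Push b True)"

lemma goes_mv:
  assumes "a \<noteq> b" "fits B (length (\<sigma> a) + length (\<sigma> b))"
  shows "goes B (mv a b) \<sigma> (\<sigma>(a := [], b := rev (\<sigma> a) @ \<sigma> b))"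
proof -
  have "goes B (mv a b) (\<sigma>(a := \<sigma> a, b := rev [] @ \<sigma> b)) (\<sigma>(a := [], b := rev (\<sigma> a) @ \<sigma> b))"
    unfolding mv_def
  proof (rule goes_drain[where S = "\<lambda>pre ys. \<sigma>(a := ys, b := rev pre @ \<sigma> b)"])
    fix pre x ys
    assume xs: "\<sigma> a = pre @ x # ys"
    let ?s = "(\<sigma>(a := x # ys, b := rev pre @ \<sigma> b))(a := ys)"
    have "fits B (Suc (length (?s b)))"
      using assms xs by (auto simp: fits_def split: option.splits)
    from goes_Push[where \<sigma> = ?s and b = x, OF this]
    show "goes B (if x then Push b True else Push b False) ?s (\<sigma>(a := ys, b := rev (pre @ [x]) @ \<sigma> b))"
      using assms(1) by (cases x) (simp_all add: fun_upd_twist)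
  qed (use assms in simp)
  then show ?thesis by simp
qed

text \<open>Emptying onto the scratch stack 3 reverses the list and refilling restores the order, so
  the source survives and the copy is not reversed.\<close>

definition copy_map :: "(bool \<Rightarrow> bool) \<Rightarrow> nat \<Rightarrow> nat \<Rightarrow> com" where
  "copy_map g a b = clear b ;; mv a 3 ;;
     drain 3 (Push a False ;; Push b (g False)) (Push a True ;; Push b (g True))"

lemma goes_copy_map:
  assumes "a \<noteq> b" "a \<noteq> 3" "b \<noteq> 3" "\<sigma> 3 = []" "fits B (length (\<sigma> a))"
  shows "goes B (copy_map g a b) \<sigma> (\<sigma>(b := map g (\<sigma> a)))"
proof -
  let ?xs = "rev (\<sigma> a)"
  have "goes B (clear b) \<sigma> (\<sigma>(b := []))"
    by (rule goes_clear)
  moreover have "goes B (mv a 3) (\<sigma>(b := [])) (\<sigma>(b := [], a := [], 3 := ?xs))"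
    using goes_mv[of a 3 B "\<sigma>(b := [])"] assms by simp
  moreover have "goes B (drain 3 (Push a False ;; Push b (g False)) (Push a True ;; Push b (g True)))
    (\<sigma>(b := map g (rev []), a := rev [], 3 := ?xs)) (\<sigma>(b := map g (rev ?xs), a := rev ?xs, 3 := []))"
  proof (rule goes_drain[where S = "\<lambda>pre ys. \<sigma>(b := map g (rev pre), a := rev pre, 3 := ys)"])
    fix pre x ys
    assume xs: "?xs = pre @ x # ys"
    have l: "length (\<sigma> a) = length pre + Suc (length ys)"
      using arg_cong[OF xs, of length] by simp
    let ?s = "(\<sigma>(b := map g (rev pre), a := rev pre, 3 := x # ys))(3 := ys)"
    have f: "fits B (Suc (length (?s a)))" "fits B (Suc (length ((?s(a := x # ?s a)) b)))"
      using assms l by (auto simp: fits_def split: option.splits)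
    have "goes B (Push a x ;; Push b (g x)) ?s (\<sigma>(b := map g (rev (pre @ [x])), a := rev (pre @ [x]), 3 := ys))"
      by (rule goes_Seq, rule goes_PushI, rule f(1), rule refl, rule goes_PushI, rule f(2))
        (use assms in \<open>auto simp: fun_eq_iff\<close>)
    then show "goes B (if x then Push a True ;; Push b (g True) else Push a False ;; Push b (g False))
       ?s (\<sigma>(b := map g (rev (pre @ [x])), a := rev (pre @ [x]), 3 := ys))"
      by (cases x) simp_all
  qed simp
  ultimately have "goes B (copy_map g a b) \<sigma> (\<sigma>(b := map g (\<sigma> a), a := \<sigma> a, 3 := []))"
    unfolding copy_map_def by (auto intro!: goes_Seq)
  moreover have "\<sigma>(b := map g (\<sigma> a), a := \<sigma> a, 3 := []) = \<sigma>(b := map g (\<sigma> a))"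
    using assms by (auto simp: fun_eq_iff)
  ultimately show ?thesis by simp
qed

text \<open>A transducer with a single bit of state. Run from the least significant bit upwards it
  covers increment, decrement and the test for zero, the state being the carry, the borrow and the
  accumulated disjunction.\<close>

fun mealy :: "(bool \<Rightarrow> bool \<Rightarrow> bool \<times> bool) \<Rightarrow> bool \<Rightarrow> bool list \<Rightarrow> bool list \<times> bool" where
  "mealy f c [] = ([], c)"
| "mealy f c (b # bs) = (case f b c of (b', c') \<Rightarrow> (case mealy f c' bs of (bs', c'') \<Rightarrow> (b' # bs', c'')))"

definition flag :: "bool \<Rightarrow> bool list" where
  "flag c = (if c then [True] else [])"

lemma flag_simps [simp]: "flag True = [True]" "flag False = []"
  by (simp_all add: flag_def)

lemma mealy_append_single:
  "mealy f c (xs @ [x]) = (fst (mealy f c xs) @ [fst (f x (snd (mealy f c xs)))], snd (f x (snd (mealy f c xs))))"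
  by (induction xs arbitrary: c) (auto split: prod.splits)

lemma length_mealy [simp]: "length (fst (mealy f c xs)) = length xs"
proof (induction xs arbitrary: c)
  case (Cons x xs)
  show ?case using Cons[of "snd (f x c)"] by (auto split: prod.splits)
qed simp

definition mealy_emit :: "bool \<times> bool \<Rightarrow> bool \<Rightarrow> com" where
  "mealy_emit p c = Push 3 (fst p) ;;
     (if c = snd p then Skip else if c then Pop 4 else Push 4 True)"

text \<open>The state lives on stack 4 in the form of \<open>flag\<close>, so reading it is a test
  for emptiness. The output arrives reversed on stack 3 and is moved back.\<close>

definition mealy_com :: "(bool \<Rightarrow> bool \<Rightarrow> bool \<times> bool) \<Rightarrow> nat \<Rightarrow> com" where
  "mealy_com f r =
     drain r (If3 4 (mealy_emit (f False False) False) Skip (mealy_emit (f False True) True))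
             (If3 4 (mealy_emit (f True False) False) Skip (mealy_emit (f True True) True)) ;;
     mv 3 r"

lemma goes_mealy:
  assumes "r \<noteq> 3" "r \<noteq> 4" "\<sigma> 3 = []" "\<sigma> 4 = flag c" "length (\<sigma> r) \<le> s" "1 \<le> s"
  shows "goes (Some s) (mealy_com f r) \<sigma>
    (\<sigma>(r := fst (mealy f c (\<sigma> r)), 4 := flag (snd (mealy f c (\<sigma> r)))))"
proof -
  let ?S = "\<lambda>pre ys. \<sigma>(r := ys, 3 := rev (fst (mealy f c pre)), 4 := flag (snd (mealy f c pre)))"
  have "goes (Some s) (drain r (If3 4 (mealy_emit (f False False) False) Skip (mealy_emit (f False True) True))
             (If3 4 (mealy_emit (f True False) False) Skip (mealy_emit (f True True) True)))
          (?S [] (\<sigma> r)) (?S (\<sigma> r) [])"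
  proof (rule goes_drain[where S = ?S])
    fix pre x ys
    assume xs: "\<sigma> r = pre @ x # ys"
    have l: "length pre < s"
      using assms xs by simp
    let ?s = "(?S pre (x # ys))(r := ys)"
    define c' where "c' = snd (mealy f c pre)"
    define \<tau> where "\<tau> = ?s"
    have s4: "\<tau> 4 = flag c'" and s3: "\<tau> 3 = rev (fst (mealy f c pre))"
      using assms by (auto simp: c'_def \<tau>_def)
    let ?s' = "\<tau>(3 := fst (f x c') # \<tau> 3)"
    have 1: "goes (Some s) (Push 3 (fst (f x c'))) \<tau> ?s'"
      by (rule goes_Push) (use l s3 in \<open>auto simp: fits_def\<close>)
    have 2: "goes (Some s) (if c' = snd (f x c') then Skip else if c' then Pop 4 else Push 4 True) ?s'
      (?s'(4 := flag (snd (f x c'))))"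
    proof (cases "c' = snd (f x c')")
      case True
      then have "?s'(4 := flag (snd (f x c'))) = ?s'"
        using s4 by (auto simp: fun_eq_iff)
      then show ?thesis using True goes_Skip[of "Some s" ?s'] by simp
    next
      case False
      show ?thesis
      proof (cases c')
        case True
        then have "goes (Some s) (Pop 4) ?s' (?s'(4 := flag (snd (f x c'))))"
          using False s4 by (intro goes_PopI) (auto simp: fun_eq_iff)
        then show ?thesis using True False by simp
      next
        case F: False
        then have "goes (Some s) (Push 4 True) ?s' (?s'(4 := flag (snd (f x c'))))"
          using False s4 assms by (intro goes_PushI) (auto simp: fun_eq_iff fits_def)
        then show ?thesis using False F by simp
      qed
    qed
    have "?s'(4 := flag (snd (f x c'))) = ?S (pre @ [x]) ys"
      using assms s3 by (auto simp: fun_eq_iff mealy_append_single c'_def \<tau>_def)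
    then have e: "goes (Some s) (mealy_emit (f x c') c') ?s (?S (pre @ [x]) ys)"
      using goes_Seq[OF 1 2] by (simp add: mealy_emit_def \<tau>_def)
    show "goes (Some s) (if x
          then If3 4 (mealy_emit (f True False) False) Skip (mealy_emit (f True True) True)
          else If3 4 (mealy_emit (f False False) False) Skip (mealy_emit (f False True) True)) ?s
          (?S (pre @ [x]) ys)"
      using e s4 by (cases x; cases c') (auto intro!: goes_If3 simp: \<tau>_def)
  qed (use assms in auto)
  moreover have "?S [] (\<sigma> r) = \<sigma>"
    using assms by (auto simp: fun_eq_iff)
  moreover have "goes (Some s) (mv 3 r) (?S (\<sigma> r) []) ((?S (\<sigma> r) [])(3 := [], r := fst (mealy f c (\<sigma> r))))"
    using goes_mv[of 3 r "Some s" "?S (\<sigma> r) []"] assms by (simp add: fits_def)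
  moreover have "(?S (\<sigma> r) [])(3 := [], r := fst (mealy f c (\<sigma> r))) =
      \<sigma>(r := fst (mealy f c (\<sigma> r)), 4 := flag (snd (mealy f c (\<sigma> r))))"
    using assms by (auto simp: fun_eq_iff)
  ultimately show ?thesis
    unfolding mealy_com_def by (auto intro!: goes_Seq)
qed

section \<open>Arithmetic in fixed width\<close>

text \<open>The least significant bit is on top, where carries start. Bits beyond the width are cut
  off, which makes \<open>inc\<close> arithmetic modulo \<open>2 ^ s\<close>.\<close>

fun rep :: "nat \<Rightarrow> nat \<Rightarrow> bool list" where
  "rep 0 x = []"
| "rep (Suc s) x = odd x # rep s (x div 2)"

lemma length_rep [simp]: "length (rep s x) = s"
  by (induction s arbitrary: x) auto

lemma rep_0: "rep s 0 = replicate s False"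
  by (induction s) auto

lemma rep_top: "rep s (2 ^ s - 1) = replicate s True"
proof (induction s)
  case (Suc s)
  have "odd (2 ^ Suc s - 1 :: nat)" "(2 ^ Suc s - 1) div 2 = (2 ^ s - 1 :: nat)"
    by auto
  then show ?case using Suc by (simp del: power_Suc)
qed simp

lemma rep_mod: "rep s (x mod 2 ^ s) = rep s x"
proof (induction s arbitrary: x)
  case (Suc s)
  have eq: "x mod 2 ^ Suc s = 2 * (x div 2 mod 2 ^ s) + x mod 2"
    by (simp add: mod_mult2_eq)
  have "odd (x mod 2 ^ Suc s) = odd x" "(x mod 2 ^ Suc s) div 2 = x div 2 mod 2 ^ s"
    unfolding eq by auto
  then show ?case using Suc by (simp del: power_Suc)
qed simp

lemma rep_append_False: "x < 2 ^ s \<Longrightarrow> rep (Suc s) x = rep s x @ [False]"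
proof (induction s arbitrary: x)
  case (Suc s)
  then have "x div 2 < 2 ^ s" by auto
  from Suc.IH[OF this] show ?case by simp
qed simp

lemma mealy_inc: "fst (mealy (\<lambda>b c. (b \<noteq> c, b \<and> c)) c (rep s x)) = rep s (x + (if c then 1 else 0))"
proof (induction s arbitrary: x c)
  case (Suc s)
  show ?case using Suc[of "c \<and> odd x" "x div 2"] by (auto split: prod.splits)
qed simp

lemma mealy_dec:
  "c \<longrightarrow> 0 < x \<Longrightarrow> fst (mealy (\<lambda>b c. (b \<noteq> c, \<not> b \<and> c)) c (rep s x)) = rep s (x - (if c then 1 else 0))"
proof (induction s arbitrary: x c)
  case (Suc s)
  have "c \<and> even x \<longrightarrow> 0 < x div 2"
    using Suc.prems by auto
  moreover have "(2 * b - Suc 0) div 2 = b - Suc 0" for b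
    by (cases b) auto
  ultimately show ?case using Suc.IH[of "c \<and> even x" "x div 2"] Suc.prems
    by (auto split: prod.splits elim!: evenE oddE)
qed simp

lemma mealy_nonzero:
  "x < 2 ^ s \<Longrightarrow> mealy (\<lambda>b c. (b, b \<or> c)) c (rep s x) = (rep s x, c \<or> x \<noteq> 0)"
proof (induction s arbitrary: x c)
  case (Suc s)
  then have "x div 2 < 2 ^ s" by auto
  from Suc.IH[OF this, of "odd x \<or> c"] show ?case by auto
qed simp

definition inc :: "nat \<Rightarrow> com" where
  "inc r = Push 4 True ;; mealy_com (\<lambda>b c. (b \<noteq> c, b \<and> c)) r ;; clear 4"

definition dec :: "nat \<Rightarrow> com" where
  "dec r = Push 4 True ;; mealy_com (\<lambda>b c. (b \<noteq> c, \<not> b \<and> c)) r ;; clear 4"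

lemma goes_inc:
  assumes "r \<noteq> 3" "r \<noteq> 4" "\<sigma> 3 = []" "\<sigma> 4 = []" "\<sigma> r = rep s x" "1 \<le> s"
  shows "goes (Some s) (inc r) \<sigma> (\<sigma>(r := rep s (Suc x)))"
proof -
  have 1: "goes (Some s) (Push 4 True) \<sigma> (\<sigma>(4 := [True]))"
    using goes_Push[of "Some s" \<sigma> 4 True] assms by (simp add: fits_def)
  have 2: "goes (Some s) (mealy_com (\<lambda>b c. (b \<noteq> c, b \<and> c)) r) (\<sigma>(4 := [True]))
     ((\<sigma>(4 := [True]))(r := rep s (Suc x), 4 := flag (snd (mealy (\<lambda>b c. (b \<noteq> c, b \<and> c)) True (rep s x)))))"
    using goes_mealy[of r "\<sigma>(4 := [True])" True s "\<lambda>b c. (b \<noteq> c, b \<and> c)"] assms mealy_inc[of True s x] by simp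
  from goes_Seq[OF 1 goes_Seq[OF 2 goes_clear]] have "goes (Some s) (inc r) \<sigma>
     ((\<sigma>(4 := [True]))(r := rep s (Suc x), 4 := flag (snd (mealy (\<lambda>b c. (b \<noteq> c, b \<and> c)) True (rep s x))), 4 := []))"
    unfolding inc_def .
  moreover have "(\<sigma>(4 := [True]))(r := rep s (Suc x), 4 := flag (snd (mealy (\<lambda>b c. (b \<noteq> c, b \<and> c)) True (rep s x))), 4 := [])
     = \<sigma>(r := rep s (Suc x))"
    using assms by (auto simp: fun_eq_iff)
  ultimately show ?thesis by simp
qed

lemma goes_dec:
  assumes "r \<noteq> 3" "r \<noteq> 4" "\<sigma> 3 = []" "\<sigma> 4 = []" "\<sigma> r = rep s x" "1 \<le> s" "0 < x"
  shows "goes (Some s) (dec r) \<sigma> (\<sigma>(r := rep s (x - 1)))"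
proof -
  have 1: "goes (Some s) (Push 4 True) \<sigma> (\<sigma>(4 := [True]))"
    using goes_Push[of "Some s" \<sigma> 4 True] assms by (simp add: fits_def)
  have 2: "goes (Some s) (mealy_com (\<lambda>b c. (b \<noteq> c, \<not> b \<and> c)) r) (\<sigma>(4 := [True]))
     ((\<sigma>(4 := [True]))(r := rep s (x - 1), 4 := flag (snd (mealy (\<lambda>b c. (b \<noteq> c, \<not> b \<and> c)) True (rep s x)))))"
    using goes_mealy[of r "\<sigma>(4 := [True])" True s "\<lambda>b c. (b \<noteq> c, \<not> b \<and> c)"] assms mealy_dec[of True x s] by simp
  from goes_Seq[OF 1 goes_Seq[OF 2 goes_clear]] have "goes (Some s) (dec r) \<sigma>
     ((\<sigma>(4 := [True]))(r := rep s (x - 1), 4 := flag (snd (mealy (\<lambda>b c. (b \<noteq> c, \<not> b \<and> c)) True (rep s x))), 4 := []))"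
    unfolding dec_def .
  moreover have "(\<sigma>(4 := [True]))(r := rep s (x - 1), 4 := flag (snd (mealy (\<lambda>b c. (b \<noteq> c, \<not> b \<and> c)) True (rep s x))), 4 := [])
     = \<sigma>(r := rep s (x - 1))"
    using assms by (auto simp: fun_eq_iff)
  ultimately show ?thesis by simp
qed

definition nonzero :: "nat \<Rightarrow> nat \<Rightarrow> com" where
  "nonzero r b = mealy_com (\<lambda>b c. (b, b \<or> c)) r ;; mv 4 b"

lemma goes_nonzero:
  assumes "r \<noteq> 3" "r \<noteq> 4" "b \<noteq> 4" "b \<noteq> r" "\<sigma> 3 = []" "\<sigma> 4 = []" "\<sigma> b = []" "\<sigma> r = rep s x" "1 \<le> s" "x < 2 ^ s"
  shows "goes (Some s) (nonzero r b) \<sigma> (\<sigma>(b := flag (x \<noteq> 0)))"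
proof -
  have 1: "goes (Some s) (mealy_com (\<lambda>b c. (b, b \<or> c)) r) \<sigma> (\<sigma>(4 := flag (x \<noteq> 0)))"
    using goes_mealy[of r \<sigma> False s "\<lambda>b c. (b, b \<or> c)"] assms mealy_nonzero[of x s False]
    by (simp add: fun_upd_idem)
  have 2: "goes (Some s) (mv 4 b) (\<sigma>(4 := flag (x \<noteq> 0))) (\<sigma>(4 := flag (x \<noteq> 0), 4 := [], b := flag (x \<noteq> 0)))"
    using goes_mv[of 4 b "Some s" "\<sigma>(4 := flag (x \<noteq> 0))"] assms by (cases "x = 0") (simp_all add: fits_def)
  have "\<sigma>(4 := flag (x \<noteq> 0), 4 := [], b := flag (x \<noteq> 0)) = \<sigma>(b := flag (x \<noteq> 0))"
    using assms by (auto simp: fun_eq_iff)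
  then show ?thesis using goes_Seq[OF 1 2] by (simp add: nonzero_def)
qed

section \<open>Functions computable in fixed width\<close>

text \<open>A function of this class receives the modulus \<open>N = 2 ^ s\<close> and an environment of numbers
  below \<open>N\<close>; stack 2 holds a template of width \<open>s\<close>, stacks 3 and 4 are scratch.\<close>

definition ready :: "nat \<Rightarrow> nat \<Rightarrow> stacks \<Rightarrow> bool" where
  "ready s z \<sigma> \<longleftrightarrow> \<sigma> 2 = replicate s False \<and> \<sigma> 3 = [] \<and> \<sigma> 4 = [] \<and> (\<forall>r \<ge> z. \<sigma> r = [])"

text \<open>\<open>ar i\<close> is the stack of variable \<open>i\<close>; several variables may
  share a stack. Stacks from \<open>z\<close> on are empty and available as temporaries, and
  everything except \<open>out\<close> is restored.\<close>

definition implements :: "com \<Rightarrow> (nat \<Rightarrow> (nat \<Rightarrow> nat) \<Rightarrow> nat) \<Rightarrow> (nat \<Rightarrow> nat) \<Rightarrow> nat \<Rightarrow> nat \<Rightarrow> bool" where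
  "implements c f ar out z \<longleftrightarrow> (\<forall>s \<ge> 2. \<forall>e \<sigma>. (\<forall>i. e i < 2 ^ s) \<longrightarrow> ready s z \<sigma> \<longrightarrow>
     (\<forall>i. \<sigma> (ar i) = rep s (e i)) \<longrightarrow> goes (Some s) c \<sigma> (\<sigma>(out := rep s (f (2 ^ s) e))))"

lemma implementsI:
  "(\<And>s e \<sigma>. 2 \<le> s \<Longrightarrow> \<forall>i. e i < 2 ^ s \<Longrightarrow> ready s z \<sigma> \<Longrightarrow> \<forall>i. \<sigma> (ar i) = rep s (e i) \<Longrightarrow>
     goes (Some s) c \<sigma> (\<sigma>(out := rep s (f (2 ^ s) e)))) \<Longrightarrow> implements c f ar out z"
  by (simp add: implements_def)

lemma implementsD:
  "implements c f ar out z \<Longrightarrow> 2 \<le> s \<Longrightarrow> \<forall>i. e i < 2 ^ s \<Longrightarrow> ready s z \<sigma> \<Longrightarrow> \<forall>i. \<sigma> (ar i) = rep s (e i) \<Longrightarrow>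
     goes (Some s) c \<sigma> (\<sigma>(out := rep s (f (2 ^ s) e)))"
  by (simp add: implements_def)

text \<open>The command is chosen before the width, so one program works for every \<open>s\<close>.
  The bound on the value makes it fit into a stack of height \<open>s\<close>, and
  \<open>s \<ge> 2\<close> makes room for the constants up to 3.\<close>

definition cmp :: "(nat \<Rightarrow> (nat \<Rightarrow> nat) \<Rightarrow> nat) \<Rightarrow> bool" where
  "cmp f \<longleftrightarrow> (\<forall>s \<ge> 2. \<forall>e. (\<forall>i. e i < 2 ^ s) \<longrightarrow> f (2 ^ s) e < 2 ^ s) \<and>
    (\<forall>ar out z. (\<forall>i. 5 \<le> ar i \<and> ar i < z \<and> ar i \<noteq> out) \<longrightarrow> 5 \<le> out \<longrightarrow> out < z \<longrightarrow>
      (\<exists>c. implements c f ar out z))"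

lemma cmpI:
  assumes "\<And>s e. 2 \<le> s \<Longrightarrow> \<forall>i. e i < 2 ^ s \<Longrightarrow> f (2 ^ s) e < 2 ^ s"
    and "\<And>ar out z. \<forall>i. 5 \<le> ar i \<and> ar i < z \<and> ar i \<noteq> out \<Longrightarrow> 5 \<le> out \<Longrightarrow> out < z \<Longrightarrow>
      \<exists>c. implements c f ar out z"
  shows "cmp f"
  using assms by (simp add: cmp_def)

lemma cmp_range: "cmp f \<Longrightarrow> 2 \<le> s \<Longrightarrow> \<forall>i. e i < 2 ^ s \<Longrightarrow> f (2 ^ s) e < 2 ^ s"
  by (simp add: cmp_def)

lemma cmp_code:
  "cmp f \<Longrightarrow> \<forall>i. 5 \<le> ar i \<and> ar i < z \<and> ar i \<noteq> out \<Longrightarrow> 5 \<le> out \<Longrightarrow> out < z \<Longrightarrow> \<exists>c. implements c f ar out z"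
  by (simp add: cmp_def)

text \<open>Only arguments in range matter, so a function may be exchanged for one that agrees with
  it there, for instance when a reduction modulo \<open>N\<close> has no effect.\<close>

lemma cmp_cong:
  assumes "cmp f" "\<And>s e. 2 \<le> s \<Longrightarrow> \<forall>i. e i < 2 ^ s \<Longrightarrow> f (2 ^ s) e = g (2 ^ s) e"
  shows "cmp g"
proof (rule cmpI)
  show "g (2 ^ s) e < 2 ^ s" if "2 \<le> s" "\<forall>i. e i < 2 ^ s" for s e
    using cmp_range[OF assms(1) that] assms(2)[OF that] by simp
next
  fix ar :: "nat \<Rightarrow> nat" and out z :: nat
  assume "\<forall>i. 5 \<le> ar i \<and> ar i < z \<and> ar i \<noteq> out" "5 \<le> out" "out < z"
  from cmp_code[OF assms(1) this] obtain c where c: "implements c f ar out z" ..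
  have "implements c g ar out z"
    by (rule implementsI) (use implementsD[OF c] assms(2) in simp)
  then show "\<exists>c. implements c g ar out z" ..
qed

lemma cmp_var: "cmp (\<lambda>N e. e i)"
proof (rule cmpI)
  fix ar :: "nat \<Rightarrow> nat" and out z :: nat
  assume a: "\<forall>i. 5 \<le> ar i \<and> ar i < z \<and> ar i \<noteq> out" "5 \<le> out" "out < z"
  have "implements (copy_map (\<lambda>b. b) (ar i) out) (\<lambda>N e. e i) ar out z"
  proof (rule implementsI)
    fix s e \<sigma>
    assume "ready s z \<sigma>" "\<forall>i. \<sigma> (ar i) = rep s (e i)"
    then show "goes (Some s) (copy_map (\<lambda>b. b) (ar i) out) \<sigma> (\<sigma>(out := rep s (e i)))"
      using goes_copy_map[of "ar i" out \<sigma> "Some s" "\<lambda>b. b"] a(1)[rule_format, of i] a(2)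
      by (simp add: ready_def fits_def)
  qed
  then show "\<exists>c. implements c (\<lambda>N e. e i) ar out z" ..
qed simp

lemma cmp_template:
  assumes "\<And>s. v (2 ^ s) < 2 ^ s" "\<And>s. rep s (v (2 ^ s)) = replicate s b"
  shows "cmp (\<lambda>N e. v N)"
proof (rule cmpI)
  fix ar :: "nat \<Rightarrow> nat" and out z :: nat
  assume a: "5 \<le> out"
  have "implements (copy_map (\<lambda>_. b) 2 out) (\<lambda>N e. v N) ar out z"
  proof (rule implementsI)
    fix s e \<sigma>
    assume "ready s z \<sigma>"
    then show "goes (Some s) (copy_map (\<lambda>_. b) 2 out) \<sigma> (\<sigma>(out := rep s (v (2 ^ s))))"
      using goes_copy_map[of 2 out \<sigma> "Some s" "\<lambda>_. b"] a assms
      by (simp add: ready_def fits_def map_replicate_const)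
  qed
  then show "\<exists>c. implements c (\<lambda>N e. v N) ar out z" ..
qed (use assms in simp)

lemma cmp_zero: "cmp (\<lambda>N e. 0)"
  by (rule cmp_template[where v = "\<lambda>_. 0"]) (auto simp: rep_0)

lemma cmp_top: "cmp (\<lambda>N e. N - 1)"
  by (rule cmp_template[where v = "\<lambda>N. N - 1" and b = True]) (auto simp: rep_top[simplified])

lemma cmp_suc:
  assumes "cmp f"
  shows "cmp (\<lambda>N e. Suc (f N e) mod N)"
proof (rule cmpI)
  fix ar :: "nat \<Rightarrow> nat" and out z :: nat
  assume a: "\<forall>i. 5 \<le> ar i \<and> ar i < z \<and> ar i \<noteq> out" "5 \<le> out" "out < z"
  from cmp_code[OF assms a] obtain c where c: "implements c f ar out z" ..
  have "implements (c ;; inc out) (\<lambda>N e. Suc (f N e) mod N) ar out z"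
  proof (rule implementsI)
    fix s e \<sigma>
    assume h: "2 \<le> s" "\<forall>i. e i < 2 ^ s" "ready s z \<sigma>" "\<forall>i. \<sigma> (ar i) = rep s (e i)"
    have "goes (Some s) (inc out) (\<sigma>(out := rep s (f (2 ^ s) e))) (\<sigma>(out := rep s (Suc (f (2 ^ s) e))))"
      using goes_inc[of out "\<sigma>(out := rep s (f (2 ^ s) e))" s "f (2 ^ s) e"] a h
      by (simp add: ready_def)
    from goes_Seq[OF implementsD[OF c h] this]
    show "goes (Some s) (c ;; inc out) \<sigma> (\<sigma>(out := rep s (Suc (f (2 ^ s) e) mod 2 ^ s)))"
      by (simp add: rep_mod)
  qed
  then show "\<exists>c. implements c (\<lambda>N e. Suc (f N e) mod N) ar out z" ..
qed simp

lemma cmp_rename: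
  assumes "cmp f"
  shows "cmp (\<lambda>N e. f N (\<lambda>i. e (\<rho> i)))"
proof (rule cmpI)
  show "f (2 ^ s) (\<lambda>i. e (\<rho> i)) < 2 ^ s" if "2 \<le> s" "\<forall>i. e i < 2 ^ s" for s e
    using cmp_range[OF assms that(1), of "\<lambda>i. e (\<rho> i)"] that(2) by simp
next
  fix ar :: "nat \<Rightarrow> nat" and out z :: nat
  assume a: "\<forall>i. 5 \<le> ar i \<and> ar i < z \<and> ar i \<noteq> out" "5 \<le> out" "out < z"
  have "\<exists>c. implements c f (\<lambda>i. ar (\<rho> i)) out z"
    by (rule cmp_code[OF assms]) (use a in simp_all)
  then obtain c where c: "implements c f (\<lambda>i. ar (\<rho> i)) out z" ..
  have "implements c (\<lambda>N e. f N (\<lambda>i. e (\<rho> i))) ar out z"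
  proof (rule implementsI)
    fix s e \<sigma>
    assume h: "2 \<le> s" "\<forall>i. e i < 2 ^ s" "ready s z \<sigma>" "\<forall>i. \<sigma> (ar i) = rep s (e i)"
    show "goes (Some s) c \<sigma> (\<sigma>(out := rep s (f (2 ^ s) (\<lambda>i. e (\<rho> i)))))"
      using implementsD[OF c h(1) _ h(3), of "\<lambda>i. e (\<rho> i)"] h by simp
  qed
  then show "\<exists>c. implements c (\<lambda>N e. f N (\<lambda>i. e (\<rho> i))) ar out z" ..
qed

text \<open>De Bruijn convention: the most recently bound variable has index 0.\<close>

definition scons :: "nat \<Rightarrow> (nat \<Rightarrow> nat) \<Rightarrow> nat \<Rightarrow> nat" (infixr "##" 65) where
  "(x ## e) i = (case i of 0 \<Rightarrow> x | Suc j \<Rightarrow> e j)"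

lemma scons_simps [simp]: "(x ## e) 0 = x" "(x ## e) (Suc i) = e i"
  by (simp_all add: scons_def)

lemma all_nat_split: "(\<forall>i. P i) \<longleftrightarrow> P 0 \<and> (\<forall>i. P (Suc i))"
  by (metis not0_implies_Suc)

lemma scons_all:
  "(\<forall>i. (x ## e) i < N) \<longleftrightarrow> x < N \<and> (\<forall>i. e i < N)"
  "(\<forall>i. m \<le> (x ## e) i \<and> (x ## e) i < N \<and> (x ## e) i \<noteq> n) \<longleftrightarrow>
    (m \<le> x \<and> x < N \<and> x \<noteq> n) \<and> (\<forall>i. m \<le> e i \<and> e i < N \<and> e i \<noteq> n)"
  "(\<forall>i. \<sigma> ((x ## e) i) = rep s ((y ## e') i)) \<longleftrightarrow> \<sigma> x = rep s y \<and> (\<forall>i. \<sigma> (e i) = rep s (e' i))"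
  by (subst all_nat_split, simp)+

lemma cmp_let:
  assumes "cmp f" "cmp g"
  shows "cmp (\<lambda>N e. f N (g N e ## e))"
proof (rule cmpI)
  show "f (2 ^ s) (g (2 ^ s) e ## e) < 2 ^ s" if "2 \<le> s" "\<forall>i. e i < 2 ^ s" for s e
    using cmp_range[OF assms(1) that(1), of "g (2 ^ s) e ## e"] cmp_range[OF assms(2) that] that(2)
    by (simp add: scons_all)
next
  fix ar :: "nat \<Rightarrow> nat" and out z :: nat
  assume a: "\<forall>i. 5 \<le> ar i \<and> ar i < z \<and> ar i \<noteq> out" "5 \<le> out" "out < z"
  have ar: "5 \<le> ar i" "ar i < z" "ar i \<noteq> out" for i
    using a by auto
  then have arz: "ar i < Suc z" "ar i \<noteq> z" for i
    by (simp_all add: less_SucI less_imp_neq)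
  have "\<exists>c. implements c g ar z (Suc z)"
    by (rule cmp_code[OF assms(2)]) (use ar arz a in auto)
  then obtain c where c: "implements c g ar z (Suc z)" ..
  have "\<exists>d. implements d f (z ## ar) out (Suc z)"
    by (rule cmp_code[OF assms(1)]) (use ar arz a in \<open>auto simp: scons_all\<close>)
  then obtain d where d: "implements d f (z ## ar) out (Suc z)" ..
  have "implements (c ;; d ;; clear z) (\<lambda>N e. f N (g N e ## e)) ar out z"
  proof (rule implementsI)
    fix s e \<sigma>
    assume h: "2 \<le> s" "\<forall>i. e i < 2 ^ s" "ready s z \<sigma>" "\<forall>i. \<sigma> (ar i) = rep s (e i)"
    let ?g = "g (2 ^ s) e"
    let ?r = "rep s (f (2 ^ s) (?g ## e))"
    have 1: "goes (Some s) c \<sigma> (\<sigma>(z := rep s ?g))"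
      by (rule implementsD[OF c h(1,2) _ h(4)]) (use h in \<open>auto simp: ready_def\<close>)
    have 2: "goes (Some s) d (\<sigma>(z := rep s ?g)) (\<sigma>(z := rep s ?g, out := ?r))"
    proof (rule implementsD[OF d h(1)])
      show "\<forall>i. (?g ## e) i < 2 ^ s"
        using cmp_range[OF assms(2) h(1,2)] h(2) by (simp add: scons_all)
      show "ready s (Suc z) (\<sigma>(z := rep s ?g))"
        using h(3) a by (auto simp: ready_def)
      show "\<forall>i. (\<sigma>(z := rep s ?g)) ((z ## ar) i) = rep s ((?g ## e) i)"
        unfolding scons_all using h(4) arz by simp
    qed
    have "(\<sigma>(z := rep s ?g, out := ?r))(z := []) = \<sigma>(out := ?r)"
      using a(3) h(3) by (auto simp: fun_eq_iff ready_def)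
    then show "goes (Some s) (c ;; d ;; clear z) \<sigma> (\<sigma>(out := ?r))"
      using goes_Seq[OF 1 goes_Seq[OF 2 goes_clear]] by metis
  qed
  then show "\<exists>c. implements c (\<lambda>N e. f N (g N e ## e)) ar out z" ..
qed

text \<open>All loops of the class come from here. The step function maps values below
  \<open>N\<close> to values below \<open>N\<close>, so the accumulator never leaves the width,
  however many rounds are made.\<close>

lemma cmp_rec:
  assumes t: "cmp t" and g: "cmp g" and f: "cmp (\<lambda>N e. f N (e 0) (e 1) (\<lambda>i. e (Suc (Suc i))))"
  shows "cmp (\<lambda>N e. rec_nat (g N e) (\<lambda>y r. f N y r e) (t N e))"
proof -
  define R where "R N e n = rec_nat (g N e) (\<lambda>y r. f N y r e) n" for N e n
  have fr: "f (2 ^ s) y r e < 2 ^ s" if "2 \<le> s" "\<forall>i. e i < 2 ^ s" "y < 2 ^ s" "r < 2 ^ s" for s e y r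
    using cmp_range[OF f that(1), of "y ## r ## e"] that by (simp add: scons_all)
  have Rr: "R (2 ^ s) e n < 2 ^ s" if "2 \<le> s" "\<forall>i. e i < 2 ^ s" "n < 2 ^ s" for s e n
    using that(3)
  proof (induction n)
    case 0
    then show ?case using cmp_range[OF g that(1,2)] by (simp add: R_def)
  next
    case (Suc n)
    then show ?case using fr[OF that(1,2), of n "R (2 ^ s) e n"] by (simp add: R_def)
  qed
  have "cmp (\<lambda>N e. R N e (t N e))"
  proof (rule cmpI)
    show "R (2 ^ s) e (t (2 ^ s) e) < 2 ^ s" if "2 \<le> s" "\<forall>i. e i < 2 ^ s" for s e
      by (intro Rr cmp_range[OF t] that)
  next
    fix ar :: "nat \<Rightarrow> nat" and out z :: nat
    assume a: "\<forall>i. 5 \<le> ar i \<and> ar i < z \<and> ar i \<noteq> out" "5 \<le> out" "out < z"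
    have z: "5 \<le> z" using a by simp
    have ar: "5 \<le> ar i" "ar i < z" "ar i \<noteq> out" for i
      using a by auto
    have arz: "ar i < Suc z" "ar i < z + 4" "ar i \<noteq> z" "ar i \<noteq> z + 1" "ar i \<noteq> z + 2" "ar i \<noteq> z + 3" for i
      using ar(2)[of i] by auto
    have "\<exists>c. implements c t ar z (Suc z)"
      by (rule cmp_code[OF t]) (use ar arz z in auto)
    then obtain ct where ct: "implements ct t ar z (Suc z)" ..
    have "\<exists>c. implements c g ar out (Suc z)"
      by (rule cmp_code[OF g]) (use ar arz a in auto)
    then obtain cg where cg: "implements cg g ar out (Suc z)" ..
    let ?ar = "(z + 1) ## out ## ar"
    have "\<exists>c. implements c (\<lambda>N e. f N (e 0) (e 1) (\<lambda>i. e (Suc (Suc i)))) ?ar (z + 3) (z + 4)"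
      by (rule cmp_code[OF f]) (use ar arz z a in \<open>auto simp: scons_all\<close>)
    then obtain cf where cf: "implements cf (\<lambda>N e. f N (e 0) (e 1) (\<lambda>i. e (Suc (Suc i)))) ?ar (z + 3) (z + 4)" ..
    \<comment> \<open>Stack \<open>z\<close> counts the rounds still to go, \<open>z + 1\<close> is
      the recursion variable and \<open>z + 2\<close> tells whether to continue. The new accumulator
      is computed in \<open>z + 3\<close> because \<open>cmp\<close> only provides commands whose
      output stack differs from all argument stacks.\<close>
    define body where "body = Pop (z + 2) ;; cf ;; copy_map (\<lambda>b. b) (z + 3) out ;; clear (z + 3) ;;
        inc (z + 1) ;; dec z ;; nonzero z (z + 2)"
    define c where "c = ct ;; cg ;; copy_map (\<lambda>b. False) 2 (z + 1) ;; nonzero z (z + 2) ;;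
        While (z + 2) body ;; clear z ;; clear (z + 1)"
    have "implements c (\<lambda>N e. R N e (t N e)) ar out z"
    proof (rule implementsI)
      fix s e \<sigma>
      assume h: "2 \<le> s" "\<forall>i. e i < 2 ^ s" "ready s z \<sigma>" "\<forall>i. \<sigma> (ar i) = rep s (e i)"
      let ?N = "2 ^ s :: nat"
      let ?t = "t ?N e"
      have tN: "?t < ?N" using cmp_range[OF t h(1,2)] .
      have s2: "\<sigma> 2 = replicate s False" "\<sigma> 3 = []" "\<sigma> 4 = []" "\<And>r. z \<le> r \<Longrightarrow> \<sigma> r = []"
        using h(3) by (auto simp: ready_def)
      \<comment> \<open>Loop invariant after \<open>y\<close> rounds.\<close>
      define L where "L y = \<sigma>(out := rep s (R ?N e y), z := rep s (?t - y), z + 1 := rep s y,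
          z + 2 := flag (?t - y \<noteq> 0))" for y
      have Lout: "L y out = rep s (R ?N e y)" and Lz: "L y z = rep s (?t - y)"
        and L1: "L y (z + 1) = rep s y" and L2: "L y (z + 2) = flag (?t - y \<noteq> 0)"
        and Lo: "r \<noteq> out \<Longrightarrow> r \<noteq> z \<Longrightarrow> r \<noteq> z + 1 \<Longrightarrow> r \<noteq> z + 2 \<Longrightarrow> L y r = \<sigma> r" for y r
        using a(3) by (auto simp: L_def)
      have L3: "L y 3 = []" "L y 4 = []" "L y 2 = replicate s False" for y
        using Lo[of 3 y] Lo[of 4 y] Lo[of 2 y] s2 a(2) z by auto
      have Lar: "L y (ar i) = rep s (e i)" for y i
        using Lo[of "ar i" y] ar arz[of i] h(4) by simp
      have body: "goes (Some s) body (L y) (L (Suc y))" if y: "y < ?t" for y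
      proof -
        let ?r' = "R ?N e (Suc y)"
        let ?a = "(L y)(z + 2 := [])"
        have 1: "goes (Some s) (Pop (z + 2)) (L y) ?a"
          using y L2[of y] by (intro goes_PopI) (simp add: fun_eq_iff)
        let ?b = "?a(z + 3 := rep s ?r')"
        have "goes (Some s) cf ?a (?a(z + 3 := rep s (f ?N ((y ## R ?N e y ## e) 0) ((y ## R ?N e y ## e) 1)
           (\<lambda>i. (y ## R ?N e y ## e) (Suc (Suc i))))))"
        proof (rule implementsD[OF cf h(1)])
          show "\<forall>i. (y ## R ?N e y ## e) i < ?N"
            using Rr[OF h(1,2), of y] y tN h(2) by (simp add: scons_all)
          show "ready s (z + 4) ?a"
            using L3[of y] s2(4) Lo a(3) z by (auto simp: ready_def)
          show "\<forall>i. ?a (?ar i) = rep s ((y ## R ?N e y ## e) i)"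
            unfolding scons_all using Lar[of y] Lout[of y] L1[of y] arz a(3) by simp
        qed
        then have 2: "goes (Some s) cf ?a ?b"
          by (simp add: R_def)
        let ?c = "?b(out := rep s ?r')"
        have "goes (Some s) (copy_map (\<lambda>b. b) (z + 3) out) ?b (?b(out := map (\<lambda>b. b) (?b (z + 3))))"
          by (rule goes_copy_map) (use a(2,3) z L3[of y] in \<open>auto simp: fits_def\<close>)
        then have 3: "goes (Some s) (copy_map (\<lambda>b. b) (z + 3) out) ?b ?c"
          by simp
        let ?d = "?c(z + 3 := [])"
        have 4: "goes (Some s) (clear (z + 3)) ?c ?d" by (rule goes_clear)
        let ?e = "?d(z + 1 := rep s (Suc y))"
        have 5: "goes (Some s) (inc (z + 1)) ?d ?e"
          by (rule goes_inc) (use a(2,3) z L3[of y] h(1) L1 in auto)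
        let ?f = "?e(z := rep s (?t - y - 1))"
        have 6: "goes (Some s) (dec z) ?e ?f"
          by (rule goes_dec) (use a(2,3) z L3[of y] h(1) y Lz in auto)
        let ?g = "?f(z + 2 := flag (?t - y - 1 \<noteq> 0))"
        have 7: "goes (Some s) (nonzero z (z + 2)) ?f ?g"
          by (rule goes_nonzero) (use a(2,3) z L3[of y] h(1) y tN in auto)
        have "?g = L (Suc y)"
          using s2(4)[of "z + 3"] a(3) by (auto simp: fun_eq_iff L_def)
        moreover have "goes (Some s) body (L y) ?g"
          unfolding body_def
          by (rule goes_Seq[OF 1 goes_Seq[OF 2 goes_Seq[OF 3 goes_Seq[OF 4 goes_Seq[OF 5 goes_Seq[OF 6 7]]]]]])
        ultimately show ?thesis by simp
      qed
      have loop: "y \<le> ?t \<Longrightarrow> goes (Some s) (While (z + 2) body) (L y) (L ?t)" for y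
      proof (induction "?t - y" arbitrary: y)
        case 0
        then show ?case using goes_While_Nil[of "L y" "z + 2"] L2[of y] by simp
      next
        case (Suc n)
        have y: "n = ?t - Suc y" "Suc y \<le> ?t" "y < ?t" using Suc.hyps(2) by auto
        show ?case
          by (rule goes_While[OF _ body[OF y(3)] Suc.hyps(1)[OF y(1,2)]]) (use y L2[of y] in simp)
      qed
      let ?a = "\<sigma>(z := rep s ?t)"
      have 1: "goes (Some s) ct \<sigma> ?a"
        by (rule implementsD[OF ct h(1,2) _ h(4)]) (use h in \<open>auto simp: ready_def\<close>)
      let ?b = "?a(out := rep s (g ?N e))"
      have 2: "goes (Some s) cg ?a ?b"
        by (rule implementsD[OF cg h(1,2)]) (use h arz z in \<open>auto simp: ready_def\<close>)
      let ?c = "?b(z + 1 := rep s 0)"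
      have "goes (Some s) (copy_map (\<lambda>b. False) 2 (z + 1)) ?b (?b(z + 1 := map (\<lambda>b. False) (?b 2)))"
        by (rule goes_copy_map) (use a(2,3) z s2 in \<open>auto simp: fits_def\<close>)
      then have 3: "goes (Some s) (copy_map (\<lambda>b. False) 2 (z + 1)) ?b ?c"
        using a(2,3) z s2 by (simp add: rep_0 map_replicate_const)
      have 4: "goes (Some s) (nonzero z (z + 2)) ?c (?c(z + 2 := flag (?t \<noteq> 0)))"
        by (rule goes_nonzero) (use a(2,3) z s2 h(1) tN in auto)
      have 5: "?c(z + 2 := flag (?t \<noteq> 0)) = L 0"
        using a(3) by (auto simp: fun_eq_iff L_def R_def)
      have 6: "goes (Some s) (clear z ;; clear (z + 1)) (L ?t) ((L ?t)(z := [], z + 1 := []))"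
        by (rule goes_Seq[OF goes_clear goes_clear])
      have 7: "(L ?t)(z := [], z + 1 := []) = \<sigma>(out := rep s (R ?N e ?t))"
        using a(3) s2(4) by (auto simp: fun_eq_iff L_def)
      show "goes (Some s) c \<sigma> (\<sigma>(out := rep s (R ?N e ?t)))"
        unfolding c_def
        by (rule goes_Seq[OF 1 goes_Seq[OF 2 goes_Seq[OF 3 goes_Seq[OF 4[unfolded 5]
               goes_Seq[OF loop[OF le0] 6[unfolded 7]]]]]])
    qed
    then show "\<exists>c. implements c (\<lambda>N e. R N e (t N e)) ar out z" ..
  qed
  then show ?thesis by (simp add: R_def)
qed

text \<open>Simultaneous substitution, obtained by binding the arguments one after the other with
  \<open>cmp_let\<close>.\<close>

lemma cmp_subst:
  assumes "cmp f" "\<forall>a \<in> set as. cmp a"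
  shows "cmp (\<lambda>N e. f N (\<lambda>i. if i < length as then (as ! i) N e else e (i - length as)))"
  using assms
proof (induction "length as" arbitrary: f as)
  case 0
  then show ?case by simp
next
  case (Suc n)
  then obtain a bs where as: "as = a # bs" "length bs = n"
    by (cases as) auto
  \<comment> \<open>\<open>cmp_let\<close> will put the value of \<open>a\<close> in front of the
    old environment, which is index \<open>n\<close> behind the other \<open>n\<close> arguments.
    The renaming fetches variable 0 from there and shifts those arguments down by one.\<close>
  let ?f = "\<lambda>N e. f N (\<lambda>i. e (if i = 0 then n else if i - 1 < n then i - 1 else i))"
  let ?bs = "map (\<lambda>b N e. b N (\<lambda>i. e (Suc i))) bs"
  have "cmp ?f" by (rule cmp_rename) (rule Suc.prems(1))
  moreover have "\<forall>a \<in> set ?bs. cmp a" using Suc.prems(2) as cmp_rename[where \<rho> = Suc] by auto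
  ultimately have "cmp (\<lambda>N e. ?f N (\<lambda>i. if i < length ?bs then (?bs ! i) N e else e (i - length ?bs)))"
    using as by (intro Suc.hyps(1)) auto
  from cmp_let[OF this, of a]
  have "cmp (\<lambda>N e. ?f N (\<lambda>i. if i < n then (?bs ! i) N (a N e ## e) else (a N e ## e) (i - n)))"
    unfolding length_map as(2) using Suc.prems(2) as(1) by simp
  moreover have "(\<lambda>i. (\<lambda>i. if i < n then (?bs ! i) N (a N e ## e) else (a N e ## e) (i - n))
       (if i = 0 then n else if i - 1 < n then i - 1 else i)) =
     (\<lambda>i. if i < length as then (as ! i) N e else e (i - length as))" for N e
  proof
    fix i
    show "(\<lambda>i. if i < n then (?bs ! i) N (a N e ## e) else (a N e ## e) (i - n))
       (if i = 0 then n else if i - 1 < n then i - 1 else i) =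
      (if i < length as then (as ! i) N e else e (i - length as))"
    proof (cases "i \<le> n")
      case True
      then show ?thesis using as by (cases i) auto
    next
      case False
      then have "i - n = Suc (i - Suc n)" by simp
      then show ?thesis using as False by auto
    qed
  qed
  ultimately show ?case by simp
qed

lemma cmp_comp1: "cmp (\<lambda>N e. g N (e 0)) \<Longrightarrow> cmp a \<Longrightarrow> cmp (\<lambda>N e. g N (a N e))"
  using cmp_subst[of "\<lambda>N e. g N (e 0)" "[a]"] by simp

lemma cmp_comp2:
  "cmp (\<lambda>N e. g N (e 0) (e 1)) \<Longrightarrow> cmp a \<Longrightarrow> cmp b \<Longrightarrow> cmp (\<lambda>N e. g N (a N e) (b N e))"
  using cmp_subst[of "\<lambda>N e. g N (e 0) (e 1)" "[a, b]"] by simp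

lemma cmp_comp3:
  "cmp (\<lambda>N e. g N (e 0) (e 1) (e 2)) \<Longrightarrow> cmp a \<Longrightarrow> cmp b \<Longrightarrow> cmp c \<Longrightarrow>
    cmp (\<lambda>N e. g N (a N e) (b N e) (c N e))"
  using cmp_subst[of "\<lambda>N e. g N (e 0) (e 1) (e 2)" "[a, b, c]"] by simp

lemma cmp_comp4:
  "cmp (\<lambda>N e. g N (e 0) (e 1) (e 2) (e 3)) \<Longrightarrow> cmp a \<Longrightarrow> cmp b \<Longrightarrow> cmp c \<Longrightarrow> cmp d \<Longrightarrow>
    cmp (\<lambda>N e. g N (a N e) (b N e) (c N e) (d N e))"
  using cmp_subst[of "\<lambda>N e. g N (e 0) (e 1) (e 2) (e 3)" "[a, b, c, d]"]
  by (simp add: numeral_3_eq_3)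

lemma cmp_comp5:
  "cmp (\<lambda>N e. g N (e 0) (e 1) (e 2) (e 3) (e 4)) \<Longrightarrow> cmp a \<Longrightarrow> cmp b \<Longrightarrow> cmp c \<Longrightarrow> cmp d \<Longrightarrow> cmp h \<Longrightarrow>
    cmp (\<lambda>N e. g N (a N e) (b N e) (c N e) (d N e) (h N e))"
  using cmp_subst[of "\<lambda>N e. g N (e 0) (e 1) (e 2) (e 3) (e 4)" "[a, b, c, d, h]"]
  by (simp add: numeral_3_eq_3 numeral_eq_Suc)

lemma cmp_comp6:
  "cmp (\<lambda>N e. g N (e 0) (e 1) (e 2) (e 3) (e 4) (e 5)) \<Longrightarrow>
    cmp a \<Longrightarrow> cmp b \<Longrightarrow> cmp c \<Longrightarrow> cmp d \<Longrightarrow> cmp h \<Longrightarrow> cmp i \<Longrightarrow>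
    cmp (\<lambda>N e. g N (a N e) (b N e) (c N e) (d N e) (h N e) (i N e))"
  using cmp_subst[of "\<lambda>N e. g N (e 0) (e 1) (e 2) (e 3) (e 4) (e 5)" "[a, b, c, d, h, i]"]
  by (simp add: numeral_3_eq_3 numeral_eq_Suc)

section \<open>Deciding a language by a computable verdict\<close>

text \<open>The leading bit 1 marks the end of the word, so words that differ only in trailing
  \<open>False\<close> stay distinct, and 0 is the code of no word.\<close>

fun wd :: "bool list \<Rightarrow> nat" where
  "wd [] = 1"
| "wd (b # w) = 2 * wd w + (if b then 1 else 0)"

lemma wd_pos: "0 < wd w"
  by (induction w) auto

lemma wd_less: "wd w < 2 ^ (length w + 1)"
  by (induction w) auto

lemma rep_wd: "rep (length w + 2) (wd w) = w @ [True, False]"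
  by (induction w) auto

text \<open>The state at the start of a round: stack 1 keeps the loop going, stack 2 is the template
  of the current width, stack 5 holds the input.\<close>

definition at_width :: "nat \<Rightarrow> nat \<Rightarrow> stacks" where
  "at_width s x r = (if r = 1 then [True] else if r = 2 then replicate s False
     else if r = 5 then rep s x else [])"

definition widen :: com where
  "widen = mv 5 3 ;; Push 5 False ;; mv 3 5 ;; Push 2 False"

lemma goes_widen:
  assumes "x < 2 ^ s" "Suc s \<le> B"
  shows "goes (Some B) widen ((at_width s x)(1 := [])) ((at_width (Suc s) x)(1 := []))"
proof -
  let ?a = "(at_width s x)(1 := [])"
  have 1: "goes (Some B) (mv 5 3) ?a (?a(5 := [], 3 := rev (rep s x)))"
    using goes_mv[of 5 3 "Some B" ?a] assms by (simp add: at_width_def fits_def)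
  let ?b = "?a(5 := [], 3 := rev (rep s x))"
  have 2: "goes (Some B) (Push 5 False) ?b (?b(5 := [False]))"
    using goes_Push[of "Some B" ?b 5 False] assms by (simp add: fits_def)
  let ?c = "?b(5 := [False])"
  have 3: "goes (Some B) (mv 3 5) ?c (?c(3 := [], 5 := rep s x @ [False]))"
    using goes_mv[of 3 5 "Some B" ?c] assms by (simp add: fits_def)
  let ?d = "?c(3 := [], 5 := rep s x @ [False])"
  have 4: "goes (Some B) (Push 2 False) ?d (?d(2 := False # ?d 2))"
    using goes_Push[of "Some B" ?d 2 False] assms by (simp add: fits_def at_width_def)
  have "?d(2 := False # ?d 2) = (at_width (Suc s) x)(1 := [])"
    using rep_append_False[OF assms(1)] by (auto simp: fun_eq_iff at_width_def simp del: rep.simps)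
  then show ?thesis
    unfolding widen_def using goes_Seq[OF 1 goes_Seq[OF 2 goes_Seq[OF 3 4]]] by simp
qed

definition setup_width :: com where
  "setup_width = Push 5 False ;; Push 5 True ;; Push 2 False ;; Push 2 False ;; mv 0 3 ;;
     drain 3 (Push 5 False ;; Push 2 False) (Push 5 True ;; Push 2 False) ;; Push 1 True"

lemma goes_setup_width:
  assumes "length w + 2 \<le> B"
  shows "goes (Some B) setup_width (init_stacks w) (at_width (length w + 2) (wd w))"
proof -
  let ?a = "(init_stacks w)(5 := [True, False], 2 := [False, False])"
  have 1: "goes (Some B) (Push 5 False) (init_stacks w) ((init_stacks w)(5 := [False]))"
    using goes_Push[of "Some B" "init_stacks w" 5 False] assms by (simp add: fits_def init_stacks_def)
  have 2: "goes (Some B) (Push 5 True) ((init_stacks w)(5 := [False])) ((init_stacks w)(5 := [True, False]))"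
    using goes_Push[of "Some B" "(init_stacks w)(5 := [False])" 5 True] assms
    by (simp add: fits_def)
  have 3: "goes (Some B) (Push 2 False) ((init_stacks w)(5 := [True, False])) ((init_stacks w)(5 := [True, False], 2 := [False]))"
    using goes_Push[of "Some B" "(init_stacks w)(5 := [True, False])" 2 False] assms
    by (simp add: fits_def init_stacks_def)
  have 4: "goes (Some B) (Push 2 False) ((init_stacks w)(5 := [True, False], 2 := [False])) ?a"
    using goes_Push[of "Some B" "(init_stacks w)(5 := [True, False], 2 := [False])" 2 False] assms
    by (simp add: fits_def)
  have 5: "goes (Some B) (mv 0 3) ?a (?a(0 := [], 3 := rev w))"
    using goes_mv[of 0 3 "Some B" ?a] assms by (simp add: fits_def init_stacks_def)
  let ?S = "\<lambda>pre ys. ?a(0 := [], 3 := ys, 5 := rev pre @ [True, False], 2 := replicate (length pre + 2) False)"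
  have "goes (Some B) (drain 3 (Push 5 False ;; Push 2 False) (Push 5 True ;; Push 2 False))
     (?S [] (rev w)) (?S (rev w) [])"
  proof (rule goes_drain[where S = ?S])
    fix pre x ys
    assume xs: "rev w = pre @ x # ys"
    have l: "length w = length pre + Suc (length ys)"
      using arg_cong[OF xs, of length] by simp
    let ?s = "(?S pre (x # ys))(3 := ys)"
    have f: "fits (Some B) (Suc (length (?s 5)))" "fits (Some B) (Suc (length ((?s(5 := x # ?s 5)) 2)))"
      using assms l by (auto simp: fits_def)
    have "goes (Some B) (Push 5 x ;; Push 2 False) ?s (?S (pre @ [x]) ys)"
      by (rule goes_Seq, rule goes_PushI, rule f(1), rule refl, rule goes_PushI, rule f(2))
        (auto simp: fun_eq_iff)
    then show "goes (Some B) (if x then Push 5 True ;; Push 2 False else Push 5 False ;; Push 2 False)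
      ?s (?S (pre @ [x]) ys)"
      by (cases x) simp_all
  qed simp
  moreover have "?S [] (rev w) = ?a(0 := [], 3 := rev w)"
    by (auto simp: fun_eq_iff numeral_2_eq_2)
  ultimately have 6: "goes (Some B) (drain 3 (Push 5 False ;; Push 2 False) (Push 5 True ;; Push 2 False))
     (?a(0 := [], 3 := rev w)) (?S (rev w) [])"
    by simp
  have 7: "goes (Some B) (Push 1 True) (?S (rev w) []) ((?S (rev w) [])(1 := [True]))"
    using goes_Push[of "Some B" "?S (rev w) []" 1 True] assms by (simp add: fits_def init_stacks_def)
  have "(?S (rev w) [])(1 := [True]) = at_width (length w + 2) (wd w)"
    using rep_wd[of w] by (auto simp: fun_eq_iff at_width_def init_stacks_def)
  then show ?thesis
    unfolding setup_width_def
    using goes_Seq[OF 1 goes_Seq[OF 2 goes_Seq[OF 3 goes_Seq[OF 4 goes_Seq[OF 5 goes_Seq[OF 6 7]]]]]]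
    by simp
qed

text \<open>Verdict 0 asks for a wider round, 1 accepts, 3 rejects: the lowest bit tells whether
  there is a verdict and the next one whether it is negative, so that two tests with a pop in
  between read it. The initial width \<open>length w + 2\<close> holds the code of the word and is
  at least 2.\<close>

theorem decide_by_width:
  assumes V: "cmp (\<lambda>N e. V N (e 0))"
    and correct: "\<And>w s. length w + 2 \<le> s \<Longrightarrow> V (2 ^ s) (wd w) \<in> {0, if w \<in> L then 1 else 3}"
    and verdict: "\<And>w. \<exists>s \<ge> length w + 2. s \<le> S (length w) \<and> V (2 ^ s) (wd w) \<noteq> 0"
    and poly: "is_poly p" and S: "\<And>n. S n < expk k (p n)"
  shows "L \<in> kEXPSPACE k"
proof -
  have "\<exists>c. implements c (\<lambda>N e. V N (e 0)) (\<lambda>_. 5) 6 7"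
    by (rule cmp_code[OF V]) auto
  then obtain c where c: "implements c (\<lambda>N e. V N (e 0)) (\<lambda>_. 5) 6 7" ..
  define check where "check = If3 6 Skip (clear 6 ;; widen ;; Push 1 True) (Pop 6 ;; If3 6 Skip Skip (Push 7 True))"
  \<comment> \<open>Stack 1 controls the loop and also carries the final answer, so a rejection
    waits on stack 7 until the loop has ended.\<close>
  define prog where "prog = setup_width ;; While 1 (Pop 1 ;; c ;; check) ;; If3 7 Skip Skip (Push 1 True)"
  obtain M where M: "wf_tm M"
    and run: "\<And>w B t \<sigma>. exec (Some B) prog (init_stacks w) t \<sigma> \<Longrightarrow> length w \<le> B \<Longrightarrow>
      \<exists>n \<le> t * (2 * B + 6) + 2. cstate (run M w n) = (if \<sigma> 1 = [] then 1 else 2) \<and>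
        (\<forall>i. chead (run M w i) \<le> B) \<and>
        ((\<forall>r > 0. \<sigma> r = []) \<longrightarrow> (\<forall>i < length (\<sigma> 0). ctape (run M w n) i = sym_of (\<sigma> 0 ! i)) \<and>
           ctape (run M w n) (length (\<sigma> 0)) = 0)"
    by (rule compile_stacks[of prog], rule that)
  have "\<exists>\<sigma> B. goes (Some B) prog (init_stacks w) \<sigma> \<and> length w \<le> B \<and> B \<le> S (length w) \<and> (\<sigma> 1 = [] \<longleftrightarrow> w \<in> L)" for w
  proof -
    define s0 where "s0 = length w + 2"
    define x where "x = wd w"
    \<comment> \<open>Widths are tried one by one, hence the loop ends at the least successful one.
      It is at most the width promised by \<open>verdict\<close> and bounds the space of all
      rounds.\<close>
    define s1 where "s1 = (LEAST s. s0 \<le> s \<and> V (2 ^ s) x \<noteq> 0)"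
    obtain s2 where s2: "s0 \<le> s2" "s2 \<le> S (length w)" "V (2 ^ s2) x \<noteq> 0"
      using verdict[of w] by (auto simp: s0_def x_def)
    then have s1: "s0 \<le> s1" "V (2 ^ s1) x \<noteq> 0" "s1 \<le> S (length w)"
      using LeastI[of "\<lambda>s. s0 \<le> s \<and> V (2 ^ s) x \<noteq> 0" s2]
        Least_le[of "\<lambda>s. s0 \<le> s \<and> V (2 ^ s) x \<noteq> 0" s2] by (auto simp: s1_def)
    have retry: "V (2 ^ s) x = 0" if "s0 \<le> s" "s < s1" for s
      using not_less_Least[of s "\<lambda>s. s0 \<le> s \<and> V (2 ^ s) x \<noteq> 0"] that by (auto simp: s1_def)
    have xs: "x < 2 ^ s" if "s0 \<le> s" for s
      using wd_less[of w] power_increasing[of "length w + 1" s "2::nat"] that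
      by (auto simp: s0_def x_def)
    have pop: "goes (Some s1) (Pop 1) (at_width s x) ((at_width s x)(1 := []))" for s
      by (rule goes_PopI) (auto simp: at_width_def fun_eq_iff)
    have head: "goes (Some s1) c ((at_width s x)(1 := [])) ((at_width s x)(1 := [], 6 := rep s (V (2 ^ s) x)))"
      if "s0 \<le> s" "s \<le> s1" for s
    proof -
      have "goes (Some s) c ((at_width s x)(1 := [])) ((at_width s x)(1 := [], 6 := rep s (V (2 ^ s) x)))"
        by (rule implementsD[OF c, of s "\<lambda>_. x"]) (use xs that in \<open>auto simp: s0_def ready_def at_width_def\<close>)
      from goes_mono[OF this that(2)] show ?thesis .
    qed
    define fin where "fin = ((at_width s1 x)(1 := [], 6 := tl (rep s1 (V (2 ^ s1) x)), 7 := flag (w \<notin> L)))"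
    have loop: "s0 \<le> s \<Longrightarrow> s \<le> s1 \<Longrightarrow> goes (Some s1) (While 1 (Pop 1 ;; c ;; check)) (at_width s x) fin" for s
    proof (induction "s1 - s" arbitrary: s)
      case 0
      then have s: "s = s1" by simp
      let ?a = "(at_width s1 x)(1 := [], 6 := rep s1 (V (2 ^ s1) x))"
      obtain s' where s': "s1 = Suc (Suc s')"
        using s1(1) that[of "s1 - 2"] by (auto simp: s0_def)
      have v: "V (2 ^ s1) x = (if w \<in> L then 1 else 3)"
        using correct[of w s1] s1 by (auto simp: s0_def x_def)
      have "rep s1 (if w \<in> L then 1 else 3) = True # (w \<notin> L) # rep s' 0"
        by (simp add: s')
      then have a6: "?a 6 = True # (w \<notin> L) # rep s' 0"
        unfolding v by simp
      let ?b = "?a(6 := tl (?a 6))"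
      have 1: "goes (Some s1) (Pop 6) ?a ?b" by (rule goes_Pop)
      have 2: "goes (Some s1) (If3 6 Skip Skip (Push 7 True)) ?b fin"
      proof (cases "w \<in> L")
        case True
        have "?b = fin" using True by (auto simp: fin_def fun_eq_iff at_width_def)
        moreover have "?b 6 = False # rep s' 0" using a6 True by simp
        ultimately show ?thesis using goes_Skip[of "Some s1" fin] by (intro goes_If3) simp
      next
        case False
        have "goes (Some s1) (Push 7 True) ?b fin"
          by (rule goes_PushI) (use s' False in \<open>auto simp: at_width_def fits_def fin_def fun_eq_iff\<close>)
        moreover have "?b 6 = True # rep s' 0" using a6 False by simp
        ultimately show ?thesis by (intro goes_If3) simp
      qed
      have 3: "goes (Some s1) check ?a fin"
        unfolding check_def using goes_Seq[OF 1 2] a6 by (intro goes_If3) simp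
      have "goes (Some s1) (Pop 1 ;; c ;; check) (at_width s x) fin"
        unfolding s by (rule goes_Seq[OF pop goes_Seq[OF head[OF s1(1) order_refl] 3]])
      moreover have "goes (Some s1) (While 1 (Pop 1 ;; c ;; check)) fin fin"
        by (rule goes_While_Nil) (simp add: fin_def)
      ultimately show ?case
        by (rule goes_While[rotated]) (simp add: at_width_def)
    next
      case (Suc n)
      then have s: "s < s1" "n = s1 - Suc s" by auto
      let ?a = "(at_width s x)(1 := [], 6 := rep s (V (2 ^ s) x))"
      have a6: "?a 6 = False # rep (s - 1) 0"
        using retry[of s] s Suc.prems by (cases s) (auto simp: s0_def)
      have 1: "goes (Some s1) (clear 6) ?a ((at_width s x)(1 := []))"
        using goes_clear[of "Some s1" 6 ?a] by (simp add: at_width_def fun_upd_idem)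
      have 2: "goes (Some s1) widen ((at_width s x)(1 := [])) ((at_width (Suc s) x)(1 := []))"
        by (rule goes_widen) (use xs s Suc.prems in auto)
      have 3: "goes (Some s1) (Push 1 True) ((at_width (Suc s) x)(1 := [])) (at_width (Suc s) x)"
        using goes_Push[of "Some s1" "(at_width (Suc s) x)(1 := [])" 1 True] s
        by (simp add: fits_def fun_upd_idem at_width_def)
      have 4: "goes (Some s1) check ?a (at_width (Suc s) x)"
        unfolding check_def using goes_Seq[OF 1 goes_Seq[OF 2 3]] a6 by (intro goes_If3) simp
      have "goes (Some s1) (Pop 1 ;; c ;; check) (at_width s x) (at_width (Suc s) x)"
        by (rule goes_Seq[OF pop goes_Seq[OF head[OF Suc.prems] 4]])
      moreover have "goes (Some s1) (While 1 (Pop 1 ;; c ;; check)) (at_width (Suc s) x) fin"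
        using Suc.hyps(1)[OF s(2)] s Suc.prems by simp
      ultimately show ?case
        by (rule goes_While[rotated]) (simp add: at_width_def)
    qed
    define out where "out = fin(1 := flag (w \<notin> L))"
    have "goes (Some s1) (If3 7 Skip Skip (Push 1 True)) fin out"
    proof (cases "w \<in> L")
      case True
      then have "out = fin" by (auto simp: out_def fin_def fun_eq_iff)
      then show ?thesis using goes_Skip[of "Some s1" fin] True by (intro goes_If3) (simp add: fin_def)
    next
      case False
      have "goes (Some s1) (Push 1 True) fin out"
        by (rule goes_PushI) (use s1(1) False in \<open>auto simp: out_def fits_def fin_def fun_eq_iff s0_def\<close>)
      then show ?thesis using False by (intro goes_If3) (simp add: fin_def)
    qed
    moreover have "goes (Some s1) setup_width (init_stacks w) (at_width s0 x)"
      using goes_setup_width[of w s1] s1(1) by (simp add: s0_def x_def)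
    ultimately have "goes (Some s1) prog (init_stacks w) out"
      unfolding prog_def using loop[OF order_refl s1(1)] by (blast intro: goes_Seq)
    moreover have "out 1 = [] \<longleftrightarrow> w \<in> L" by (simp add: out_def flag_def)
    ultimately show ?thesis using s1 by (intro exI[of _ out] exI[of _ s1]) (simp add: s0_def)
  qed
  then have "decides_in_space M L (\<lambda>n. expk k (p n))"
    unfolding decides_in_space_def
  proof (intro conjI allI M)
    fix w
    obtain \<sigma> B where \<sigma>: "goes (Some B) prog (init_stacks w) \<sigma>" "length w \<le> B" "B \<le> S (length w)" "\<sigma> 1 = [] \<longleftrightarrow> w \<in> L"
      using \<open>\<And>w. \<exists>\<sigma> B. goes (Some B) prog (init_stacks w) \<sigma> \<and> length w \<le> B \<and> B \<le> S (length w) \<and> (\<sigma> 1 = [] \<longleftrightarrow> w \<in> L)\<close>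
      by blast
    then obtain t where "exec (Some B) prog (init_stacks w) t \<sigma>" by (auto simp: goes_def)
    from run[OF this \<sigma>(2)] obtain n where n: "cstate (run M w n) = (if \<sigma> 1 = [] then 1 else 2)"
      "\<forall>i. chead (run M w i) \<le> B" by blast
    show "\<exists>t. halted (cstate (run M w t)) \<and> (cstate (run M w t) = 1 \<longleftrightarrow> w \<in> L)"
      using n(1) \<sigma>(4) by (intro exI[of _ n]) (auto simp: halted_def)
    show "chead (run M w t) < expk k (p (length w))" for t
      using n(2) \<sigma>(3) S[of "length w"] by (meson le_less_trans)
  qed
  then show ?thesis using poly by (auto simp: kEXPSPACE_def)
qed

section \<open>Closure properties of the computable functions\<close>

abbreviation cmpP :: "(nat \<Rightarrow> (nat \<Rightarrow> nat) \<Rightarrow> bool) \<Rightarrow> bool" where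
  "cmpP P \<equiv> cmp (\<lambda>N e. of_bool (P N e))"

lemma two_power_ge_4: "2 \<le> s \<Longrightarrow> (4::nat) \<le> 2 ^ s"
  using power_increasing[of 2 s "2::nat"] by simp

lemma cmp_one: "cmp (\<lambda>N e. 1)"
  by (rule cmp_cong[OF cmp_suc[OF cmp_zero]]) (use two_power_ge_4 in force)

lemma cmp_two: "cmp (\<lambda>N e. 2)"
  by (rule cmp_cong[OF cmp_suc[OF cmp_one]]) (use two_power_ge_4 in force)

lemma cmp_three: "cmp (\<lambda>N e. 3)"
  by (rule cmp_cong[OF cmp_suc[OF cmp_two]]) (use two_power_ge_4 in force)

lemma cmp_lift2: "cmp a \<Longrightarrow> cmp (\<lambda>N e. a N (\<lambda>i. e (Suc (Suc i))))"
  by (rule cmp_rename)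

lemma cmp_pred:
  assumes "cmp a"
  shows "cmp (\<lambda>N e. a N e - 1)"
proof -
  have "rec_nat 0 (\<lambda>y r. y) n = n - 1" for n :: nat
    by (cases n) auto
  then show ?thesis
    using cmp_rec[OF assms cmp_zero, of "\<lambda>N y r e. y"] cmp_var by simp
qed

lemma cmp_if_zero:
  assumes "cmp c" "cmp a" "cmp b"
  shows "cmp (\<lambda>N e. if c N e = 0 then b N e else a N e)"
proof -
  have "rec_nat y (\<lambda>_ _. x) n = (if n = 0 then y else x)" for x y n :: nat
    by (cases n) auto
  then show ?thesis
    using cmp_rec[OF assms(1,3), of "\<lambda>N y r e. a N e"] cmp_lift2[OF assms(2)] by simp
qed

lemma cmp_diff:
  assumes "cmp a" "cmp b"
  shows "cmp (\<lambda>N e. a N e - b N e)"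
proof -
  have "rec_nat x (\<lambda>_ r. r - 1) n = x - n" for x n :: nat
    by (induction n) auto
  then show ?thesis
    using cmp_rec[OF assms(2,1), of "\<lambda>N y r e. r - 1"] cmp_pred[OF cmp_var] by simp
qed

lemma cmp_not: "cmpP P \<Longrightarrow> cmpP (\<lambda>N e. \<not> P N e)"
  by (rule cmp_cong[OF cmp_if_zero[OF _ cmp_zero cmp_one]]) auto

lemma cmp_if:
  assumes "cmpP P" "cmp a" "cmp b"
  shows "cmp (\<lambda>N e. if P N e then a N e else b N e)"
  by (rule cmp_cong[OF cmp_if_zero[OF assms]]) auto

lemma cmp_and:
  assumes "cmpP P" "cmpP Q"
  shows "cmpP (\<lambda>N e. P N e \<and> Q N e)"
  by (rule cmp_cong[OF cmp_if[OF assms cmp_zero]]) auto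

lemma cmp_or:
  assumes "cmpP P" "cmpP Q"
  shows "cmpP (\<lambda>N e. P N e \<or> Q N e)"
  by (rule cmp_cong[OF cmp_if[OF assms(1) cmp_one assms(2)]]) auto

lemma cmp_imp:
  assumes "cmpP P" "cmpP Q"
  shows "cmpP (\<lambda>N e. P N e \<longrightarrow> Q N e)"
  by (rule cmp_cong[OF cmp_if[OF assms cmp_one]]) auto

lemma cmp_iff:
  assumes "cmpP P" "cmpP Q"
  shows "cmpP (\<lambda>N e. P N e \<longleftrightarrow> Q N e)"
  by (rule cmp_cong[OF cmp_if[OF assms cmp_not[OF assms(2)]]]) auto

lemma cmp_le: "cmp a \<Longrightarrow> cmp b \<Longrightarrow> cmpP (\<lambda>N e. a N e \<le> b N e)"
  by (rule cmp_cong[OF cmp_if_zero[OF cmp_diff[of a b] cmp_zero cmp_one]]) auto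

lemma cmp_less: "cmp a \<Longrightarrow> cmp b \<Longrightarrow> cmpP (\<lambda>N e. a N e < b N e)"
  by (rule cmp_cong[OF cmp_not[OF cmp_le[of b a]]]) auto

lemma cmp_eq: "cmp a \<Longrightarrow> cmp b \<Longrightarrow> cmpP (\<lambda>N e. a N e = b N e)"
  by (rule cmp_cong[OF cmp_and[OF cmp_le[of a b] cmp_le[of b a]]]) auto

text \<open>A quantifier binds one variable, the recursion implementing it binds two, counter and
  accumulator; the renaming skips the accumulator.\<close>

lemma cmp_lift_binder:
  "cmp (\<lambda>N e. f N (e 0) (\<lambda>i. e (Suc i))) \<Longrightarrow> cmp (\<lambda>N e. f N (e 0) (\<lambda>i. e (Suc (Suc i))))"
  using cmp_rename[of "\<lambda>N e. f N (e 0) (\<lambda>i. e (Suc i))" "case_nat 0 (\<lambda>i. Suc (Suc i))"] by simp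

lemma cmp_ex:
  assumes "cmpP (\<lambda>N e. P N (e 0) (\<lambda>i. e (Suc i)))" "cmp t"
  shows "cmpP (\<lambda>N e. \<exists>y<t N e. P N y e)"
proof -
  have "rec_nat 0 (\<lambda>y r. if Q y then Suc 0 else r) n = of_bool (\<exists>y<n. Q y)" for Q and n :: nat
    by (induction n) (auto simp: less_Suc_eq)
  then show ?thesis
    using cmp_rec[OF assms(2) cmp_zero, of "\<lambda>N y r e. if P N y e then 1 else r"]
      cmp_if[OF cmp_lift_binder[where f = "\<lambda>N y e. of_bool (P N y e)", OF assms(1)] cmp_one cmp_var[of 1]]
    by simp
qed

lemma cmp_all:
  assumes "cmpP (\<lambda>N e. P N (e 0) (\<lambda>i. e (Suc i)))" "cmp t"
  shows "cmpP (\<lambda>N e. \<forall>y<t N e. P N y e)"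
proof -
  have "cmpP (\<lambda>N e. \<exists>y<t N e. \<not> P N y e)"
    by (rule cmp_ex[where P = "\<lambda>N y e. \<not> P N y e"], rule cmp_not, rule assms(1), rule assms(2))
  then have "cmpP (\<lambda>N e. \<not> (\<exists>y<t N e. \<not> P N y e))"
    by (rule cmp_not)
  moreover have "(\<not> (\<exists>y<t N e. \<not> P N y e)) = (\<forall>y<t N e. P N y e)" for N e
    by blast
  ultimately show ?thesis by presburger
qed

text \<open>The largest witness below the bound, or 0 if there is none.\<close>

definition search :: "nat \<Rightarrow> (nat \<Rightarrow> bool) \<Rightarrow> nat" where
  "search n P = rec_nat 0 (\<lambda>y r. if P y then y else r) n"

lemma search_unique: "P y \<Longrightarrow> y < n \<Longrightarrow> (\<And>z. P z \<Longrightarrow> z = y) \<Longrightarrow> search n P = y"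
proof -
  assume P: "P y" "\<And>z. P z \<Longrightarrow> z = y" and "y < n"
  have eq: "P = (\<lambda>z. z = y)"
    using P by blast
  have "search m P = (if y < m then y else 0)" for m
    unfolding eq by (induction m) (auto simp: search_def less_Suc_eq)
  then show ?thesis using \<open>y < n\<close> by simp
qed

lemma search_le: "search n P \<le> n"
proof (induction n)
  case (Suc n)
  then show ?case by (simp add: search_def)
qed (simp add: search_def)

lemma search_cases: "search n P = 0 \<or> P (search n P)"
proof (induction n)
  case (Suc n)
  then show ?case by (simp add: search_def)
qed (simp add: search_def)

lemma cmp_search:
  assumes "cmpP (\<lambda>N e. P N (e 0) (\<lambda>i. e (Suc i)))" "cmp t"
  shows "cmp (\<lambda>N e. search (t N e) (\<lambda>y. P N y e))"
  unfolding search_def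
  using cmp_rec[OF assms(2) cmp_zero, of "\<lambda>N y r e. if P N y e then y else r"]
      cmp_if[OF cmp_lift_binder[where f = "\<lambda>N y e. of_bool (P N y e)", OF assms(1)] cmp_var[of 0] cmp_var[of 1]]
  by simp

lemma cmp_mod:
  assumes "cmp a" "cmp b"
  shows "cmp (\<lambda>N e. a N e mod b N e)"
proof -
  \<comment> \<open>Only the successor modulo \<open>N\<close> is available; claim \<open>R\<close>
    shows that it does not wrap around here.\<close>
  let ?R = "\<lambda>N b n. rec_nat 0 (\<lambda>y r. if Suc r mod N = b then 0 else Suc r mod N) n :: nat"
  have R: "n < N \<Longrightarrow> ?R N b n = n mod b" for N b n :: nat
  proof (induction n)
    case (Suc n)
    then have "Suc (n mod b) < N"
      using mod_less_eq_dividend[of n b] by linarith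
    then show ?case using Suc by (auto simp: mod_Suc)
  qed simp
  have "cmp (\<lambda>N e. ?R N (e 1) (e 0))"
    by (intro cmp_rec[where f = "\<lambda>N y r e. if Suc r mod N = e 1 then 0 else Suc r mod N"]
        cmp_var cmp_zero cmp_if cmp_eq cmp_suc)
  then have "cmp (\<lambda>N e. e 0 mod e 1)"
    by (rule cmp_cong) (use R in auto)
  from cmp_comp2[where g = "\<lambda>N a b. a mod b", OF this assms] show ?thesis .
qed

lemma cmp_div:
  assumes "cmp a" "cmp b"
  shows "cmp (\<lambda>N e. a N e div b N e)"
proof -
  let ?R = "\<lambda>N b n. rec_nat 0 (\<lambda>y r. if b \<noteq> 0 \<and> (Suc y mod N) mod b = 0 then Suc r mod N else r) n :: nat"
  have R: "n < N \<Longrightarrow> ?R N b n = n div b" for N b n :: nat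
  proof (induction n)
    case (Suc n)
    then have "Suc (n div b) < N"
      using div_le_dividend[of n b] by linarith
    then show ?case using Suc by (cases "b = 0") (auto simp: div_Suc)
  qed simp
  have "cmp (\<lambda>N e. ?R N (e 1) (e 0))"
    by (intro cmp_rec[where f = "\<lambda>N y r e. if e 1 \<noteq> 0 \<and> (Suc y mod N) mod e 1 = 0 then Suc r mod N else r"]
        cmp_var cmp_zero cmp_if cmp_and cmp_not cmp_eq cmp_suc cmp_mod)
  then have "cmp (\<lambda>N e. e 0 div e 1)"
    by (rule cmp_cong) (use R in auto)
  from cmp_comp2[where g = "\<lambda>N a b. a div b", OF this assms] show ?thesis .
qed

lemma cmp_even: "cmp a \<Longrightarrow> cmpP (\<lambda>N e. even (a N e))"
  by (rule cmp_cong[OF cmp_eq[OF cmp_mod[OF _ cmp_two] cmp_zero]]) (auto simp: even_iff_mod_2_eq_zero)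

text \<open>The power itself may exceed \<open>N\<close>; dividing by the base again and again never
  leaves the range.\<close>

lemma cmp_div_power:
  assumes "cmp a" "cmp b" "cmp j"
  shows "cmp (\<lambda>N e. a N e div b N e ^ j N e)"
proof -
  have R: "rec_nat x (\<lambda>_ r. r div b) n = x div b ^ n" for x b n :: nat
    by (induction n) (simp_all add: div_mult2_eq[symmetric] mult.commute)
  have "cmp (\<lambda>N e. rec_nat (e 0) (\<lambda>_ r. r div e 1) (e 2))"
    by (intro cmp_rec[where f = "\<lambda>N y r e. r div e 1"] cmp_var cmp_div)
  then have "cmp (\<lambda>N e. e 0 div e 1 ^ e 2)"
    unfolding R .
  from cmp_comp3[where g = "\<lambda>N a b j. a div b ^ j", OF this assms] show ?thesis .
qed

subsection \<open>Saturating arithmetic\<close>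

definition sadd :: "nat \<Rightarrow> nat \<Rightarrow> nat \<Rightarrow> nat" where
  "sadd N a b = min (a + b) (N - 1)"

definition smul :: "nat \<Rightarrow> nat \<Rightarrow> nat \<Rightarrow> nat" where
  "smul N a b = min (a * b) (N - 1)"

definition spow :: "nat \<Rightarrow> nat \<Rightarrow> nat \<Rightarrow> nat" where
  "spow N a b = min (a ^ b) (N - 1)"

lemma cmp_sadd:
  assumes "cmp a" "cmp b"
  shows "cmp (\<lambda>N e. sadd N (a N e) (b N e))"
proof -
  let ?R = "\<lambda>N a n. rec_nat a (\<lambda>y r. if r = N - 1 then r else Suc r mod N) n :: nat"
  have R: "a < N \<Longrightarrow> ?R N a n = sadd N a n" for N a n :: nat
    by (induction n) (auto simp: sadd_def min_def)
  have "cmp (\<lambda>N e. ?R N (e 0) (e 1))"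
    by (intro cmp_rec[where f = "\<lambda>N y r e. if r = N - 1 then r else Suc r mod N"]
        cmp_var cmp_top cmp_if cmp_eq cmp_suc)
  then have "cmp (\<lambda>N e. sadd N (e 0) (e 1))"
    by (rule cmp_cong) (use R in auto)
  from cmp_comp2[where g = sadd, OF this assms] show ?thesis .
qed

text \<open>Cutting off at \<open>N - 1\<close> is compatible with each operation, so a compound
  saturated expression is its true value cut off once at the end. A result below
  \<open>N - 1\<close> is therefore exact, and \<open>N - 1\<close> serves as the overflow
  signal.\<close>

lemma sadd_min: "sadd N (min a (N - 1)) (min b (N - 1)) = min (a + b) (N - 1)"
  by (auto simp: sadd_def min_def)

lemma smul_min: "smul N (min a (N - 1)) (min b (N - 1)) = min (a * b) (N - 1)"
\<comment> \<open>A zero factor hides an overflow of the other one; both sides are 0 in that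
  case.\<close>
proof (cases "a = 0 \<or> b = 0")
  case False
  then have "N - 1 \<le> (N - 1) * b" "N - 1 \<le> a * (N - 1)" "N - 1 \<le> (N - 1) * (N - 1)"
    by auto
  moreover have "N - 1 \<le> a \<Longrightarrow> N - 1 \<le> a * b" "N - 1 \<le> b \<Longrightarrow> N - 1 \<le> a * b"
    using False mult_le_mono[of "N - 1" a 1 b] mult_le_mono[of 1 a "N - 1" b] by simp_all
  ultimately show ?thesis unfolding smul_def min_def by auto
qed (auto simp: smul_def)

text \<open>An exponent cut off at \<open>N - 1\<close> still makes the power overflow, because
  \<open>N - 1 < 2 ^ (N - 1)\<close>.\<close>

lemma spow_min: "spow N 2 (min b (N - 1)) = min (2 ^ b) (N - 1)"
proof (cases "b \<le> N - 1")
  case False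
  have "N - 1 < 2 ^ (N - 1)" by (rule less_exp)
  moreover have "(2::nat) ^ (N - 1) \<le> 2 ^ b" using False by (intro power_increasing) auto
  ultimately have "min (2 ^ (N - 1)) (N - 1) = N - 1" "min (2 ^ b) (N - 1) = N - 1"
    by linarith+
  then show ?thesis using False unfolding spow_def by (simp add: min_absorb2)
qed (simp add: spow_def)

lemma cmp_smul:
  assumes "cmp a" "cmp b"
  shows "cmp (\<lambda>N e. smul N (a N e) (b N e))"
proof -
  let ?R = "\<lambda>N a n. rec_nat 0 (\<lambda>y r. sadd N r a) n :: nat"
  have R: "?R N a n = smul N a n" for N a n :: nat
    by (induction n) (auto simp: sadd_def smul_def min_def)
  have "cmp (\<lambda>N e. ?R N (e 0) (e 1))"
    by (intro cmp_rec[where f = "\<lambda>N y r e. sadd N r (e 0)"] cmp_var cmp_zero cmp_sadd)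
  then have "cmp (\<lambda>N e. smul N (e 0) (e 1))"
    unfolding R .
  from cmp_comp2[where g = smul, OF this assms] show ?thesis .
qed

lemma cmp_spow:
  assumes "cmp a" "cmp b"
  shows "cmp (\<lambda>N e. spow N (a N e) (b N e))"
proof -
  let ?R = "\<lambda>N a n. rec_nat 1 (\<lambda>y r. smul N r a) n :: nat"
  have R: "?R N a n = spow N a n" if "2 \<le> N" "a < N" for N a n :: nat
  proof (induction n)
    case (Suc n)
    have "smul N (min (a ^ n) (N - 1)) (min a (N - 1)) = min (a ^ n * a) (N - 1)"
      by (rule smul_min)
    then show ?case using Suc that by (simp add: spow_def mult.commute)
  qed (use that in \<open>simp add: spow_def\<close>)
  have "cmp (\<lambda>N e. ?R N (e 0) (e 1))"
    by (intro cmp_rec[where f = "\<lambda>N y r e. smul N r (e 0)"] cmp_var cmp_one cmp_smul)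
  then have "cmp (\<lambda>N e. spow N (e 0) (e 1))"
  proof (rule cmp_cong)
    fix s :: nat and e :: "nat \<Rightarrow> nat"
    assume "2 \<le> s" "\<forall>i. e i < 2 ^ s"
    then show "?R (2 ^ s) (e 0) (e 1) = spow (2 ^ s) (e 0) (e 1)"
      using two_power_ge_4[of s] by (intro R) auto
  qed
  from cmp_comp2[where g = spow, OF this assms] show ?thesis .
qed

lemma cmp_expk:
  assumes "cmp a"
  shows "cmp (\<lambda>N e. min (expk k (a N e)) (N - 1))"
proof (induction k)
  case 0
  show ?case
  proof (rule cmp_cong[OF assms])
    fix s :: nat and e :: "nat \<Rightarrow> nat"
    assume "2 \<le> s" "\<forall>i. e i < 2 ^ s"
    from cmp_range[OF assms this] show "a (2 ^ s) e = min (expk 0 (a (2 ^ s) e)) (2 ^ s - 1)"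
      by simp
  qed
next
  case (Suc k)
  from cmp_spow[OF cmp_two this] show ?case
    unfolding spow_min by simp
qed

lemmas cmp_intros = cmp_var cmp_zero cmp_one cmp_two cmp_three cmp_top cmp_not cmp_if cmp_and cmp_or
  cmp_imp cmp_iff cmp_le cmp_less cmp_eq cmp_ex cmp_all cmp_search cmp_diff cmp_mod cmp_div cmp_even
  cmp_div_power cmp_sadd cmp_smul cmp_spow

section \<open>Parsing instances\<close>

declare bits.simps [simp del]

lemma enc_nat_0: "enc_nat 0 = [False, False]"
  by (simp add: enc_nat_def bits.simps)

lemma enc_nat_pos: "0 < m \<Longrightarrow> enc_nat m = True # odd m # enc_nat (m div 2)"
  by (simp add: enc_nat_def bits.simps[of m])

text \<open>Meaning: the word coded by \<open>y\<close> starts with \<open>enc_nat m\<close> and the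
  rest has code \<open>z\<close>. The index \<open>i\<close> is the number of bits of
  \<open>m\<close>, and \<open>y div 2 ^ j div 2 ^ j\<close> exposes the two-bit block
  \<open>j\<close>; base 4 cannot be used directly, as the constant 4 is out of range at width 2.
  With \<open>z \<noteq> 0\<close> the end mark still lies ahead.\<close>

definition encN :: "nat \<Rightarrow> nat \<Rightarrow> nat \<Rightarrow> bool" where
  "encN y m z \<longleftrightarrow> (\<exists>i<y. (\<forall>j<i. odd (y div 2 ^ j div 2 ^ j) \<and>
       (odd (y div 2 ^ j div 2 ^ j div 2) \<longleftrightarrow> odd (m div 2 ^ j))) \<and>
     m div 2 ^ i = 0 \<and> (i = 0 \<or> m div 2 ^ (i - 1) \<noteq> 0) \<and>
     even (y div 2 ^ i div 2 ^ i) \<and> even (y div 2 ^ i div 2 ^ i div 2) \<and>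
     z = y div 2 ^ i div 2 ^ i div 2 div 2 \<and> z \<noteq> 0)"

lemma cmp_encN: "cmp a \<Longrightarrow> cmp b \<Longrightarrow> cmp c \<Longrightarrow> cmpP (\<lambda>N e. encN (a N e) (b N e) (c N e))"
  by (rule cmp_comp3[where g = "\<lambda>N a b c. of_bool (encN a b c)"])
    (unfold encN_def, intro cmp_intros)

lemma div_pow_Suc: "y div 2 ^ Suc i div 2 ^ Suc i = (y div 4) div 2 ^ i div (2 ^ i :: nat)"
  by (simp add: div_mult2_eq[symmetric] mult.commute mult.left_commute)

text \<open>A nonempty rest after \<open>i\<close> blocks forces \<open>4 ^ i\<close> to be at most
  \<open>y\<close>, so the bounded quantifier in \<open>encN\<close> loses no witness.\<close>

lemma encN_bound:
  assumes "(y::nat) div 2 ^ i div 2 ^ i div 2 div 2 \<noteq> 0"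
  shows "i < y" "i < y div 4"
proof -
  have 1: "y div 2 ^ i div 2 ^ i div 2 div 2 = y div 4 div 2 ^ i div 2 ^ i"
    by (simp add: div_mult2_eq[symmetric] mult.commute mult.left_commute)
  have "y div 4 div 2 ^ i \<noteq> 0"
  proof
    assume "y div 4 div 2 ^ i = 0"
    then show False using assms 1 by simp
  qed
  then have "2 ^ i \<le> y div 4" by (meson div_less not_le)
  then show "i < y div 4" using less_exp[of i] by linarith
  then show "i < y" by linarith
qed

text \<open>Shifting the block index by one turns the closed form, chosen for computability, into
  the recursion of \<open>enc_nat\<close>, on which the correctness proofs rest.\<close>

lemma encN_rec:
  "encN y m z \<longleftrightarrow> (if m = 0 then even y \<and> even (y div 2) \<and> z = y div 4 \<and> z \<noteq> 0
     else odd y \<and> (odd (y div 2) \<longleftrightarrow> odd m) \<and> encN (y div 4) (m div 2) z)"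
proof -
  define Q where "Q y m i \<longleftrightarrow> (\<forall>j<i. odd (y div 2 ^ j div 2 ^ j) \<and>
       (odd (y div 2 ^ j div 2 ^ j div 2) \<longleftrightarrow> odd (m div 2 ^ j))) \<and>
     m div 2 ^ i = 0 \<and> (i = 0 \<or> m div 2 ^ (i - 1) \<noteq> 0) \<and>
     even (y div 2 ^ i div 2 ^ i) \<and> even (y div 2 ^ i div 2 ^ i div 2) \<and>
     z = y div 2 ^ i div 2 ^ i div 2 div 2 \<and> z \<noteq> 0" for y m i :: nat
  have E: "encN y m z \<longleftrightarrow> (\<exists>i. Q y m i)" for y m
    unfolding encN_def Q_def using encN_bound(1)[of y] by blast
  show ?thesis
  proof (cases "m = 0")
    case True
    have "Q y 0 i \<longleftrightarrow> i = 0 \<and> Q y 0 0" for i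
      by (auto simp: Q_def)
    then have "encN y m z \<longleftrightarrow> Q y 0 0" using E True by blast
    moreover have "y div 2 div 2 = y div 4" by (simp add: div_mult2_eq[symmetric])
    ultimately show ?thesis using True by (auto simp: Q_def)
  next
    case False
    have all: "(\<forall>j<Suc i. P j) \<longleftrightarrow> P 0 \<and> (\<forall>j<i. P (Suc j))" for P i
      by (metis less_Suc_eq_0_disj zero_less_Suc Suc_less_eq)
    have m2: "m div 2 ^ Suc i = m div 2 div 2 ^ i" for i
      by (simp add: div_mult2_eq)
    have "Q y m (Suc i) \<longleftrightarrow> odd y \<and> (odd (y div 2) \<longleftrightarrow> odd m) \<and> Q (y div 4) (m div 2) i" for i
    proof -
      have "(m div 2 ^ (Suc i - 1) \<noteq> 0) \<longleftrightarrow> (i = 0 \<or> m div 2 div 2 ^ (i - 1) \<noteq> 0)"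
        using False m2[of "i - 1"] by (cases i) auto
      then show ?thesis
        unfolding Q_def all div_pow_Suc m2 by auto
    qed
    moreover have "\<not> Q y m 0" using False by (simp add: Q_def)
    ultimately have "(\<exists>i. Q y m i) \<longleftrightarrow> odd y \<and> (odd (y div 2) \<longleftrightarrow> odd m) \<and> (\<exists>i. Q (y div 4) (m div 2) i)"
      by (metis not0_implies_Suc)
    then show ?thesis using E False by simp
  qed
qed

lemma encN_0: "\<not> encN 0 m z"
  by (simp add: encN_def)

lemma encN_less: "encN y m z \<Longrightarrow> z < y"
proof (induction m arbitrary: y rule: less_induct)
  case (less m)
  show ?case
  proof (cases "m = 0")
    case True
    then show ?thesis using less.prems by (subst (asm) encN_rec) auto
  next
    case False
    then have "encN (y div 4) (m div 2) z" using less.prems by (subst (asm) encN_rec) auto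
    then have "z < y div 4" using less.IH[of "m div 2" "y div 4"] False by simp
    then show ?thesis by linarith
  qed
qed

lemma encN_less2: "encN y m z \<Longrightarrow> m < y"
proof (induction m arbitrary: y rule: less_induct)
  case (less m)
  show ?case
  proof (cases "m = 0")
    case True
    then show ?thesis using encN_less[OF less.prems] by simp
  next
    case False
    then have "encN (y div 4) (m div 2) z" using less.prems by (subst (asm) encN_rec) auto
    then have "m div 2 < y div 4" using less.IH[of "m div 2" "y div 4"] False by simp
    then show ?thesis by linarith
  qed
qed

lemma wd_eq_1: "wd u = 1 \<longleftrightarrow> u = []"
  using wd_pos by (cases u) (auto simp: Suc_lessI)

lemma encN_wd: "encN (wd u) m z \<longleftrightarrow> (\<exists>v. u = enc_nat m @ v \<and> z = wd v)"
proof (induction m arbitrary: u rule: less_induct)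
  case (less m)
  consider "u = []" | b where "u = [b]" | b c u' where "u = b # c # u'"
    by (metis list.exhaust)
  then show ?case
  proof cases
    case 1
    then show ?thesis using encN_0 by (subst encN_rec) (cases "m = 0"; simp add: enc_nat_0 enc_nat_pos)
  next
    case 2
    then show ?thesis using encN_0 by (subst encN_rec) (cases "m = 0"; simp add: enc_nat_0 enc_nat_pos)
  next
    case 3
    define B where "B b = (if b then 1 else 0 :: nat)" for b
    have w: "wd u = 4 * wd u' + 2 * B c + B b"
      by (simp add: 3 B_def)
    have B: "B b < 2" "odd (B b) = b" for b
      by (auto simp: B_def)
    have w': "odd (wd u) = b" "odd (wd u div 2) = c" "wd u div 4 = wd u'"
      unfolding w using B[of b] B[of c] by (auto simp: B_def)
    show ?thesis
    proof (cases "m = 0")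
      case True
      then show ?thesis using w' wd_pos[of u'] 3 by (subst encN_rec) (auto simp: enc_nat_0)
    next
      case False
      then show ?thesis using w' 3 less[of "m div 2" u'] by (subst encN_rec) (auto simp: enc_nat_pos)
    qed
  qed
qed

section \<open>Encodings of tiles and of lists of tiles\<close>

definition encT :: "nat \<Rightarrow> nat \<Rightarrow> nat \<Rightarrow> nat \<Rightarrow> nat \<Rightarrow> nat \<Rightarrow> bool" where
  "encT y l t r b z \<longleftrightarrow> (\<exists>p<y. \<exists>q<y. \<exists>s<y. encN y l p \<and> encN p t q \<and> encN q r s \<and> encN s b z)"

lemma cmp_encT:
  "cmp a \<Longrightarrow> cmp b \<Longrightarrow> cmp c \<Longrightarrow> cmp d \<Longrightarrow> cmp h \<Longrightarrow> cmp i \<Longrightarrow>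
    cmpP (\<lambda>N e. encT (a N e) (b N e) (c N e) (d N e) (h N e) (i N e))"
  by (rule cmp_comp6[where g = "\<lambda>N a b c d h i. of_bool (encT a b c d h i)"])
    (unfold encT_def, intro cmp_intros cmp_encN)

lemma encT_wd: "encT (wd u) l t r b z \<longleftrightarrow> (\<exists>v. u = enc_tile (l, t, r, b) @ v \<and> z = wd v)"
proof
  assume "encT (wd u) l t r b z"
  then show "\<exists>v. u = enc_tile (l, t, r, b) @ v \<and> z = wd v"
    unfolding encT_def by (auto simp: encN_wd)
next
  assume "\<exists>v. u = enc_tile (l, t, r, b) @ v \<and> z = wd v"
  then obtain v where v: "u = enc_nat l @ enc_nat t @ enc_nat r @ enc_nat b @ v" "z = wd v"
    by auto
  let ?p = "wd (enc_nat t @ enc_nat r @ enc_nat b @ v)"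
  let ?q = "wd (enc_nat r @ enc_nat b @ v)"
  let ?s = "wd (enc_nat b @ v)"
  have e: "encN (wd u) l ?p" "encN ?p t ?q" "encN ?q r ?s" "encN ?s b z"
    using v by (auto simp: encN_wd)
  note less = encN_less[OF e(1)] encN_less[OF e(2)] encN_less[OF e(3)]
  then show "encT (wd u) l t r b z"
    unfolding encT_def using e by (meson less_trans)
qed

lemma encT_less:
  assumes "encT y l t r b z"
  shows "l < y" "t < y" "r < y" "b < y" "z < y"
proof -
  obtain p q s where e: "encN y l p" "encN p t q" "encN q r s" "encN s b z"
    using assms by (auto simp: encT_def)
  note 1 = encN_less[OF e(1)] encN_less[OF e(2)] encN_less[OF e(3)] encN_less[OF e(4)]
  note 2 = encN_less2[OF e(1)] encN_less2[OF e(2)] encN_less2[OF e(3)] encN_less2[OF e(4)]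
  show "l < y" "t < y" "r < y" "b < y" "z < y"
    using 1 2 by linarith+
qed

lemma enc_nat_prefix: "enc_nat m @ u = enc_nat m' @ v \<Longrightarrow> m = m' \<and> u = v"
proof (induction m arbitrary: m' rule: less_induct)
  case (less m)
  show ?case
  proof (cases "m = 0 \<or> m' = 0")
    case True
    then show ?thesis using less.prems by (cases "m = 0"; cases "m' = 0") (auto simp: enc_nat_0 enc_nat_pos)
  next
    case False
    then have p: "odd m = odd m'" "enc_nat (m div 2) @ u = enc_nat (m' div 2) @ v"
      using less.prems by (auto simp: enc_nat_pos)
    have q: "m div 2 = m' div 2 \<and> u = v"
      by (rule less.IH[OF _ p(2)]) (use False in simp)
    have "m mod 2 = m' mod 2" using p(1) by (simp add: mod2_eq_if)
    then have "m = m'"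
      using conjunct1[OF q] div_mult_mod_eq[of m 2] div_mult_mod_eq[of m' 2] by linarith
    then show ?thesis using q by blast
  qed
qed

lemma enc_tile_prefix: "enc_tile t @ u = enc_tile t' @ v \<Longrightarrow> t = t' \<and> u = v"
  by (cases t; cases t') (auto dest!: enc_nat_prefix)

text \<open>Strips one encoded tile. The default 0 of \<open>search\<close> codes no word; it
  signals a failed parse and is passed on by further applications.\<close>

definition nxt :: "nat \<Rightarrow> nat" where
  "nxt y = search y (\<lambda>z. \<exists>l<y. \<exists>t<y. \<exists>r<y. \<exists>b<y. encT y l t r b z)"

definition nxts :: "nat \<Rightarrow> nat \<Rightarrow> nat" where
  "nxts j y = rec_nat y (\<lambda>_ r. nxt r) j"

lemma cmp_nxt: "cmp a \<Longrightarrow> cmp (\<lambda>N e. nxt (a N e))"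
  by (rule cmp_comp1[where g = "\<lambda>N a. nxt a"])
    (unfold nxt_def, intro cmp_search cmp_ex cmp_encT cmp_var)

lemma cmp_nxts: "cmp a \<Longrightarrow> cmp b \<Longrightarrow> cmp (\<lambda>N e. nxts (a N e) (b N e))"
  by (rule cmp_comp2[where g = "\<lambda>N a b. nxts a b"])
    (unfold nxts_def, intro cmp_rec[where f = "\<lambda>N y r e. nxt r"] cmp_nxt cmp_var)

lemma nxt_0: "nxt 0 = 0"
  by (simp add: nxt_def search_def)

lemma nxts_0: "nxts j 0 = 0"
  by (induction j) (auto simp: nxts_def nxt_0)

lemma nxts_Suc: "nxts (Suc j) y = nxts j (nxt y)"
  by (induction j) (auto simp: nxts_def)

lemma nxt_wd: "nxt (wd (enc_tile t @ v)) = wd v"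
proof (cases t)
  case (fields l tt r b)
  let ?y = "wd (enc_tile t @ v)"
  have e: "encT ?y l tt r b (wd v)"
    unfolding encT_wd fields by blast
  show ?thesis
    unfolding nxt_def
  proof (rule search_unique)
    show "\<exists>l<?y. \<exists>t<?y. \<exists>r<?y. \<exists>b<?y. encT ?y l t r b (wd v)" "wd v < ?y"
      using e encT_less[OF e] by blast+
    fix z
    assume "\<exists>l<?y. \<exists>t<?y. \<exists>r<?y. \<exists>b<?y. encT ?y l t r b z"
    then show "z = wd v"
      unfolding encT_wd using enc_tile_prefix by blast
  qed
qed

lemma nxt_wd_cases: "nxt (wd u) = 0 \<or> (\<exists>t v. u = enc_tile t @ v)"
proof (cases "nxt (wd u) = 0")
  case False
  then have "\<exists>l<wd u. \<exists>t<wd u. \<exists>r<wd u. \<exists>b<wd u. encT (wd u) l t r b (nxt (wd u))"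
    using search_cases[of "wd u" "\<lambda>z. \<exists>l<wd u. \<exists>t<wd u. \<exists>r<wd u. \<exists>b<wd u. encT (wd u) l t r b z"]
    by (auto simp: nxt_def)
  then show ?thesis unfolding encT_wd by blast
qed simp

lemma nxts_wd: "nxts (length Ts) (wd (concat (map enc_tile Ts) @ v)) = wd v"
  by (induction Ts) (auto simp: nxts_Suc nxt_wd, simp add: nxts_def)

definition tile_at :: "nat \<Rightarrow> nat \<Rightarrow> nat \<Rightarrow> nat \<Rightarrow> nat \<Rightarrow> nat \<Rightarrow> bool" where
  "tile_at y J l t r b \<longleftrightarrow> (\<exists>j<J. encT (nxts j y) l t r b (nxt (nxts j y)))"

lemma cmp_tile_at:
  "cmp a \<Longrightarrow> cmp b \<Longrightarrow> cmp c \<Longrightarrow> cmp d \<Longrightarrow> cmp h \<Longrightarrow> cmp i \<Longrightarrow>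
    cmpP (\<lambda>N e. tile_at (a N e) (b N e) (c N e) (d N e) (h N e) (i N e))"
  by (rule cmp_comp6[where g = "\<lambda>N a b c d h i. of_bool (tile_at a b c d h i)"])
    (unfold tile_at_def, intro cmp_ex cmp_encT cmp_nxt cmp_nxts cmp_var)

lemma tile_at_wd:
  "tile_at (wd (concat (map enc_tile Ts) @ v)) (length Ts) l t r b \<longleftrightarrow> (l, t, r, b) \<in> set Ts"
proof (induction Ts)
  case (Cons a Ts)
  have all: "(\<exists>j<Suc i. P j) \<longleftrightarrow> P 0 \<or> (\<exists>j<i. P (Suc j))" for P i
    by (metis less_Suc_eq_0_disj zero_less_Suc Suc_less_eq)
  let ?u = "concat (map enc_tile Ts) @ v"
  have "encT (wd (enc_tile a @ ?u)) l t r b (wd ?u) \<longleftrightarrow> a = (l, t, r, b)"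
    unfolding encT_wd using enc_tile_prefix by blast
  moreover have "nxts 0 y = y" for y by (simp add: nxts_def)
  ultimately show ?case
    using Cons unfolding tile_at_def by (simp add: all nxts_Suc nxt_wd) blast
qed (simp add: tile_at_def)

lemma nxts_parse:
  "nxts J (wd u) \<noteq> 0 \<Longrightarrow> \<exists>Ts v. u = concat (map enc_tile Ts) @ v \<and> length Ts = J"
proof (induction J arbitrary: u)
  case (Suc J)
  have "nxt (wd u) \<noteq> 0"
  proof
    assume "nxt (wd u) = 0"
    then show False using Suc.prems by (simp add: nxts_Suc nxts_0)
  qed
  then obtain t v where u: "u = enc_tile t @ v" using nxt_wd_cases[of u] by auto
  then have "nxts J (wd v) \<noteq> 0" using Suc.prems by (simp add: nxts_Suc nxt_wd)
  then obtain Ts v' where "v = concat (map enc_tile Ts) @ v'" "length Ts = J" using Suc.IH by blast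
  then show ?case using u by (intro exI[of _ "t # Ts"]) auto
qed simp

section \<open>The unary prefix and complete instances\<close>

definition ones :: "nat \<Rightarrow> nat \<Rightarrow> bool" where
  "ones x n \<longleftrightarrow> (\<forall>j<n. odd (x div 2 ^ j)) \<and> even (x div 2 ^ n)"

definition lead :: "nat \<Rightarrow> nat" where
  "lead x = search x (ones x)"

lemma cmp_ones: "cmp a \<Longrightarrow> cmp b \<Longrightarrow> cmpP (\<lambda>N e. ones (a N e) (b N e))"
  by (rule cmp_comp2[where g = "\<lambda>N a b. of_bool (ones a b)"]) (unfold ones_def, intro cmp_intros)

lemma cmp_lead: "cmp a \<Longrightarrow> cmp (\<lambda>N e. lead (a N e))"
  by (rule cmp_comp1[where g = "\<lambda>N a. lead a"]) (unfold lead_def, intro cmp_search cmp_ones cmp_var)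

lemma ones_unique: "ones x m \<Longrightarrow> ones x n \<Longrightarrow> m = n"
  unfolding ones_def by (metis linorder_neqE_nat)

text \<open>In a word without \<open>False\<close> the end mark counts as one more 1, followed by
  the zero above it. The nonzero remainder excludes this, so the zero that was found is a letter of
  the word.\<close>

lemma ones_wd: "x = wd w \<Longrightarrow> ones x n \<Longrightarrow> x div 2 ^ n div 2 \<noteq> 0 \<Longrightarrow>
   \<exists>u. w = replicate n True @ False # u \<and> x div 2 ^ n div 2 = wd u"
proof (induction n arbitrary: x w)
  case 0
  then show ?case by (cases w) (auto simp: ones_def split: if_splits)
next
  case (Suc n)
  obtain b w' where w: "w = b # w'"
  proof (cases w)
    case Nil
    have "1 < (2::nat) ^ Suc n" by (rule one_less_power) auto
    then have "(1::nat) div 2 ^ Suc n = 0" by (rule div_less)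
    then show ?thesis using Suc.prems Nil by simp
  qed
  have b: "b" using Suc.prems by (auto simp: w ones_def split: if_splits)
  have d: "x div 2 ^ Suc j = wd w' div 2 ^ j" for j
    using Suc.prems(1) w b by (simp add: div_mult2_eq)
  have "ones (wd w') n"
    using Suc.prems(2) d unfolding ones_def by (metis Suc_less_eq)
  then show ?case
    using Suc.IH[OF refl, of w'] Suc.prems(3) w b unfolding d by auto
qed

lemma ones_wd_intro:
  "ones (wd (replicate n True @ False # u)) n"
  "wd (replicate n True @ False # u) div 2 ^ n div 2 = wd u"
proof -
  have d: "wd (replicate n True @ v) div 2 ^ n = wd v" for v
    by (induction n) (auto simp: div_mult2_eq)
  show "wd (replicate n True @ False # u) div 2 ^ n div 2 = wd u" by (simp add: d)
  have "odd (wd (replicate n True @ False # u) div 2 ^ j)" if "j < n" for j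
  proof -
    have "replicate n True @ False # u = replicate j True @ True # replicate (n - Suc j) True @ False # u"
      using that by (metis Suc_diff_Suc append_Cons append_assoc replicate_Suc replicate_add
          le_add_diff_inverse less_imp_le_nat)
    moreover have "wd (replicate j True @ v) div 2 ^ j = wd v" for v
      by (induction j) (auto simp: div_mult2_eq)
    ultimately show ?thesis by simp
  qed
  then show "ones (wd (replicate n True @ False # u)) n" by (simp add: ones_def d)
qed

lemma lead_eq:
  assumes "ones x n" "n < x"
  shows "lead x = n"
  unfolding lead_def
  by (rule search_unique[where P = "ones x", OF assms]) (rule ones_unique[OF _ assms(1)])

text \<open>Covers words that are no instances, too: the width of the computation depends on
  \<open>lead\<close> before the word is known to be well formed.\<close>

lemma lead_le:
  assumes "x < 2 ^ n" 
  shows "lead x \<le> n"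
proof (cases "ones x (lead x)")
  case True
  show ?thesis
  proof (rule ccontr)
    assume "\<not> lead x \<le> n"
    then have "odd (x div 2 ^ n)" using True by (auto simp: ones_def)
    then show False using assms by simp
  qed
next
  case False
  then have "lead x = 0" using search_cases[of x "ones x"] by (auto simp: lead_def)
  then show ?thesis by simp
qed

definition tiles_code :: "nat \<Rightarrow> nat" where
  "tiles_code x = x div 2 ^ lead x div 2"

text \<open>The word coded by \<open>x\<close> is an instance with \<open>J\<close> tile types and distinguished tile \<open>(l, t, r, b)\<close>.\<close>

definition inst :: "nat \<Rightarrow> nat \<Rightarrow> nat \<Rightarrow> nat \<Rightarrow> nat \<Rightarrow> nat \<Rightarrow> bool" where
  "inst x J l t r b \<longleftrightarrow> ones x (lead x) \<and> nxts J (tiles_code x) \<noteq> 0 \<and> even (nxts J (tiles_code x)) \<and>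
     odd (nxts J (tiles_code x) div 2) \<and> encT (nxts J (tiles_code x) div 2 div 2) l t r b 1"

lemma cmp_tiles_code: "cmp a \<Longrightarrow> cmp (\<lambda>N e. tiles_code (a N e))"
  by (rule cmp_comp1[where g = "\<lambda>N a. tiles_code a"]) (unfold tiles_code_def, intro cmp_intros cmp_lead)

lemma cmp_inst:
  "cmp a \<Longrightarrow> cmp b \<Longrightarrow> cmp c \<Longrightarrow> cmp d \<Longrightarrow> cmp h \<Longrightarrow> cmp i \<Longrightarrow>
    cmpP (\<lambda>N e. inst (a N e) (b N e) (c N e) (d N e) (h N e) (i N e))"
  by (rule cmp_comp6[where g = "\<lambda>N a b c d h i. of_bool (inst a b c d h i)"])
    (unfold inst_def, intro cmp_and cmp_not cmp_eq cmp_even cmp_ones cmp_lead cmp_nxts cmp_tiles_code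
      cmp_encT cmp_div cmp_two cmp_one cmp_zero cmp_var)

lemma length_lt_wd: "length w < wd w"
  by (induction w) auto

lemma instI:
  assumes "w = enc_inst n Ts (l, t, r, b)"
  shows "inst (wd w) (length Ts) l t r b" "lead (wd w) = n" "length Ts < wd w"
    "\<And>l t r b. tile_at (tiles_code (wd w)) (length Ts) l t r b \<longleftrightarrow> (l, t, r, b) \<in> set Ts"
proof -
  define v where "v = concat (map enc_tile Ts) @ [False, True] @ enc_tile (l, t, r, b)"
  have w: "w = replicate n True @ False # v"
    using assms by (simp add: enc_inst_def v_def)
  note o = ones_wd_intro[of n v, folded w]
  have "n < wd w" using length_lt_wd[of w] by (simp add: w)
  then show L: "lead (wd w) = n" using lead_eq o(1) by blast
  have tc: "tiles_code (wd w) = wd v" using o(2) by (simp add: tiles_code_def L)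
  have nx: "nxts (length Ts) (wd v) = wd ([False, True] @ enc_tile (l, t, r, b))"
    unfolding v_def by (rule nxts_wd)
  have "encT (wd (enc_tile (l, t, r, b))) l t r b 1"
    unfolding encT_wd by (intro exI[of _ "[]"]) simp
  then show "inst (wd w) (length Ts) l t r b"
    using o(1) wd_pos[of "enc_tile (l, t, r, b)"] unfolding inst_def L tc nx
    by (simp del: enc_tile.simps)
  show "tile_at (tiles_code (wd w)) (length Ts) l t r b \<longleftrightarrow> (l, t, r, b) \<in> set Ts" for l t r b
    unfolding tc v_def by (rule tile_at_wd)
  have "length Ts \<le> length (concat (map enc_tile Ts))"
  proof (induction Ts)
    case (Cons a Ts)
    have "enc_nat m \<noteq> []" for m by (simp add: enc_nat_def)
    then have "enc_tile a \<noteq> []" by (cases a) simp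
    then have "1 \<le> length (enc_tile a)" by (simp add: Suc_leI)
    then show ?case using Cons by simp
  qed simp
  then have "length Ts \<le> length w" by (simp add: w v_def)
  then show "length Ts < wd w" using length_lt_wd[of w] by simp
qed

text \<open>The remainder 1 demanded by \<open>inst\<close> is the code of the empty word, so the
  distinguished tile ends the word.\<close>

lemma instD:
  assumes "inst (wd w) J l t r b"
  shows "\<exists>Ts. w = enc_inst (lead (wd w)) Ts (l, t, r, b) \<and> length Ts = J"
proof -
  let ?y = "tiles_code (wd w)"
  have "?y \<noteq> 0"
  proof
    assume "?y = 0"
    then show False using assms nxts_0[of J] by (simp add: inst_def)
  qed
  then obtain u where w: "w = replicate (lead (wd w)) True @ False # u" and y: "?y = wd u"
    using ones_wd[OF refl, of w "lead (wd w)"] assms by (auto simp: inst_def tiles_code_def)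
  have "nxts J (wd u) \<noteq> 0" using assms y by (auto simp: inst_def)
  then obtain Ts v where u: "u = concat (map enc_tile Ts) @ v" "length Ts = J"
    using nxts_parse by blast
  have "nxts J (wd u) = wd v" using nxts_wd u by blast
  then have v: "even (wd v)" "odd (wd v div 2)" "encT (wd v div 2 div 2) l t r b 1"
    using assms y by (auto simp: inst_def)
  obtain v1 where v1: "v = False # v1" using v(1) by (cases v) (auto split: if_splits)
  have "wd v1 \<noteq> 1"
  proof
    assume "wd v1 = 1"
    then have "encT 0 l t r b 1" using v(3) v1 by simp
    then show False using encT_less(1) by blast
  qed
  then obtain b2 v2 where v2: "v1 = b2 # v2" by (cases v1) auto
  have b2: "b2" using v(2) v1 v2 by (auto split: if_splits)
  have "encT (wd v2) l t r b 1" using v(3) v1 v2 b2 by simp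
  then have "v2 = enc_tile (l, t, r, b)"
    unfolding encT_wd using wd_eq_1 by (metis append_Nil2)
  then have "w = enc_inst (lead (wd w)) Ts (l, t, r, b)"
    unfolding enc_inst_def using w u v1 v2 b2 by simp
  then show ?thesis using u(2) by blast
qed

section \<open>Evaluating alternating games\<close>

text \<open>Savitch's recursion is unfolded into a game on a complete binary tree whose nodes are numbered
  like a heap. The tree is traversed keeping only the current node and the value coming from below,
  which fits into linear space because the operators short-circuit.\<close>

fun game_val :: "(nat \<Rightarrow> bool) \<Rightarrow> nat \<Rightarrow> nat \<Rightarrow> nat \<Rightarrow> bool" where
  "game_val \<phi> g 0 a = \<phi> a"
| "game_val \<phi> g (Suc l) a = (if l mod g = 0 then game_val \<phi> g l (2 * a) \<and> game_val \<phi> g l (2 * a + 1)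
     else game_val \<phi> g l (2 * a) \<or> game_val \<phi> g l (2 * a + 1))"

text \<open>The depth of node \<open>a\<close> in the heap numbering, that is, the binary logarithm
  rounded down.\<close>

definition lg :: "nat \<Rightarrow> nat" where
  "lg a = search a (\<lambda>i. a div 2 ^ i = 1)"

lemma lg_eq:
  assumes "2 ^ i \<le> a" "a < 2 ^ (i + 1)"
  shows "lg a = i"
  unfolding lg_def
proof (rule search_unique)
  have "a div 2 ^ i < 2" using assms by (intro less_mult_imp_div_less) simp
  moreover have "0 < a div 2 ^ i" using assms by (simp add: div_greater_zero_iff)
  ultimately show "a div 2 ^ i = 1" by simp
  show "i < a" using assms(1) less_exp[of i] by linarith
  fix j
  assume j: "a div 2 ^ j = 1"
  have "2 ^ j \<le> a" using j by (metis div_less not_le zero_neq_one)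
  moreover have "a < 2 ^ (j + 1)"
  proof (rule ccontr)
    assume "\<not> a < 2 ^ (j + 1)"
    then have "2 * 2 ^ j \<le> a" by simp
    then have "2 \<le> a div 2 ^ j" by (simp add: less_eq_div_iff_mult_less_eq)
    then show False using j by simp
  qed
  ultimately have "(2::nat) ^ j < 2 ^ (i + 1)" "(2::nat) ^ i < 2 ^ (j + 1)"
    using assms by linarith+
  then have "j < i + 1" "i < j + 1"
    by (meson power_less_imp_less_exp one_less_numeral_iff semiring_norm(76))+
  then show "j = i" by simp
qed

text \<open>A state \<open>3 * a + r\<close> is at node \<open>a\<close>: with \<open>r = 0\<close>
  on the way down, with \<open>r = 1\<close> or \<open>r = 2\<close> on the way up carrying the
  value false or true. A left child whose value does not settle its parent hands over to the sibling
  \<open>a + 1\<close>; in all other cases the value moves up unchanged. At the root it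
  stays.\<close>

definition traverse :: "nat \<Rightarrow> nat \<Rightarrow> (nat \<Rightarrow> bool) \<Rightarrow> nat \<Rightarrow> nat" where
  "traverse l g \<phi> c = (if c mod 3 = 0 then (if l \<le> lg (c div 3) then c + (if \<phi> (c div 3) then 2 else 1) else 2 * c)
     else if c div 3 = 1 then c
     else if even (c div 3) \<and> (c mod 3 = 2 \<longleftrightarrow> (l - lg (c div 3)) mod g = 0) then c - c mod 3 + 3
     else 3 * (c div 3 div 2) + c mod 3)"

definition code :: "nat \<Rightarrow> bool \<Rightarrow> nat" where
  "code a b = 3 * a + (if b then 2 else 1)"

lemma code_simps [simp]: "code a b div 3 = a" "code a b mod 3 = (if b then 2 else 1)"
  by (auto simp: code_def)

lemma traverse_down: "traverse l g \<phi> (3 * a) = (if l \<le> lg a then code a (\<phi> a) else 3 * (2 * a))"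
  by (simp add: traverse_def code_def)

lemma traverse_up:
  "traverse l g \<phi> (code a b) = (if a = 1 then code a b
     else if even a \<and> (b \<longleftrightarrow> (l - lg a) mod g = 0) then 3 * (a + 1) else code (a div 2) b)"
proof -
  have 1: "code a b - (if b then 2 else 1) + 3 = 3 * (a + 1)"
    "3 * (a div 2) + (if b then 2 else 1) = code (a div 2) b"
    by (simp_all add: code_def)
  have 2: "((if b then 2 else 1) = (2::nat)) = b" "((if b then 2 else 1) = (0::nat)) = False"
    by simp_all
  show ?thesis
    unfolding traverse_def code_simps 1 2 by (simp only: if_False)
qed

definition iter_within :: "('a \<Rightarrow> 'a) \<Rightarrow> ('a \<Rightarrow> bool) \<Rightarrow> nat \<Rightarrow> 'a \<Rightarrow> 'a \<Rightarrow> bool" where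
  "iter_within f P n x y \<longleftrightarrow> (\<exists>m \<le> n. (f ^^ m) x = y \<and> (\<forall>i \<le> m. P ((f ^^ i) x)))"

lemma iter_within_step: "P x \<Longrightarrow> P (f x) \<Longrightarrow> iter_within f P 1 x (f x)"
  unfolding iter_within_def by (intro exI[of _ 1]) (auto simp: le_Suc_eq)

lemma iter_within_trans:
  assumes "iter_within f P n x y" "iter_within f P n' y z" "n + n' \<le> n''"
  shows "iter_within f P n'' x z"
proof -
  obtain m where m: "m \<le> n" "(f ^^ m) x = y" "\<And>i. i \<le> m \<Longrightarrow> P ((f ^^ i) x)"
    using assms(1) by (auto simp: iter_within_def)
  obtain m' where m': "m' \<le> n'" "(f ^^ m') y = z" "\<And>i. i \<le> m' \<Longrightarrow> P ((f ^^ i) y)"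
    using assms(2) by (auto simp: iter_within_def)
  have shift: "(f ^^ (j + m)) x = (f ^^ j) y" for j
    using m(2) by (simp add: funpow_add)
  have "P ((f ^^ i) x)" if "i \<le> m' + m" for i
  proof (cases "i \<le> m")
    case False
    then show ?thesis using shift[of "i - m"] m'(3)[of "i - m"] that by auto
  qed (use m(3) in auto)
  then show ?thesis
    unfolding iter_within_def using shift[of m'] m(1) m'(1,2) assms(3) by (intro exI[of _ "m' + m"]) auto
qed

text \<open>The number of steps solves the recurrence with value 1 at a leaf and twice the previous
  value plus 3 above: two subtrees and three moves between them.\<close>

lemma traverse_game_val:
  "l \<le> L \<Longrightarrow> 2 ^ (L - l) \<le> a \<Longrightarrow> a < 2 ^ (L - l + 1) \<Longrightarrow>
    iter_within (traverse L g \<phi>) (\<lambda>c. c < 3 * 2 ^ (L + 1)) (4 * 2 ^ l - 3) (3 * a) (code a (game_val \<phi> g l a))"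
proof (induction l arbitrary: a)
  case 0
  have "lg a = L" by (rule lg_eq) (use 0 in auto)
  then have st: "traverse L g \<phi> (3 * a) = code a (\<phi> a)" by (simp add: traverse_down)
  have "code a (\<phi> a) < 3 * 2 ^ (L + 1)" "3 * a < 3 * 2 ^ (L + 1)"
    using 0 by (auto simp: code_def)
  then show ?case
    using iter_within_step[of "\<lambda>c. c < 3 * 2 ^ (L + 1)" "3 * a" "traverse L g \<phi>"] st by simp
next
  case (Suc l)
  let ?P = "\<lambda>c. c < 3 * 2 ^ (L + 1)"
  let ?f = "traverse L g \<phi>"
  let ?v = "game_val \<phi> g"
  have Ll: "L - l = Suc (L - Suc l)" using Suc.prems by simp
  have a1: "1 \<le> a" using Suc.prems(2) by (meson le_trans one_le_power one_le_numeral)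
  have lga: "lg a = L - Suc l" by (rule lg_eq) (use Suc.prems in auto)
  have r: "2 ^ (L - l) \<le> 2 * a" "2 * a + 1 < 2 ^ (L - l + 1)" "2 ^ (L - l) \<le> 2 * a + 1" "2 * a < 2 ^ (L - l + 1)"
    using Suc.prems unfolding Ll by auto
  have lg2: "lg (2 * a) = L - l" "lg (2 * a + 1) = L - l" by (rule lg_eq, use r in auto)+
  have big: "(2::nat) ^ (L - l + 1) \<le> 2 ^ (L + 1)" by (rule power_increasing) auto
  have P: "?P (3 * a)" "?P (code a b)" "?P (code (2 * a) b)" "?P (code (2 * a + 1) b)" "?P (3 * (2 * a))" "?P (3 * (2 * a + 1))" for b
  proof -
    define X where "X = (2::nat) ^ (L + 1)"
    have "2 * a + 1 < X" unfolding X_def using r(2) big by (rule less_le_trans)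
    then show "?P (3 * a)" "?P (code a b)" "?P (code (2 * a) b)" "?P (code (2 * a + 1) b)"
      "?P (3 * (2 * a))" "?P (3 * (2 * a + 1))"
      unfolding code_def X_def[symmetric] by (auto split: if_split)
  qed
  have t0: "1 \<le> (2::nat) ^ l" by simp
  have "\<not> L \<le> lg a" using lga Suc.prems(1) by simp
  then have "?f (3 * a) = 3 * (2 * a)" by (simp add: traverse_down)
  then have s1: "iter_within ?f ?P 1 (3 * a) (3 * (2 * a))"
    using iter_within_step[of ?P "3 * a" ?f] P(1,5) by (simp only:)
  have s2: "iter_within ?f ?P (4 * 2 ^ l - 3) (3 * (2 * a)) (code (2 * a) (?v l (2 * a)))"
    by (rule Suc.IH) (use Suc.prems r in auto)
  have s12: "iter_within ?f ?P (4 * 2 ^ l - 2) (3 * a) (code (2 * a) (?v l (2 * a)))"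
    by (rule iter_within_trans[OF s1 s2]) (use t0 in linarith)
  have ll: "L - (L - l) = l" using Suc.prems by simp
  show ?case
  proof (cases "?v l (2 * a) \<longleftrightarrow> l mod g = 0")
    case True
    then have "?f (code (2 * a) (?v l (2 * a))) = 3 * (2 * a + 1)"
      by (simp add: traverse_up lg2 ll)
    then have s3: "iter_within ?f ?P 1 (code (2 * a) (?v l (2 * a))) (3 * (2 * a + 1))"
      using iter_within_step[of ?P "code (2 * a) (?v l (2 * a))" ?f] P by simp
    have s4: "iter_within ?f ?P (4 * 2 ^ l - 3) (3 * (2 * a + 1)) (code (2 * a + 1) (?v l (2 * a + 1)))"
      by (rule Suc.IH) (use Suc.prems r in auto)
    have "?f (code (2 * a + 1) (?v l (2 * a + 1))) = code a (?v l (2 * a + 1))"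
      using a1 by (simp add: traverse_up)
    then have s5: "iter_within ?f ?P 1 (code (2 * a + 1) (?v l (2 * a + 1))) (code a (?v l (2 * a + 1)))"
      using iter_within_step[of ?P "code (2 * a + 1) (?v l (2 * a + 1))" ?f] P by simp
    have "?v (Suc l) a = ?v l (2 * a + 1)" using True by auto
    moreover have "iter_within ?f ?P (4 * 2 ^ Suc l - 3) (3 * a) (code a (?v l (2 * a + 1)))"
      by (rule iter_within_trans[OF s12 iter_within_trans[OF s3 iter_within_trans[OF s4 s5 order_refl] order_refl]])
        (use t0 in \<open>simp, linarith\<close>)
    ultimately show ?thesis by simp
  next
    case False
    then have "?f (code (2 * a) (?v l (2 * a))) = code a (?v l (2 * a))"
      by (auto simp: traverse_up lg2 ll)
    then have s3: "iter_within ?f ?P 1 (code (2 * a) (?v l (2 * a))) (code a (?v l (2 * a)))"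
      using iter_within_step[of ?P "code (2 * a) (?v l (2 * a))" ?f] P by simp
    have "?v (Suc l) a = ?v l (2 * a)" using False by auto
    moreover have "iter_within ?f ?P (4 * 2 ^ Suc l - 3) (3 * a) (code a (?v l (2 * a)))"
      by (rule iter_within_trans[OF s12 s3]) (use t0 in \<open>simp, linarith\<close>)
    ultimately show ?thesis by simp
  qed
qed

text \<open>The evaluated root is a fixed point, so any sufficiently large number of rounds gives
  the result, and \<open>f\<close> has to agree with the traversal only on states that
  occur.\<close>

lemma traverse_result:
  assumes M: "4 * 2 ^ L \<le> M" and f: "\<And>c. c < 3 * 2 ^ (L + 1) \<Longrightarrow> f c = traverse L g \<phi> c"
  shows "rec_nat 3 (\<lambda>_ c. f c) M = code 1 (game_val \<phi> g L 1)"
proof -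
  let ?t = "traverse L g \<phi>"
  obtain m where m: "m \<le> 4 * 2 ^ L - 3" "(?t ^^ m) 3 = code 1 (game_val \<phi> g L 1)"
    "\<And>i. i \<le> m \<Longrightarrow> (?t ^^ i) 3 < 3 * 2 ^ (L + 1)"
    using traverse_game_val[of L L 1 g \<phi>] by (auto simp: iter_within_def)
  have fixp: "(?t ^^ (i + m)) 3 = code 1 (game_val \<phi> g L 1)" for i
  proof (induction i)
    case (Suc i)
    then show ?case by (simp add: traverse_up)
  qed (simp add: m)
  have lt: "(?t ^^ i) 3 < 3 * 2 ^ (L + 1)" for i
  proof (cases "i \<le> m")
    case False
    then have "(?t ^^ i) 3 = (?t ^^ m) 3" using fixp[of "i - m"] m(2) by simp
    then show ?thesis using m(3)[of m] by simp
  qed (use m in simp)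
  have "rec_nat 3 (\<lambda>_ c. f c) i = (?t ^^ i) 3" for i
    by (induction i) (auto simp: f[OF lt])
  then show ?thesis using fixp[of "M - m"] m(1) M by simp
qed

section \<open>Reachability as a game\<close>

text \<open>Each digit of \<open>a\<close> in base \<open>G = 2 ^ (rb + 1)\<close> is one halving:
  its upper \<open>rb\<close> bits are the guessed midpoint, its lowest bit selects the second half.
  Endpoints are read off the node number instead of being stored: the lowest odd digit supplies the
  left endpoint, the lowest even digit the right one. At the root they are \<open>u\<close> and 0,
  the white row.\<close>

fun path_U :: "nat \<Rightarrow> nat \<Rightarrow> nat \<Rightarrow> nat \<Rightarrow> nat" where
  "path_U G u 0 a = u"
| "path_U G u (Suc e) a = (if odd (a mod G) then a mod G div 2 else path_U G u e (a div G))"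

fun path_V :: "nat \<Rightarrow> nat \<Rightarrow> nat \<Rightarrow> nat" where
  "path_V G 0 a = 0"
| "path_V G (Suc e) a = (if odd (a mod G) then path_V G e (a div G) else a mod G div 2)"

fun savitch :: "(nat \<Rightarrow> nat \<Rightarrow> bool) \<Rightarrow> nat \<Rightarrow> nat \<Rightarrow> nat \<Rightarrow> nat \<Rightarrow> bool" where
  "savitch S K 0 u v = S u v"
| "savitch S K (Suc d) u v = (\<exists>m<K. savitch S K d u m \<and> savitch S K d m v)"

text \<open>Consecutive disjunction levels append freely chosen bits to the node number. A full run
  of \<open>rb\<close> of them is the guess of a midpoint; the conjunction level below asks for both
  halves.\<close>

lemma game_val_block:
  "c \<le> rb \<Longrightarrow> game_val \<phi> (Suc rb) (i * Suc rb + 1 + c) a \<longleftrightarrow>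
    (\<exists>m<2 ^ c. game_val \<phi> (Suc rb) (i * Suc rb + 1) (a * 2 ^ c + m))"
proof (induction c arbitrary: a)
  case (Suc c)
  let ?l = "i * Suc rb + 1 + c"
  define Q where "Q = game_val \<phi> (Suc rb) (i * Suc rb + 1)"
  have "(1 + c + i * Suc rb) mod Suc rb = Suc c"
    using Suc.prems by (subst mod_mult_self1) simp
  then have "?l mod Suc rb \<noteq> 0" by (simp add: algebra_simps)
  then have "game_val \<phi> (Suc rb) (Suc ?l) a \<longleftrightarrow> game_val \<phi> (Suc rb) ?l (2 * a) \<or> game_val \<phi> (Suc rb) ?l (2 * a + 1)"
    by (simp del: mult_Suc_right)
  also have "\<dots> \<longleftrightarrow> (\<exists>m<2 ^ c. Q (2 * a * 2 ^ c + m)) \<or> (\<exists>m<2 ^ c. Q ((2 * a + 1) * 2 ^ c + m))"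
    unfolding Q_def using Suc by (simp del: game_val.simps)
  also have "\<dots> \<longleftrightarrow> (\<exists>m<2 ^ Suc c. Q (a * 2 ^ Suc c + m))" (is "?L \<longleftrightarrow> ?R")
  proof
    assume ?L
    then show ?R
    proof (elim disjE exE conjE)
      fix m
      assume m: "m < 2 ^ c" "Q (2 * a * 2 ^ c + m)"
      then show ?R by (intro exI[of _ m]) (simp add: algebra_simps)
    next
      fix m
      assume m: "m < 2 ^ c" "Q ((2 * a + 1) * 2 ^ c + m)"
      then show ?R by (intro exI[of _ "2 ^ c + m"]) (simp add: algebra_simps)
    qed
  next
    assume ?R
    then obtain m where m: "m < 2 ^ Suc c" "Q (a * 2 ^ Suc c + m)" by blast
    show ?L
    proof (cases "m < 2 ^ c")
      case True
      then show ?thesis using m by (intro disjI1 exI[of _ m]) (simp add: algebra_simps)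
    next
      case False
      then have "(2 * a + 1) * 2 ^ c + (m - 2 ^ c) = a * 2 ^ Suc c + m" by (simp add: algebra_simps)
      then have "Q ((2 * a + 1) * 2 ^ c + (m - 2 ^ c))" using m(2) by (simp only:)
      moreover have "m - 2 ^ c < 2 ^ c" using m(1) by simp
      ultimately show ?thesis by blast
    qed
  qed
  finally show ?case unfolding Q_def add_Suc_right .
qed simp

lemma game_val_savitch:
  assumes "\<And>a. \<phi> a \<longleftrightarrow> S (path_U (2 ^ Suc rb) u d a) (path_V (2 ^ Suc rb) d a)"
  shows "i \<le> d \<Longrightarrow> game_val \<phi> (Suc rb) (i * Suc rb) a \<longleftrightarrow>
    savitch S (2 ^ rb) i (path_U (2 ^ Suc rb) u (d - i) a) (path_V (2 ^ Suc rb) (d - i) a)"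
proof (induction i arbitrary: a)
  case 0
  then show ?case using assms by simp
next
  case (Suc i)
  let ?G = "2 ^ Suc rb :: nat"
  let ?v = "game_val \<phi> (Suc rb)"
  define e where "e = d - Suc i"
  have e: "d - i = Suc e" using Suc.prems by (simp add: e_def)
  have "Suc i * Suc rb = i * Suc rb + 1 + rb" by simp
  then have "?v (Suc i * Suc rb) a \<longleftrightarrow> (\<exists>m<2 ^ rb. ?v (i * Suc rb + 1) (a * 2 ^ rb + m))"
    using game_val_block[of rb rb \<phi> i a] by (simp del: mult_Suc mult_Suc_right)
  also have "\<dots> \<longleftrightarrow> (\<exists>m<2 ^ rb. ?v (i * Suc rb) (2 * (a * 2 ^ rb + m)) \<and> ?v (i * Suc rb) (2 * (a * 2 ^ rb + m) + 1))"
    by (simp del: mult_Suc mult_Suc_right)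
  also have "\<dots> \<longleftrightarrow> (\<exists>m<2 ^ rb. savitch S (2 ^ rb) i (path_U ?G u e a) m \<and> savitch S (2 ^ rb) i m (path_V ?G e a))"
  proof (rule ex_cong1, rule conj_cong[OF refl])
    fix m :: nat
    assume m: "m < 2 ^ rb"
    have 0: "2 * (a * 2 ^ rb + m) = a * ?G + 2 * m" "2 * (a * 2 ^ rb + m) + 1 = a * ?G + (2 * m + 1)"
      by (auto simp: algebra_simps)
    have 1: "2 * m < ?G" "2 * m + 1 < ?G" using m by auto
    have 2: "(a * ?G + y) mod ?G = y" "(a * ?G + y) div ?G = a" if "y < ?G" for y
      using that by (simp_all del: power_Suc)
    have "path_U ?G u (Suc e) (a * ?G + 2 * m) = path_U ?G u e a" "path_V ?G (Suc e) (a * ?G + 2 * m) = m"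
      "path_U ?G u (Suc e) (a * ?G + (2 * m + 1)) = m" "path_V ?G (Suc e) (a * ?G + (2 * m + 1)) = path_V ?G e a"
      unfolding path_U.simps path_V.simps 2[OF 1(1)] 2[OF 1(2)] by simp_all
    note 3 = this
    have id: "i \<le> d" using Suc.prems by simp
    have "?v (i * Suc rb) (2 * (a * 2 ^ rb + m)) \<longleftrightarrow> savitch S (2 ^ rb) i (path_U ?G u e a) m"
      unfolding 0(1) Suc.IH[OF id] e 3 ..
    moreover have "?v (i * Suc rb) (2 * (a * 2 ^ rb + m) + 1) \<longleftrightarrow> savitch S (2 ^ rb) i m (path_V ?G e a)"
      unfolding 0(2) Suc.IH[OF id] e 3 ..
    ultimately show "?v (i * Suc rb) (2 * (a * 2 ^ rb + m)) \<and> ?v (i * Suc rb) (2 * (a * 2 ^ rb + m) + 1) \<longleftrightarrow>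
       savitch S (2 ^ rb) i (path_U ?G u e a) m \<and> savitch S (2 ^ rb) i m (path_V ?G e a)"
      by (rule arg_cong2[of _ _ _ _ "(\<and>)"])
  qed
  finally show ?case by (simp add: e_def)
qed

section \<open>Paths of exact and of arbitrary length\<close>

definition below :: "nat \<Rightarrow> (nat \<Rightarrow> nat \<Rightarrow> bool) \<Rightarrow> nat \<Rightarrow> nat \<Rightarrow> bool" where
  "below K S u v \<longleftrightarrow> S u v \<and> u < K \<and> v < K"

text \<open>Halving counts exactly \<open>2 ^ d\<close> steps, not at most as many, which is what a
  prescribed height asks for.\<close>

lemma savitch_relpowp: "u < K \<Longrightarrow> v < K \<Longrightarrow> savitch S K d u v \<longleftrightarrow> (below K S ^^ (2 ^ d)) u v"
proof (induction d arbitrary: u v)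
  case 0
  then show ?case by (auto simp: below_def relcompp_apply)
next
  case (Suc d)
  have b: "m < K" if "(below K S ^^ n) u m" "u < K" for n m u
    using that by (cases n) (auto simp: below_def elim: relcomppE)
  have "(below K S ^^ (2 ^ Suc d)) u v \<longleftrightarrow> (\<exists>m. (below K S ^^ (2 ^ d)) u m \<and> (below K S ^^ (2 ^ d)) m v)"
    by (simp add: mult_2 relpowp_add relcompp_apply)
  also have "\<dots> \<longleftrightarrow> (\<exists>m<K. (below K S ^^ (2 ^ d)) u m \<and> (below K S ^^ (2 ^ d)) m v)"
    using b Suc.prems(1) by blast
  also have "\<dots> \<longleftrightarrow> savitch S K (Suc d) u v"
    using Suc by auto
  finally show ?case by simp
qed

text \<open>Loops at the endpoint pad a shorter path to the prescribed length; such a loop exists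
  only if \<open>Q y\<close>.\<close>

lemma relpowp_reflcl_mono:
  assumes "(P ^^ n) x y" "n \<le> m"
  shows "((\<lambda>u v. P u v \<or> (u = v \<and> Q u)) ^^ m) x y \<or> \<not> Q y"
  using assms(2)
proof (induction m rule: dec_induct)
  case base
  have "(P ^^ n) x y \<longrightarrow> ((\<lambda>u v. P u v \<or> (u = v \<and> Q u)) ^^ n) x y"
    by (induction n arbitrary: y) (auto simp: relcompp_apply)
  then show ?case using assms(1) by blast
next
  case (step m)
  then show ?case by (auto simp: relcompp_apply)
qed

lemma relpowp_positive: "(\<exists>n \<ge> 1. (P ^^ n) x y) \<longleftrightarrow> (\<exists>v. P x v \<and> P\<^sup>*\<^sup>* v y)"
proof
  assume "\<exists>n \<ge> 1. (P ^^ n) x y"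
  then obtain n where "1 \<le> n" "(P ^^ n) x y" by blast
  then obtain m where "(P ^^ Suc m) x y" by (cases n) auto
  from relpowp_Suc_D2[OF this] obtain v where v: "P x v \<and> (P ^^ m) v y" ..
  have "P x v \<and> P\<^sup>*\<^sup>* v y"
    by (rule conjI[OF conjunct1[OF v] relpowp_imp_rtranclp[OF conjunct2[OF v]]])
  then show "\<exists>v. P x v \<and> P\<^sup>*\<^sup>* v y" ..
next
  assume "\<exists>v. P x v \<and> P\<^sup>*\<^sup>* v y"
  then obtain v where v: "P x v" "P\<^sup>*\<^sup>* v y" by blast
  from rtranclp_imp_relpowp[OF v(2)] obtain m where "(P ^^ m) v y" ..
  with v(1) have "(P ^^ Suc m) x y" by (rule relpowp_Suc_I2)
  then show "\<exists>n \<ge> 1. (P ^^ n) x y" by (intro exI[of _ "Suc m"]) simp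
qed

text \<open>The length of a path is bounded by the number of pairs in the relation, at most
  \<open>K * K\<close>. This is cruder than counting nodes but only doubles the depth. The loops
  turn an exact length into an upper bound.\<close>

lemma rtranclp_savitch:
  assumes "u < K" "v < K" "K * K \<le> 2 ^ d"
  shows "savitch (\<lambda>u v. S u v \<or> u = v) K d u v \<longleftrightarrow> (below K S)\<^sup>*\<^sup>* u v"
proof -
  let ?S = "\<lambda>u v. S u v \<or> u = v"
  have eq: "below K ?S = (\<lambda>u v. below K S u v \<or> (u = v \<and> u < K))"
    by (auto simp: below_def fun_eq_iff)
  have "(below K ?S ^^ (2 ^ d)) u v \<longleftrightarrow> (below K S)\<^sup>*\<^sup>* u v"
  proof
    have "(below K ?S ^^ n) u v \<Longrightarrow> (below K S)\<^sup>*\<^sup>* u v" for n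
    proof (induction n arbitrary: v)
      case (Suc n)
      then obtain m where "(below K ?S ^^ n) u m" "below K ?S m v" by (auto simp: relcompp_apply)
      then have m: "(below K S)\<^sup>*\<^sup>* u m" "below K S m v \<or> m = v"
        using Suc.IH by (blast, auto simp: below_def)
      then show ?case by (auto intro: rtranclp.rtrancl_into_rtrancl)
    qed simp
    then show "(below K ?S ^^ (2 ^ d)) u v \<Longrightarrow> (below K S)\<^sup>*\<^sup>* u v" .
  next
    assume r: "(below K S)\<^sup>*\<^sup>* u v"
    define R where "R = {(u, v). below K S u v}"
    have sub: "R \<subseteq> {..<K} \<times> {..<K}" by (auto simp: R_def below_def)
    then have fin: "finite R" by (rule finite_subset) simp
    have "card R \<le> K * K" using card_mono[OF _ sub] by simp
    have "(u, v) \<in> R\<^sup>*" using r by (simp add: R_def rtranclp_rtrancl_eq[symmetric])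
    then have "(u, v) \<in> (\<Union>n\<in>{n. n \<le> card R}. R ^^ n)"
      using rtrancl_finite_eq_relpow[OF fin] by simp
    then obtain n where n: "n \<le> card R" "(u, v) \<in> R ^^ n" by blast
    have "(\<lambda>x y. (x, y) \<in> R) = below K S" by (simp add: R_def)
    then have "(below K S ^^ n) u v" using n(2) relpowp_relpow_eq[of n R] by simp
    moreover have "n \<le> 2 ^ d" using n(1) \<open>card R \<le> K * K\<close> assms(3) by linarith
    ultimately show "(below K ?S ^^ (2 ^ d)) u v"
      unfolding eq using relpowp_reflcl_mono[of n "below K S" u v "2 ^ d" "\<lambda>u. u < K"] assms(2) by blast
  qed
  then show ?thesis using savitch_relpowp[OF assms(1,2)] by blast
qed

section \<open>Tilings as paths\<close>

text \<open>The base will be the code of the whole instance, which exceeds every colour occurring in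
  it.\<close>

definition dg :: "nat \<Rightarrow> nat \<Rightarrow> nat \<Rightarrow> nat" where
  "dg x u j = u div x ^ j mod x"

lemma dg_shift: "dg x (u div x) j = dg x u (Suc j)"
  by (simp add: dg_def div_mult2_eq)

lemma dg_0: "dg x 0 j = 0"
  by (simp add: dg_def)

lemma digits_exist: "(\<And>j. j < W \<Longrightarrow> c j < x) \<Longrightarrow> \<exists>u<x ^ W. \<forall>j<W. dg x u j = c j"
proof (induction W arbitrary: c)
  case (Suc W)
  obtain u where u: "u < x ^ W" "\<forall>j<W. dg x u j = c (Suc j)"
    using Suc.IH[of "\<lambda>j. c (Suc j)"] Suc.prems by auto
  let ?u = "c 0 + x * u"
  have c0: "c 0 < x" using Suc.prems by simp
  have "?u div x = u" "?u mod x = c 0" using c0 by auto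
  then have "\<forall>j<Suc W. dg x ?u j = c j"
    using u(2) dg_shift[of x ?u] by (auto simp: less_Suc_eq_0_disj) (simp add: dg_def)
  moreover have "?u < x ^ Suc W"
  proof -
    have "?u < x * Suc u" using c0 by simp
    also have "\<dots> \<le> x * x ^ W" using u(1) by (intro mult_le_mono) auto
    finally show ?thesis by simp
  qed
  ultimately show ?case by blast
qed simp

text \<open>The horizontal colours of the row form a number \<open>h\<close> of \<open>W + 1\<close>
  digits; dividing it by \<open>x\<close> turns left colours into right colours.\<close>

definition row_step :: "(nat \<Rightarrow> nat \<Rightarrow> nat \<Rightarrow> nat \<Rightarrow> bool) \<Rightarrow> nat \<Rightarrow> nat \<Rightarrow> nat \<Rightarrow> nat \<Rightarrow> nat \<Rightarrow> bool" where
  "row_step T x W B u v \<longleftrightarrow> (\<exists>h<B. dg x h 0 = 0 \<and> dg x h W = 0 \<and>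
     (\<forall>j<W. T (dg x h j) (dg x u j) (dg x (h div x) j) (dg x v j)))"

lemma tiling_iff_path:
  assumes T: "\<And>l t r b. (l, t, r, b) \<in> T \<longleftrightarrow> P l t r b"
    and small: "\<And>l t r b. P l t r b \<Longrightarrow> l < x \<and> t < x \<and> r < x \<and> b < x"
    and x: "0 < x" and W: "1 \<le> W" and B: "x ^ Suc W \<le> B" and K: "x ^ W \<le> K" and H: "1 \<le> H"
  shows "(\<exists>\<tau>. is_tiling T H W \<tau>) \<longleftrightarrow> (below K (row_step P x W B) ^^ H) 0 0"
proof
  assume "\<exists>\<tau>. is_tiling T H W \<tau>"
  then obtain \<tau> where \<tau>: "is_tiling T H W \<tau>" by blast
  have inT: "\<tau> i j \<in> T" if "1 \<le> i" "i \<le> H" "1 \<le> j" "j \<le> W" for i j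
    using \<tau> that by (simp add: is_tiling_def)
  have P: "P (tleft (\<tau> i j)) (ttop (\<tau> i j)) (tright (\<tau> i j)) (tbottom (\<tau> i j))"
    if "1 \<le> i" "i \<le> H" "1 \<le> j" "j \<le> W" for i j
    using inT[OF that] T by (cases "\<tau> i j") simp
  note lt = small[OF P]
  have "\<exists>u<x ^ W. \<forall>j<W. dg x u j = (if i = 0 \<or> H \<le> i then 0 else ttop (\<tau> (Suc i) (Suc j)))" for i
    by (rule digits_exist) (use lt x in auto)
  then obtain f0 where f0: "\<And>i. f0 i < x ^ W"
    "\<And>i j. j < W \<Longrightarrow> dg x (f0 i) j = (if i = 0 \<or> H \<le> i then 0 else ttop (\<tau> (Suc i) (Suc j)))"
    by metis
  \<comment> \<open>The end rows are set to 0 itself, which spares the argument that digits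
    determine a number.\<close>
  define f where "f i = (if i = 0 \<or> H \<le> i then 0 else f0 i)" for i
  have fK: "f i < K" for i
    using f0(1)[of i] K x zero_less_power[of x W] by (auto simp: f_def)
  have ftop: "dg x (f i) j = ttop (\<tau> (Suc i) (Suc j))" if "i < H" "j < W" for i j
    using \<tau> that f0(2)[of j i] by (auto simp: f_def dg_0 is_tiling_def white_def)
  have fbot: "dg x (f (Suc i)) j = tbottom (\<tau> (Suc i) (Suc j))" if i: "i < H" "j < W" for i j
  proof (cases "Suc i = H")
    case True
    then show ?thesis using \<tau> i by (simp add: f_def dg_0 is_tiling_def white_def)
  next
    case False
    then have "dg x (f (Suc i)) j = ttop (\<tau> (Suc (Suc i)) (Suc j))" using ftop i by simp
    also have "\<dots> = tbottom (\<tau> (Suc i) (Suc j))" using \<tau> i False by (simp add: is_tiling_def)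
    finally show ?thesis .
  qed
  have "row_step P x W B (f i) (f (Suc i))" if i: "i < H" for i
  proof -
    have "\<exists>h<x ^ Suc W. \<forall>j<Suc W. dg x h j = (if j = 0 then 0 else tright (\<tau> (Suc i) j))"
      by (rule digits_exist) (use lt x i in auto)
    then obtain h where h: "h < x ^ Suc W" "\<forall>j<Suc W. dg x h j = (if j = 0 then 0 else tright (\<tau> (Suc i) j))"
      by blast
    have "P (dg x h j) (dg x (f i) j) (dg x (h div x) j) (dg x (f (Suc i)) j)" if j: "j < W" for j
    proof -
      have "dg x h j = tleft (\<tau> (Suc i) (Suc j))"
        using h(2) j \<tau> i by (cases j) (auto simp: is_tiling_def white_def)
      then show ?thesis
        using P[of "Suc i" "Suc j"] i j ftop[OF i j] fbot[OF i j] h(2) by (simp add: dg_shift)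
    qed
    moreover have "dg x h W = 0" using h(2) W \<tau> i by (auto simp: is_tiling_def white_def)
    moreover have "h < B" using h(1) B by simp
    ultimately show ?thesis unfolding row_step_def using h(2) by (intro exI[of _ h]) auto
  qed
  then have "\<forall>i<H. below K (row_step P x W B) (f i) (f (Suc i))"
    using fK by (simp add: below_def)
  moreover have "f 0 = 0" "f H = 0" by (simp_all add: f_def)
  ultimately show "(below K (row_step P x W B) ^^ H) 0 0"
    unfolding relpowp_fun_conv by blast
next
  assume "(below K (row_step P x W B) ^^ H) 0 0"
  then obtain f where f: "f 0 = 0" "f H = 0" "\<forall>i<H. below K (row_step P x W B) (f i) (f (Suc i))"
    unfolding relpowp_fun_conv by blast
  then have "\<forall>i. \<exists>h. i < H \<longrightarrow> dg x h 0 = 0 \<and> dg x h W = 0 \<and>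
     (\<forall>j<W. P (dg x h j) (dg x (f i) j) (dg x (h div x) j) (dg x (f (Suc i)) j))"
    by (auto simp: below_def row_step_def)
  then obtain h where h: "\<And>i. i < H \<Longrightarrow> dg x (h i) 0 = 0" "\<And>i. i < H \<Longrightarrow> dg x (h i) W = 0"
    "\<And>i j. i < H \<Longrightarrow> j < W \<Longrightarrow> P (dg x (h i) j) (dg x (f i) j) (dg x (h i) (Suc j)) (dg x (f (Suc i)) j)"
    unfolding dg_shift by metis
  define \<tau> where "\<tau> i j = (dg x (h (i - 1)) (j - 1), dg x (f (i - 1)) (j - 1), dg x (h (i - 1)) j, dg x (f i) (j - 1))" for i j
  have "\<tau> i j \<in> T" if "i \<in> {1..H}" "j \<in> {1..W}" for i j
    using h(3)[of "i - 1" "j - 1"] that T by (auto simp: \<tau>_def)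
  then have "is_tiling T H W \<tau>"
    unfolding is_tiling_def using h(1,2) f(1,2) H by (auto simp: \<tau>_def dg_0 white_def)
  then show "\<exists>\<tau>. is_tiling T H W \<tau>" by blast
qed

text \<open>White lies in \<open>Col\<close>, so left and top colour determine the corner tile. The
  corner condition thereby concerns the distinguished tile alone and not the tiling.\<close>

lemma tiling_corner:
  assumes "deterministic T" "is_tiling T H W \<tau>" "1 \<le> H" "1 \<le> W"
  shows "\<tau> 1 1 = (l, t, r, b) \<longleftrightarrow> (l, t, r, b) \<in> T \<and> l = 0 \<and> t = 0"
proof -
  have c: "\<tau> 1 1 \<in> T" "tleft (\<tau> 1 1) = 0" "ttop (\<tau> 1 1) = 0"
    using assms(2-4) by (auto simp: is_tiling_def white_def)
  obtain Col where Col: "(0::nat) \<in> Col" "\<forall>c\<in>Col. \<forall>c'. \<forall>t1\<in>T. \<forall>t2\<in>T.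
        tleft t1 = c \<and> ttop t1 = c' \<and> tleft t2 = c \<and> ttop t2 = c' \<longrightarrow> t1 = t2"
    using assms(1) unfolding deterministic_def white_def by blast
  show ?thesis
  proof
    assume "\<tau> 1 1 = (l, t, r, b)"
    then show "(l, t, r, b) \<in> T \<and> l = 0 \<and> t = 0" using c by simp
  next
    assume "(l, t, r, b) \<in> T \<and> l = 0 \<and> t = 0"
    then show "\<tau> 1 1 = (l, t, r, b)"
      using Col(2)[rule_format, OF Col(1) c(1), of "(l, t, r, b)" 0] c by auto
  qed
qed

text \<open>The bits of \<open>C\<close> are the characteristic function of \<open>Col\<close>, with
  white at bit 0. Membership matters only for colours below \<open>x\<close>, so the partition can
  be searched for.\<close>

definition det_check :: "(nat \<Rightarrow> nat \<Rightarrow> nat \<Rightarrow> nat \<Rightarrow> bool) \<Rightarrow> nat \<Rightarrow> nat \<Rightarrow> bool" where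
  "det_check T x B \<longleftrightarrow> (\<exists>C<B. odd C \<and>
     (\<forall>l<x. \<forall>t<x. \<forall>r<x. \<forall>b<x. T l t r b \<longrightarrow> (odd (C div 2 ^ t) \<longleftrightarrow> even (C div 2 ^ b)) \<and>
       (\<forall>l'<x. \<forall>r'<x. \<forall>b'<x. T l' t r' b' \<longrightarrow>
          (odd (C div 2 ^ l) \<and> l = l' \<longrightarrow> r = r' \<and> b = b') \<and>
          (even (C div 2 ^ r) \<and> r = r' \<longrightarrow> l = l' \<and> b = b'))))"

lemma det_check_iff:
  assumes T: "\<And>l t r b. (l, t, r, b) \<in> T \<longleftrightarrow> P l t r b"
    and small: "\<And>l t r b. P l t r b \<Longrightarrow> l < x \<and> t < x \<and> r < x \<and> b < x"
    and x: "0 < x" and B: "2 ^ x \<le> B"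
  shows "deterministic T \<longleftrightarrow> det_check P x B"
proof
  assume "deterministic T"
  then obtain Col where Col: "0 \<in> Col" "\<forall>t\<in>T. ttop t \<in> Col \<longleftrightarrow> tbottom t \<notin> Col"
     "\<forall>c\<in>Col. \<forall>c'. \<forall>t1\<in>T. \<forall>t2\<in>T. tleft t1 = c \<and> ttop t1 = c' \<and> tleft t2 = c \<and> ttop t2 = c' \<longrightarrow> t1 = t2"
     "\<forall>c\<in>-Col. \<forall>c'. \<forall>t1\<in>T. \<forall>t2\<in>T. tright t1 = c \<and> ttop t1 = c' \<and> tright t2 = c \<and> ttop t2 = c' \<longrightarrow> t1 = t2"
    unfolding deterministic_def white_def by blast
  have "\<exists>C<2 ^ x. \<forall>j<x. dg 2 C j = of_bool (j \<in> Col)"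
    by (rule digits_exist) simp
  then obtain C where C: "C < 2 ^ x" "\<forall>j<x. dg 2 C j = of_bool (j \<in> Col)"
    by blast
  have bit: "odd (C div 2 ^ j) \<longleftrightarrow> j \<in> Col" if "j < x" for j
    using C(2) that by (auto simp: dg_def odd_iff_mod_2_eq_one)
  have c1: "odd C" using bit[of 0] x Col(1) by simp
  have c2: "(odd (C div 2 ^ t) \<longleftrightarrow> even (C div 2 ^ b))" if "P l t r b" for l t r b
    using that small[OF that] Col(2) T[of l t r b] bit by force
  have c3: "(odd (C div 2 ^ l) \<and> l = l' \<longrightarrow> r = r' \<and> b = b') \<and>
          (even (C div 2 ^ r) \<and> r = r' \<longrightarrow> l = l' \<and> b = b')"
    if "P l t r b" "P l' t r' b'" for l t r b l' r' b'
  proof -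
    have t: "(l, t, r, b) \<in> T" "(l', t, r', b') \<in> T" using that T by auto
    have 1: "r = r' \<and> b = b'" if "l \<in> Col" "l = l'"
      using Col(3) that t by force
    have 2: "l = l' \<and> b = b'" if "r \<notin> Col" "r = r'"
      using Col(4) that t by force
    show ?thesis using 1 2 bit small[OF that(1)] by blast
  qed
  show "det_check P x B"
    unfolding det_check_def
    by (rule exI[of _ C], intro conjI[OF less_le_trans[OF C(1) B] conjI[OF c1]] allI impI)
      (rule conjI, erule c2, intro allI impI, erule (1) c3)
next
  assume "det_check P x B"
  then obtain C where CD: "C < B \<and> odd C \<and> (\<forall>l<x. \<forall>t<x. \<forall>r<x. \<forall>b<x. P l t r b \<longrightarrow>
       (odd (C div 2 ^ t) \<longleftrightarrow> even (C div 2 ^ b)) \<and>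
       (\<forall>l'<x. \<forall>r'<x. \<forall>b'<x. P l' t r' b' \<longrightarrow>
          (odd (C div 2 ^ l) \<and> l = l' \<longrightarrow> r = r' \<and> b = b') \<and>
          (even (C div 2 ^ r) \<and> r = r' \<longrightarrow> l = l' \<and> b = b')))"
    unfolding det_check_def by (elim exE)
  note C = conjunct1[OF conjunct2[OF CD]]
  note D = conjunct2[OF conjunct2[OF CD]]
  have C2: "odd (C div 2 ^ t) \<longleftrightarrow> even (C div 2 ^ b)" if "P l t r b" for l t r b
  proof -
    have "l < x" "t < x" "r < x" "b < x" using small[OF that] by auto
    from conjunct1[OF D[rule_format, OF this that]] show ?thesis .
  qed
  have C3: "(odd (C div 2 ^ l) \<and> l = l' \<longrightarrow> r = r' \<and> b = b') \<and>
          (even (C div 2 ^ r) \<and> r = r' \<longrightarrow> l = l' \<and> b = b')" if "P l t r b" "P l' t r' b'" for l t r b l' r' b'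
  proof -
    have s: "l < x" "t < x" "r < x" "b < x" "l' < x" "r' < x" "b' < x"
      using small[OF that(1)] small[OF that(2)] by auto
    have "\<forall>l'<x. \<forall>r'<x. \<forall>b'<x. P l' t r' b' \<longrightarrow>
          (odd (C div 2 ^ l) \<and> l = l' \<longrightarrow> r = r' \<and> b = b') \<and>
          (even (C div 2 ^ r) \<and> r = r' \<longrightarrow> l = l' \<and> b = b')"
      using conjunct2[OF D[rule_format, OF s(1-4) that(1)]] .
    from this[THEN spec, THEN mp, OF s(5), THEN spec, THEN mp, OF s(6), THEN spec, THEN mp, OF s(7),
        THEN mp, OF that(2)]
    show ?thesis .
  qed
  show "deterministic T"
    unfolding deterministic_def
  proof (intro exI[of _ "{c. odd (C div 2 ^ c)}"] conjI ballI allI impI)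
    show "white \<in> {c. odd (C div 2 ^ c)}" using C by (simp add: white_def)
  next
    fix t
    assume "t \<in> T"
    then show "ttop t \<in> {c. odd (C div 2 ^ c)} \<longleftrightarrow> tbottom t \<notin> {c. odd (C div 2 ^ c)}"
      using C2 T by (cases t) auto
  next
    fix c c' t1 t2
    assume "c \<in> {c. odd (C div 2 ^ c)}" "t1 \<in> T" "t2 \<in> T"
      "tleft t1 = c \<and> ttop t1 = c' \<and> tleft t2 = c \<and> ttop t2 = c'"
    then show "t1 = t2" using C3 T by (cases t1; cases t2) auto
  next
    fix c c' t1 t2
    assume "c \<in> - {c. odd (C div 2 ^ c)}" "t1 \<in> T" "t2 \<in> T"
      "tright t1 = c \<and> ttop t1 = c' \<and> tright t2 = c \<and> ttop t2 = c'"
    then show "t1 = t2" using C3 T by (cases t1; cases t2) auto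
  qed
qed

section \<open>The verdict on an encoded instance\<close>

lemma cmp_dg: "cmp a \<Longrightarrow> cmp b \<Longrightarrow> cmp c \<Longrightarrow> cmp (\<lambda>N e. dg (a N e) (b N e) (c N e))"
  unfolding dg_def by (intro cmp_intros)

lemma cmp_lg: "cmp a \<Longrightarrow> cmp (\<lambda>N e. lg (a N e))"
  by (rule cmp_comp1[where g = "\<lambda>N a. lg a"]) (unfold lg_def, intro cmp_intros)

abbreviation tile_rel :: "nat \<Rightarrow> nat \<Rightarrow> nat \<Rightarrow> nat \<Rightarrow> nat \<Rightarrow> nat \<Rightarrow> bool" where
  "tile_rel x J \<equiv> tile_at (tiles_code x) J"

lemma cmp_row_step:
  "cmp a \<Longrightarrow> cmp b \<Longrightarrow> cmp c \<Longrightarrow> cmp d \<Longrightarrow> cmp h \<Longrightarrow> cmp i \<Longrightarrow>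
    cmpP (\<lambda>N e. row_step (tile_rel (a N e) (b N e)) (a N e) (c N e) (d N e) (h N e) (i N e))"
  by (rule cmp_comp6[where g = "\<lambda>N x J W B u v. of_bool (row_step (tile_rel x J) x W B u v)"])
    (unfold row_step_def, intro cmp_intros cmp_dg cmp_tile_at cmp_tiles_code)

lemma cmp_det_check:
  "cmp a \<Longrightarrow> cmp b \<Longrightarrow> cmp c \<Longrightarrow>
    cmpP (\<lambda>N e. det_check (tile_rel (a N e) (b N e)) (a N e) (c N e))"
  by (rule cmp_comp3[where g = "\<lambda>N x J B. of_bool (det_check (tile_rel x J) x B)"])
    (unfold det_check_def, intro cmp_intros cmp_tile_at cmp_tiles_code)

text \<open>The recursion of \<open>path_U\<close> changes its last argument, which
  \<open>cmp_rec\<close> does not allow. Scanning from the most significant digit down, with later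
  digits overriding earlier ones, keeps that argument fixed.\<close>

lemma path_U_rec:
  "path_U G u d a = rec_nat u (\<lambda>i r. if odd (a div G ^ (d - 1 - i) mod G) then a div G ^ (d - 1 - i) mod G div 2 else r) d"
proof -
  have "i \<le> d \<Longrightarrow> rec_nat u (\<lambda>i r. if odd (a div G ^ (d - 1 - i) mod G) then a div G ^ (d - 1 - i) mod G div 2 else r) i
      = path_U G u i (a div G ^ (d - i))" for i
  proof (induction i)
    case (Suc i)
    have "a div G ^ (d - Suc i) div G = a div G ^ (d - i)"
      using Suc.prems by (simp add: div_mult2_eq[symmetric] power_Suc2[symmetric] Suc_diff_Suc del: power_Suc)
    then show ?case using Suc by (simp add: diff_diff_add)
  qed simp
  from this[OF order_refl] show ?thesis by (simp only: diff_self_eq_0 power_0 div_by_1)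
qed

lemma path_V_rec:
  "path_V G d a = rec_nat 0 (\<lambda>i r. if odd (a div G ^ (d - 1 - i) mod G) then r else a div G ^ (d - 1 - i) mod G div 2) d"
proof -
  have "i \<le> d \<Longrightarrow> rec_nat 0 (\<lambda>i r. if odd (a div G ^ (d - 1 - i) mod G) then r else a div G ^ (d - 1 - i) mod G div 2) i
      = path_V G i (a div G ^ (d - i))" for i
  proof (induction i)
    case (Suc i)
    have "a div G ^ (d - Suc i) div G = a div G ^ (d - i)"
      using Suc.prems by (simp add: div_mult2_eq[symmetric] power_Suc2[symmetric] Suc_diff_Suc del: power_Suc)
    then show ?case using Suc by (simp add: diff_diff_add)
  qed simp
  from this[OF order_refl] show ?thesis by (simp only: diff_self_eq_0 power_0 div_by_1)
qed

lemma cmp_path_U: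
  "cmp a \<Longrightarrow> cmp b \<Longrightarrow> cmp c \<Longrightarrow> cmp d \<Longrightarrow> cmp (\<lambda>N e. path_U (a N e) (b N e) (c N e) (d N e))"
  by (rule cmp_comp4[where g = "\<lambda>N a b c d. path_U a b c d"]) (unfold path_U_rec,
      intro cmp_rec[where f = "\<lambda>N i r e. if odd (e 3 div e 0 ^ (e 2 - 1 - i) mod e 0)
         then e 3 div e 0 ^ (e 2 - 1 - i) mod e 0 div 2 else r"] cmp_intros)

lemma cmp_path_V:
  "cmp a \<Longrightarrow> cmp b \<Longrightarrow> cmp c \<Longrightarrow> cmp (\<lambda>N e. path_V (a N e) (b N e) (c N e))"
  by (rule cmp_comp3[where g = "\<lambda>N a b c. path_V a b c"]) (unfold path_V_rec,
      intro cmp_rec[where f = "\<lambda>N i r e. if odd (e 2 div e 0 ^ (e 1 - 1 - i) mod e 0)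
         then r else e 2 div e 0 ^ (e 1 - 1 - i) mod e 0 div 2"] cmp_intros)

text \<open>Parameters of the game: a row of vertical colours is a number below \<open>2 ^ rb\<close>, the recursion
  depth is \<open>W\<close> for height \<open>2 ^ W\<close> and \<open>2 * rb\<close> for unrestricted height, and \<open>levels\<close> is the height
  of the tree. The primed versions saturate at \<open>N - 1\<close>.\<close>

definition depth :: "bool \<Rightarrow> nat \<Rightarrow> nat \<Rightarrow> nat" where
  "depth star x W = (if star then 2 * (x * W) else W)"

definition levels :: "bool \<Rightarrow> nat \<Rightarrow> nat \<Rightarrow> nat" where
  "levels star x W = depth star x W * (x * W + 1)"

text \<open>\<open>2 ^ size_exp\<close> dominates all that is computed: the states and rounds of the
  traversal through \<open>levels\<close>, the horizontal colours of a row because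
  \<open>x ^ (W + 1) \<le> 2 ^ (x * W + x)\<close>, and the sets of colours because of
  \<open>2 ^ x\<close>. The 8 is slack for constants.\<close>

definition size_exp :: "bool \<Rightarrow> nat \<Rightarrow> nat \<Rightarrow> nat" where
  "size_exp star x W = levels star x W + (x * W + x) + 8"

definition rb' :: "nat \<Rightarrow> nat \<Rightarrow> nat \<Rightarrow> nat" where
  "rb' N x W = smul N x W"

definition depth' :: "bool \<Rightarrow> nat \<Rightarrow> nat \<Rightarrow> nat \<Rightarrow> nat" where
  "depth' star N x W = (if star then smul N 2 (rb' N x W) else W)"

definition levels' :: "bool \<Rightarrow> nat \<Rightarrow> nat \<Rightarrow> nat \<Rightarrow> nat" where
  "levels' star N x W = smul N (depth' star N x W) (sadd N (rb' N x W) 1)"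

text \<open>The summand 8 is composed of 3, 3 and 2, as larger constants are out of range at width
  2.\<close>

definition size_exp' :: "bool \<Rightarrow> nat \<Rightarrow> nat \<Rightarrow> nat \<Rightarrow> nat" where
  "size_exp' star N x W = sadd N (sadd N (levels' star N x W) (sadd N (rb' N x W) x)) (sadd N 3 (sadd N 3 2))"

lemma cmp_params:
  assumes "cmp a" "cmp b"
  shows "cmp (\<lambda>N e. rb' N (a N e) (b N e))" "cmp (\<lambda>N e. depth' star N (a N e) (b N e))"
    "cmp (\<lambda>N e. levels' star N (a N e) (b N e))" "cmp (\<lambda>N e. size_exp' star N (a N e) (b N e))"
proof -
  show 1: "cmp (\<lambda>N e. rb' N (a N e) (b N e))"
    unfolding rb'_def by (intro cmp_smul assms)
  show 2: "cmp (\<lambda>N e. depth' star N (a N e) (b N e))"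
    unfolding depth'_def by (cases star) (auto intro!: cmp_smul cmp_two 1 assms)
  show 3: "cmp (\<lambda>N e. levels' star N (a N e) (b N e))"
    unfolding levels'_def by (intro cmp_smul cmp_sadd cmp_one 1 2)
  show "cmp (\<lambda>N e. size_exp' star N (a N e) (b N e))"
    unfolding size_exp'_def by (intro cmp_sadd cmp_two cmp_three 1 3 assms)
qed

lemma params_min:
  assumes N: "16 \<le> N" and x: "x < N" and W: "W' = min W (N - 1)"
  shows "rb' N x W' = min (x * W) (N - 1)" "depth' star N x W' = min (depth star x W) (N - 1)"
    "levels' star N x W' = min (levels star x W) (N - 1)"
    "size_exp' star N x W' = min (size_exp star x W) (N - 1)"
proof -
  have m: "x = min x (N - 1)" "1 = min 1 (N - 1)" "2 = min 2 (N - 1)" "3 = min 3 (N - 1)"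
    using N x by auto
  show 1: "rb' N x W' = min (x * W) (N - 1)"
    unfolding rb'_def W using smul_min[of N x W] m(1) by simp
  show 2: "depth' star N x W' = min (depth star x W) (N - 1)"
    unfolding depth'_def depth_def 1 using smul_min[of N 2 "x * W"] m(3) W by simp
  have "sadd N (min (x * W) (N - 1)) 1 = min (x * W + 1) (N - 1)"
    using sadd_min[of N "x * W" 1] m(2) by simp
  then show 3: "levels' star N x W' = min (levels star x W) (N - 1)"
    unfolding levels'_def levels_def 1 2 by (simp only: smul_min)
  have "sadd N 3 (sadd N 3 2) = min 8 (N - 1)"
    using N by (simp add: sadd_def)
  moreover have "sadd N (min (x * W) (N - 1)) x = min (x * W + x) (N - 1)"
    using sadd_min[of N "x * W" x] m(1) by simp
  ultimately show "size_exp' star N x W' = min (size_exp star x W) (N - 1)"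
    unfolding size_exp'_def size_exp_def 1 3 by (simp only: sadd_min)
qed

section \<open>The game in saturating arithmetic\<close>

definition game_step :: "bool \<Rightarrow> nat \<Rightarrow> nat \<Rightarrow> nat \<Rightarrow> nat \<Rightarrow> nat \<Rightarrow> nat \<Rightarrow> bool" where
  "game_step star x J W B u v \<longleftrightarrow> row_step (tile_rel x J) x W B u v \<or> (star \<and> u = v)"

definition traverse' :: "bool \<Rightarrow> nat \<Rightarrow> nat \<Rightarrow> nat \<Rightarrow> nat \<Rightarrow> nat \<Rightarrow> nat \<Rightarrow> nat \<Rightarrow> nat" where
  "traverse' star N x J W B u c = (if c mod 3 = 0 then (if levels' star N x W \<le> lg (c div 3)
        then sadd N c (if game_step star x J W B
             (path_U (spow N 2 (sadd N (rb' N x W) 1)) u (depth' star N x W) (c div 3))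
             (path_V (spow N 2 (sadd N (rb' N x W) 1)) (depth' star N x W) (c div 3)) then 2 else 1)
        else smul N 2 c)
     else if c div 3 = 1 then c
     else if even (c div 3) \<and> (c mod 3 = 2 \<longleftrightarrow> (levels' star N x W - lg (c div 3)) mod sadd N (rb' N x W) 1 = 0)
        then sadd N (c - c mod 3) 3
     else sadd N (smul N 3 (c div 3 div 2)) (c mod 3))"

definition game' :: "bool \<Rightarrow> nat \<Rightarrow> nat \<Rightarrow> nat \<Rightarrow> nat \<Rightarrow> nat \<Rightarrow> nat \<Rightarrow> bool" where
  "game' star N x J W B u \<longleftrightarrow> rec_nat 3 (\<lambda>_ c. traverse' star N x J W B u c) (N - 1) mod 3 = 2"

lemma cmp_game_step:
  "cmp a \<Longrightarrow> cmp b \<Longrightarrow> cmp c \<Longrightarrow> cmp d \<Longrightarrow> cmp h \<Longrightarrow> cmp i \<Longrightarrow>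
    cmpP (\<lambda>N e. game_step star (a N e) (b N e) (c N e) (d N e) (h N e) (i N e))"
  unfolding game_step_def
  by (cases star) (simp_all only: simp_thms, (intro cmp_or cmp_eq cmp_row_step; assumption)+)

lemma cmp_traverse':
  "cmp a \<Longrightarrow> cmp b \<Longrightarrow> cmp c \<Longrightarrow> cmp d \<Longrightarrow> cmp h \<Longrightarrow> cmp i \<Longrightarrow>
    cmp (\<lambda>N e. traverse' star N (a N e) (b N e) (c N e) (d N e) (h N e) (i N e))"
  by (rule cmp_comp6[where g = "traverse' star"])
    (unfold traverse'_def, intro cmp_intros cmp_lg cmp_params cmp_game_step cmp_path_U cmp_path_V)

lemma cmp_game':
  "cmp a \<Longrightarrow> cmp b \<Longrightarrow> cmp c \<Longrightarrow> cmp d \<Longrightarrow> cmp h \<Longrightarrow>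
    cmpP (\<lambda>N e. game' star N (a N e) (b N e) (c N e) (d N e) (h N e))"
  by (rule cmp_comp5[where g = "\<lambda>N x J W B u. of_bool (game' star N x J W B u)"])
    (unfold game'_def, intro cmp_rec[where f = "\<lambda>N y r e. traverse' star N (e 0) (e 1) (e 2) (e 3) (e 4) r"]
      cmp_traverse' cmp_intros)

text \<open>While \<open>2 ^ size_exp\<close> stays below the saturation value, every saturated
  quantity is exact, and \<open>N - 1\<close> rounds are enough for the traversal.\<close>

lemma game'_correct:
  assumes small: "2 ^ size_exp star x W < N - 1" and x: "0 < x" and W: "0 < W"
  shows "game' star N x J W B u \<longleftrightarrow> savitch (game_step star x J W B) (2 ^ (x * W)) (depth star x W) u 0"
proof -
  let ?rb = "x * W"
  let ?L = "levels star x W"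
  let ?d = "depth star x W"
  have "(16::nat) \<le> 2 ^ size_exp star x W"
    using power_increasing[of 4 "size_exp star x W" "2::nat"] by (simp add: size_exp_def)
  then have N: "16 \<le> N" using small by simp
  have sl: "size_exp star x W < N - 1" using small less_exp[of "size_exp star x W"] by linarith
  have xN: "x < N" and WW: "W = min W (N - 1)"
  proof -
    have "W \<le> x * W" using x by simp
    then have "W \<le> size_exp star x W" unfolding size_exp_def by linarith
    then show "W = min W (N - 1)" using sl by linarith
    show "x < N" using sl by (simp add: size_exp_def)
  qed
  have d1: "1 \<le> ?d" using x W by (auto simp: depth_def Suc_le_eq)
  then have gL: "?rb + 1 \<le> ?L" unfolding levels_def using mult_le_mono1[of 1 ?d "?rb + 1"] by simp
  have dL: "?d \<le> ?L" by (simp add: levels_def)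
  note p = params_min(1)[OF N xN WW] params_min(2-4)[OF N xN WW, of star]
  have e: "rb' N x W = ?rb" "depth' star N x W = ?d" "levels' star N x W = ?L"
    using p sl dL by (auto simp: size_exp_def min_def)
  have g: "sadd N ?rb 1 = Suc ?rb" using sl by (simp add: sadd_def size_exp_def)
  have "(2::nat) ^ (?L + 4) \<le> 2 ^ size_exp star x W"
    by (rule power_increasing) (auto simp: size_exp_def)
  then have big: "2 ^ (?L + 4) < N - 1" using small by (rule le_less_trans)
  have "2 ^ Suc ?rb \<le> (2::nat) ^ (?L + 4)" by (rule power_increasing) (use gL in auto)
  then have G: "spow N 2 (Suc ?rb) = 2 ^ Suc ?rb" using big by (simp add: spow_def)
  define \<phi> where "\<phi> a \<longleftrightarrow> game_step star x J W B (path_U (2 ^ Suc ?rb) u ?d a) (path_V (2 ^ Suc ?rb) ?d a)" for a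
  have t: "traverse' star N x J W B u c = traverse ?L (Suc ?rb) \<phi> c" if c: "c < 3 * 2 ^ (?L + 1)" for c
  proof -
    have "(2::nat) ^ 1 \<le> 2 ^ ?L" by (rule power_increasing) (use gL in auto)
    then have "2 * c + 8 < N"
      using c big by (simp add: power_add)
    moreover have "3 * (c div 3 div 2) \<le> c" by simp
    moreover have "c mod 3 < 3" by simp
    ultimately have a: "smul N 2 c = 2 * c"
      "sadd N (c - c mod 3) 3 = c - c mod 3 + 3" "smul N 3 (c div 3 div 2) = 3 * (c div 3 div 2)"
      "sadd N (3 * (c div 3 div 2)) (c mod 3) = 3 * (c div 3 div 2) + c mod 3"
      unfolding sadd_def smul_def by linarith+
    have b: "sadd N c (if b then 2 else 1) = c + (if b then 2 else 1)" for b
      using \<open>2 * c + 8 < N\<close> by (cases b) (simp_all add: sadd_def)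
    show ?thesis
      unfolding traverse'_def traverse_def e g G \<phi>_def[symmetric] a b ..
  qed
  have "rec_nat 3 (\<lambda>_ c. traverse' star N x J W B u c) (N - 1) = code 1 (game_val \<phi> (Suc ?rb) ?L 1)"
    by (rule traverse_result[where f = "traverse' star N x J W B u"])
      (use big in \<open>simp add: power_add\<close>, rule t)
  then have "game' star N x J W B u \<longleftrightarrow> game_val \<phi> (Suc ?rb) ?L 1"
    by (simp add: game'_def)
  also have "?L = ?d * Suc ?rb" by (simp add: levels_def)
  also have "game_val \<phi> (Suc ?rb) (?d * Suc ?rb) 1 \<longleftrightarrow> savitch (game_step star x J W B) (2 ^ ?rb) ?d
      (path_U (2 ^ Suc ?rb) u (?d - ?d) 1) (path_V (2 ^ Suc ?rb) (?d - ?d) 1)"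
    by (rule game_val_savitch[where S = "game_step star x J W B"], rule \<phi>_def, rule order_refl)
  finally show ?thesis
    by (simp only: diff_self_eq_0 path_U.simps path_V.simps)
qed

text \<open>For unrestricted height the first row is split off, since the reflexive game alone would
  admit a tiling without rows. The test \<open>v div 2 ^ rb' N x W = 0\<close> stands for
  \<open>v < 2 ^ (x * W)\<close>.\<close>

definition accepts' :: "bool \<Rightarrow> nat \<Rightarrow> nat \<Rightarrow> nat \<Rightarrow> nat \<Rightarrow> bool" where
  "accepts' star N x W B \<longleftrightarrow> (\<exists>J<x. \<exists>r<x. \<exists>b<x. inst x J 0 0 r b \<and> tile_rel x J 0 0 r b \<and>
     det_check (tile_rel x J) x B \<and>
     (if star then \<exists>v<B. v div 2 ^ rb' N x W = 0 \<and> row_step (tile_rel x J) x W B 0 v \<and> game' star N x J W B v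
      else game' star N x J W B 0))"

definition verdict :: "bool \<Rightarrow> nat \<Rightarrow> nat \<Rightarrow> nat \<Rightarrow> nat" where
  "verdict star k N x = (if spow N 2 (size_exp' star N x (min (expk k (lead x)) (N - 1))) = N - 1 then 0
     else if accepts' star N x (min (expk k (lead x)) (N - 1))
        (spow N 2 (size_exp' star N x (min (expk k (lead x)) (N - 1)))) then 1 else 3)"

lemma cmp_accepts':
  "cmp a \<Longrightarrow> cmp b \<Longrightarrow> cmp c \<Longrightarrow> cmpP (\<lambda>N e. accepts' star N (a N e) (b N e) (c N e))"
  by (rule cmp_comp3[where g = "\<lambda>N x W B. of_bool (accepts' star N x W B)"])
    (unfold accepts'_def, cases star, simp_all only: if_True if_False,
      (intro cmp_intros cmp_inst cmp_tile_at cmp_tiles_code cmp_det_check cmp_row_step cmp_game' cmp_params)+)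

lemma cmp_verdict: "cmp (\<lambda>N e. verdict star k N (e 0))"
  unfolding verdict_def
  by (intro cmp_intros cmp_accepts' cmp_params cmp_expk cmp_lead)

definition tiling_lang :: "bool \<Rightarrow> nat \<Rightarrow> bool list set" where
  "tiling_lang star k = (if star then detTILING_star (expk k) else detTILING (expk (k + 1)) (expk k))"

lemma expk_pos: "1 \<le> k \<Longrightarrow> 1 \<le> expk k n"
  by (cases k) auto

lemma power_le_two_power: "x ^ W \<le> 2 ^ (x * W)"
proof -
  have "x \<le> 2 ^ x" by simp
  then have "x ^ W \<le> (2 ^ x) ^ W" by (rule power_mono) simp
  then show ?thesis by (simp add: power_mult)
qed

lemma accepts'_correct:
  assumes k: "1 \<le> k" and W: "W = expk k (lead (wd w))"
    and small: "2 ^ size_exp star (wd w) W < N - 1" and B: "B = 2 ^ size_exp star (wd w) W"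
  shows "accepts' star N (wd w) W B \<longleftrightarrow> w \<in> tiling_lang star k"
proof -
  define x where "x = wd w"
  define n where "n = lead x"
  have x: "0 < x" using wd_pos by (simp add: x_def)
  have W1: "1 \<le> W" using expk_pos[OF k] W by simp
  let ?K = "2 ^ (x * W) :: nat"
  have B': "B = 2 ^ size_exp star x W" and small': "2 ^ size_exp star x W < N - 1"
    using B small by (auto simp: x_def)
  have xB: "x ^ Suc W \<le> B"
  proof -
    have "x ^ Suc W \<le> 2 ^ (x * Suc W)" by (rule power_le_two_power)
    also have "\<dots> \<le> B" unfolding B' by (rule power_increasing) (auto simp: size_exp_def)
    finally show ?thesis .
  qed
  have xB2: "2 ^ x \<le> B" unfolding B' by (rule power_increasing) (auto simp: size_exp_def)
  have KB: "?K \<le> B" unfolding B' by (rule power_increasing) (auto simp: size_exp_def)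
  have xK: "x ^ W \<le> ?K" by (rule power_le_two_power)
  have rb: "rb' N x W = x * W"
  proof -
    have "x * W \<le> size_exp star x W" by (simp add: size_exp_def)
    then have "x * W < N - 1" using small' less_exp[of "size_exp star x W"] by linarith
    then show ?thesis by (simp add: rb'_def smul_def)
  qed
  \<comment> \<open>Parts of a parsed word have smaller codes than the word, which is why
    \<open>x\<close> can serve as the base for colours.\<close>
  have tile_small: "l < x \<and> t < x \<and> r < x \<and> b < x" if "tile_rel x J l t r b" for J l t r b
  proof -
    obtain j where e: "encT (nxts j (tiles_code x)) l t r b (nxt (nxts j (tiles_code x)))"
      using \<open>tile_rel x J l t r b\<close> by (auto simp: tile_at_def)
    have "nxt y \<le> y" for y by (simp add: nxt_def search_le)
    then have "nxts j y \<le> y" for y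
      by (induction j arbitrary: y) (auto simp: nxts_def intro: order_trans)
    then have "nxts j (tiles_code x) \<le> x"
      unfolding tiles_code_def by (meson div_le_dividend order_trans)
    then show ?thesis using encT_less[OF e] by linarith
  qed
  define cond where "cond J = (if star then \<exists>v<B. v div 2 ^ rb' N x W = 0 \<and> row_step (tile_rel x J) x W B 0 v \<and> game' star N x J W B v
      else game' star N x J W B 0)" for J
  define tiled where "tiled T = (if star then \<exists>H \<ge> 1. \<exists>\<tau>. is_tiling T H W \<tau> else \<exists>\<tau>. is_tiling T (2 ^ W) W \<tau>)" for T
  have cond: "cond J \<longleftrightarrow> tiled {(l, t, r, b). tile_rel x J l t r b}" for J
  proof -
    let ?T = "{(l, t, r, b). tile_rel x J l t r b}"
    let ?S = "row_step (tile_rel x J) x W B"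
    have path: "(\<exists>\<tau>. is_tiling ?T H W \<tau>) \<longleftrightarrow> (below ?K ?S ^^ H) 0 0" if "1 \<le> H" for H
      by (rule tiling_iff_path[OF _ tile_small x W1 xB xK that]) auto
    have gm: "game' star N x J W B u \<longleftrightarrow> savitch (game_step star x J W B) ?K (depth star x W) u 0" for u
      by (rule game'_correct[OF small' x]) (use W1 in simp)
    show ?thesis
    proof (cases star)
      case False
      then have "game_step star x J W B = ?S" by (auto simp: game_step_def fun_eq_iff)
      then show ?thesis
        using False path[of "2 ^ W"] gm[of 0] savitch_relpowp[of 0 ?K 0 ?S W]
        by (simp add: cond_def tiled_def depth_def)
    next
      case True
      then have sr: "game_step star x J W B = (\<lambda>u v. ?S u v \<or> u = v)" by (auto simp: game_step_def fun_eq_iff)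
      have "savitch (\<lambda>u v. ?S u v \<or> u = v) ?K (2 * (x * W)) v 0 \<longleftrightarrow> (below ?K ?S)\<^sup>*\<^sup>* v 0" if "v < ?K" for v
        by (rule rtranclp_savitch[OF that]) (simp_all add: mult_2 power_add)
      then have "cond J \<longleftrightarrow> (\<exists>v<B. v < ?K \<and> ?S 0 v \<and> (below ?K ?S)\<^sup>*\<^sup>* v 0)"
        using True gm unfolding cond_def rb sr depth_def by (auto simp: div_eq_0_iff)
      also have "\<dots> \<longleftrightarrow> (\<exists>v. below ?K ?S 0 v \<and> (below ?K ?S)\<^sup>*\<^sup>* v 0)"
        using KB by (auto simp: below_def intro: less_le_trans)
      also have "\<dots> \<longleftrightarrow> (\<exists>H \<ge> 1. (below ?K ?S ^^ H) 0 0)"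
        by (rule relpowp_positive[symmetric])
      also have "\<dots> \<longleftrightarrow> tiled ?T" using True path by (auto simp: tiled_def)
      finally show ?thesis .
    qed
  qed
  have tl: "w \<in> tiling_lang star k \<longleftrightarrow> (\<exists>m Ts t0. w = enc_inst m Ts t0 \<and> deterministic (set Ts) \<and>
     (if star then \<exists>H \<ge> 1. \<exists>\<tau>. is_tiling (set Ts) H (expk k m) \<tau> \<and> \<tau> 1 1 = t0
      else \<exists>\<tau>. is_tiling (set Ts) (2 ^ expk k m) (expk k m) \<tau> \<and> \<tau> 1 1 = t0))"
    by (auto simp: tiling_lang_def detTILING_def detTILING_star_def)
  have corner: "(if star then \<exists>H \<ge> 1. \<exists>\<tau>. is_tiling T H W \<tau> \<and> \<tau> 1 1 = (l, t, r, b)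
      else \<exists>\<tau>. is_tiling T (2 ^ W) W \<tau> \<and> \<tau> 1 1 = (l, t, r, b)) \<longleftrightarrow>
      tiled T \<and> (l, t, r, b) \<in> T \<and> l = 0 \<and> t = 0" if "deterministic T" for T l t r b
  proof -
    let ?Q = "(l, t, r, b) \<in> T \<and> l = 0 \<and> t = 0"
    have c: "is_tiling T H W \<tau> \<and> \<tau> 1 1 = (l, t, r, b) \<longleftrightarrow> is_tiling T H W \<tau> \<and> ?Q" if "1 \<le> H" for H \<tau>
      by (rule conj_cong[OF refl], rule tiling_corner[OF \<open>deterministic T\<close> _ that W1])
    show ?thesis
    proof (cases star)
      case True
      have "(\<exists>H \<ge> 1. \<exists>\<tau>. is_tiling T H W \<tau> \<and> \<tau> 1 1 = (l, t, r, b)) \<longleftrightarrow> (\<exists>H \<ge> 1. \<exists>\<tau>. is_tiling T H W \<tau> \<and> ?Q)"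
        by (rule ex_cong1, rule conj_cong[OF refl], rule ex_cong1, rule c)
      then show ?thesis using True unfolding tiled_def by auto
    next
      case False
      have "(\<exists>\<tau>. is_tiling T (2 ^ W) W \<tau> \<and> \<tau> 1 1 = (l, t, r, b)) \<longleftrightarrow> (\<exists>\<tau>. is_tiling T (2 ^ W) W \<tau> \<and> ?Q)"
        by (rule ex_cong1, rule c) simp
      then show ?thesis using False unfolding tiled_def by auto
    qed
  qed
  have det: "deterministic {(l, t, r, b). tile_rel x J l t r b} \<longleftrightarrow> det_check (tile_rel x J) x B" for J
    by (rule det_check_iff[OF _ tile_small x xB2]) auto
  show ?thesis
  proof
    assume "accepts' star N (wd w) W B"
    then obtain J r b where a: "inst x J 0 0 r b" "tile_rel x J 0 0 r b" "det_check (tile_rel x J) x B" "cond J"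
      unfolding accepts'_def x_def[symmetric] cond_def by blast
    obtain Ts where Ts: "w = enc_inst n Ts (0, 0, r, b)" "length Ts = J"
      using instD[of w J 0 0 r b] a(1) by (auto simp: x_def n_def)
    have T: "{(l, t, r, b). tile_rel x J l t r b} = set Ts"
      using instI(4)[OF Ts(1)] Ts(2) by (auto simp: x_def)
    have d: "deterministic (set Ts)" using a(3) det[of J] T by simp
    moreover have "tiled (set Ts)" "(0, 0, r, b) \<in> set Ts" using a(2,4) cond[of J] T by auto
    moreover have "expk k n = W" using W by (simp add: n_def x_def)
    ultimately show "w \<in> tiling_lang star k"
      unfolding tl using Ts(1) corner[OF d, of 0 0 r b] by blast
  next
    assume "w \<in> tiling_lang star k"
    then obtain m Ts l t r b where m: "w = enc_inst m Ts (l, t, r, b)" "deterministic (set Ts)"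
      "if star then \<exists>H \<ge> 1. \<exists>\<tau>. is_tiling (set Ts) H (expk k m) \<tau> \<and> \<tau> 1 1 = (l, t, r, b)
       else \<exists>\<tau>. is_tiling (set Ts) (2 ^ expk k m) (expk k m) \<tau> \<and> \<tau> 1 1 = (l, t, r, b)"
      unfolding tl by (metis prod.exhaust)
    note i = instI[OF m(1)]
    have "expk k m = W" using W i(2) by simp
    then have t: "tiled (set Ts)" "(l, t, r, b) \<in> set Ts" "l = 0" "t = 0"
      using m(3) corner[OF m(2), of l t r b] by auto
    let ?J = "length Ts"
    have T: "{(l, t, r, b). tile_rel x ?J l t r b} = set Ts"
      using i(4) by (auto simp: x_def)
    have "tile_rel x ?J 0 0 r b" using t i(4)[of 0 0 r b] by (simp add: x_def)
    moreover have "inst x ?J 0 0 r b" "?J < x" using i t by (auto simp: x_def)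
    moreover have "det_check (tile_rel x ?J) x B" using det[of ?J] T m(2) by simp
    moreover have "cond ?J" using cond[of ?J] t(1) T by simp
    ultimately show "accepts' star N (wd w) W B"
      unfolding accepts'_def x_def[symmetric] using tile_small[of ?J 0 0 r b] unfolding cond_def by blast
  qed
qed

section \<open>Growth of iterated exponentials and the space bound\<close>

lemma expk_mono: "m \<le> n \<Longrightarrow> expk k m \<le> expk k n"
  by (induction k) auto

lemma expk_mult: "1 \<le> c \<Longrightarrow> 1 \<le> n \<Longrightarrow> c * expk k n \<le> expk k (c * n)"
proof (induction k)
  case (Suc k)
  have e: "1 \<le> expk k n" using Suc.prems by (cases k) auto
  have "c * 2 ^ expk k n \<le> 2 ^ (c - 1) * 2 ^ expk k n"
    using Suc.prems less_exp[of "c - 1"] by (intro mult_le_mono1) linarith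
  also have "\<dots> = 2 ^ (c - 1 + expk k n)" by (simp add: power_add)
  also have "\<dots> \<le> 2 ^ (c * expk k n)"
  proof (rule power_increasing)
    have "c * expk k n = (c - 1) * expk k n + expk k n" using Suc.prems by (simp add: algebra_simps)
    moreover have "c - 1 \<le> (c - 1) * expk k n" using e by simp
    ultimately show "c - 1 + expk k n \<le> c * expk k n" by linarith
  qed simp
  also have "\<dots> \<le> 2 ^ expk k (c * n)" using Suc by (intro power_increasing) auto
  finally show ?case by simp
qed simp

text \<open>A power at the top of the tower is a factor one level below, and factors can be moved
  into the innermost argument. For \<open>k = 0\<close> there is no top to take the power.\<close>

lemma expk_power: "1 \<le> c \<Longrightarrow> 1 \<le> n \<Longrightarrow> 1 \<le> k \<Longrightarrow> expk k n ^ c \<le> expk k (c * n)"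
proof -
  assume a: "1 \<le> c" "1 \<le> n" "1 \<le> k"
  then obtain j where k: "k = Suc j" by (cases k) auto
  have "expk k n ^ c = 2 ^ (c * expk j n)" by (simp add: k power_mult[symmetric] mult.commute)
  also have "\<dots> \<le> 2 ^ expk j (c * n)" by (rule power_increasing) (use expk_mult a in auto)
  finally show ?thesis by (simp add: k)
qed

lemma expk_ge_exp: "1 \<le> k \<Longrightarrow> 2 ^ n \<le> expk k n"
proof -
  assume "1 \<le> k"
  then obtain j where k: "k = Suc j" by (cases k) auto
  have "n \<le> expk j n" by (induction j) (auto intro: order_trans[OF _ less_imp_le[OF less_exp]])
  then show ?thesis by (simp add: k)
qed

lemma size_exp_mono: "x \<le> x' \<Longrightarrow> W \<le> W' \<Longrightarrow> size_exp star x W \<le> size_exp star x' W'"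
  unfolding size_exp_def levels_def depth_def
  by (auto intro!: add_mono mult_le_mono)

text \<open>\<open>E n\<close> bounds both the code of a word of length \<open>n\<close> and the
  width \<open>W\<close>. The required width \<open>S\<close> is of order \<open>E ^ 4\<close>; the
  crude strict bound \<open>E ^ 9\<close> yields the polynomial \<open>9 * (n + 1)\<close>.\<close>

theorem tiling_lang_in_kEXPSPACE:
  assumes k: "1 \<le> k"
  shows "tiling_lang star k \<in> kEXPSPACE k"
proof -
  define E where "E n = expk k (n + 1)" for n
  \<comment> \<open>Two more bits make \<open>N\<close> four times \<open>2 ^ size_exp\<close>,
    clear of the saturation value \<open>N - 1\<close>.\<close>
  define S where "S n = size_exp star (E n) (E n) + 2" for n
  have par: "wd w \<le> E (length w)" "expk k (lead (wd w)) \<le> E (length w)" for w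
  proof -
    have "wd w \<le> 2 ^ (length w + 1)" using wd_less[of w] by simp
    also have "\<dots> \<le> E (length w)" unfolding E_def by (rule expk_ge_exp[OF k])
    finally show "wd w \<le> E (length w)" .
    have "lead (wd w) \<le> length w + 1" by (rule lead_le[OF wd_less])
    then show "expk k (lead (wd w)) \<le> E (length w)" unfolding E_def by (rule expk_mono)
  qed
  show ?thesis
  proof (rule decide_by_width[where V = "verdict star k" and S = S and p = "\<lambda>n. 9 + 9 * n"])
    show "cmp (\<lambda>N e. verdict star k N (e 0))" by (rule cmp_verdict)
  next
    fix w :: "bool list" and s :: nat
    assume s: "length w + 2 \<le> s"
    let ?N = "2 ^ s :: nat"
    let ?x = "wd w"
    let ?W = "expk k (lead ?x)"
    show "verdict star k ?N ?x \<in> {0, if w \<in> tiling_lang star k then 1 else 3}"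
    \<comment> \<open>\<open>params_min\<close> asks for \<open>N \<ge> 16\<close>; at smaller
      widths the summand 8 alone saturates the size.\<close>
    proof (cases "s < 4")
      case True
      have "sadd ?N a (sadd ?N 3 (sadd ?N 3 2)) = ?N - 1" for a
      proof -
        have "?N \<le> 8" using True power_increasing[of s 3 "2::nat"] by simp
        then show ?thesis by (simp add: sadd_def)
      qed
      moreover have "spow ?N 2 (?N - 1) = ?N - 1"
        using less_exp[of "?N - 1"] by (simp add: spow_def)
      ultimately show ?thesis by (simp add: verdict_def size_exp'_def)
    next
      case False
      then have N: "16 \<le> ?N" using power_increasing[of 4 s "2::nat"] by simp
      have xN: "?x < ?N" using wd_less[of w] power_increasing[of "length w + 1" s "2::nat"] s by simp
      have se: "spow ?N 2 (size_exp' star ?N ?x (min ?W (?N - 1))) = min (2 ^ size_exp star ?x ?W) (?N - 1)"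
        unfolding params_min(4)[OF N xN refl] by (rule spow_min)
      show ?thesis
      proof (cases "2 ^ size_exp star ?x ?W < ?N - 1")
        case True
        have "?W \<le> ?x * ?W" using wd_pos[of w] by simp
        then have "?W \<le> size_exp star ?x ?W" unfolding size_exp_def by linarith
        then have "?W < ?N - 1" using True less_exp[of "size_exp star ?x ?W"] by linarith
        then have Wm: "min ?W (?N - 1) = ?W" by simp
        have sm: "min (2 ^ size_exp star ?x ?W) (?N - 1) = 2 ^ size_exp star ?x ?W" using True by simp
        show ?thesis
          unfolding verdict_def se sm unfolding Wm
          using accepts'_correct[OF k refl True refl] True by simp
      next
        case False
        then show ?thesis unfolding verdict_def se by (simp add: min_def)
      qed
    qed
  next
    fix w :: "bool list"
    let ?x = "wd w"
    let ?W = "expk k (lead ?x)"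
    let ?s = "size_exp star ?x ?W + 2"
    let ?N = "2 ^ ?s :: nat"
    have "length w < ?x" by (rule length_lt_wd)
    then have 1: "length w + 2 \<le> ?s" by (simp add: size_exp_def)
    have 2: "?s \<le> S (length w)" using size_exp_mono[OF par] by (simp add: S_def)
    have N: "16 \<le> ?N" using power_increasing[of 4 ?s "2::nat"] by (simp add: size_exp_def)
    have "?x \<le> size_exp star ?x ?W" by (simp add: size_exp_def)
    then have "?x < 2 ^ size_exp star ?x ?W" using less_exp[of "size_exp star ?x ?W"] by linarith
    then have xN: "?x < ?N" by simp
    have "?N = 4 * 2 ^ size_exp star ?x ?W" by (simp add: power_add)
    moreover have "(1::nat) \<le> 2 ^ size_exp star ?x ?W" by simp
    ultimately have "2 ^ size_exp star ?x ?W < ?N - 1" by linarith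
    then have "spow ?N 2 (size_exp' star ?N ?x (min ?W (?N - 1))) \<noteq> ?N - 1"
      unfolding params_min(4)[OF N xN refl] spow_min by linarith
    then have "verdict star k ?N ?x \<noteq> 0" by (simp add: verdict_def)
    then show "\<exists>s \<ge> length w + 2. s \<le> S (length w) \<and> verdict star k (2 ^ s) (wd w) \<noteq> 0"
      using 1 2 by blast
  next
    show "is_poly (\<lambda>n. 9 + 9 * n)"
      unfolding is_poly_def by (intro exI[of _ "[9, 9]"]) simp
  next
    fix n
    let ?E = "E n"
    have E2: "2 \<le> ?E"
    proof -
      have "(2::nat) ^ 1 \<le> 2 ^ (n + 1)" by (rule power_increasing) auto
      from order_trans[OF this expk_ge_exp[OF k]] show ?thesis by (simp add: E_def)
    qed
    have pw: "?E ^ i \<le> ?E ^ j" if "i \<le> j" for i j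
      using that E2 by (intro power_increasing) auto
    have d: "depth star ?E ?E \<le> 2 * ?E ^ 2" using pw[of 1 2] by (auto simp: depth_def power2_eq_square)
    have g: "?E * ?E + 1 \<le> 2 * ?E ^ 2" using pw[of 0 2] by (simp add: power2_eq_square)
    have "levels star ?E ?E \<le> 2 * ?E ^ 2 * (2 * ?E ^ 2)"
      unfolding levels_def by (rule mult_le_mono[OF d g])
    also have "\<dots> = 4 * ?E ^ 4" by (simp add: power_add[symmetric])
    finally have l: "levels star ?E ?E \<le> 4 * ?E ^ 4" .
    have "S n \<le> 4 * ?E ^ 4 + 2 * ?E ^ 4 + 10"
      using l pw[of 2 4] pw[of 1 4] by (simp add: S_def size_exp_def power2_eq_square)
    also have "\<dots> \<le> 16 * ?E ^ 4"
      using power_mono[OF E2, of 4] by simp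
    also have "\<dots> \<le> ?E ^ 4 * ?E ^ 4"
      using power_mono[OF E2, of 4] by (intro mult_le_mono1) simp
    also have "\<dots> = ?E ^ 8" by (simp add: power_add[symmetric])
    also have "\<dots> < ?E ^ 9" using E2 by (intro power_strict_increasing) auto
    also have "\<dots> \<le> expk k (9 * (n + 1))" unfolding E_def by (rule expk_power) (use k in auto)
    finally show "S n < expk k (9 + 9 * n)" by (simp add: algebra_simps)
  qed
qed

section \<open>Simulating a Turing machine by deterministic tiles\<close>

text \<open>The first column only alternates between two tiles, since a tile with left colour white is
  determined by its top colour; all columns to its right start with the colour \<open>Id 0\<close>, which is
  not in \<open>Col\<close>. Left of the head the tiles are determined from the right, right of the head they
  are determined from the left, and the tile at the head is subject to no determinism condition.
  The vertical colour \<open>Cell p m q a\<close> stands for a tape cell in a row of parity \<open>p\<close> with symbol \<open>a\<close>;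
  \<open>m\<close> marks cell 0 and \<open>q\<close> is the state if the head is there.\<close>

datatype col = White | Dum | Id nat | Rt nat | Lt nat | Fin | Ga | Fa | Ha | Sym nat
  | Cell bool bool "nat option" nat

text \<open>The blank padding of the first row must be able to stop at any width. The choice is made
  by tiles with left colour \<open>Fa\<close>, outside \<open>Col\<close>, and right colours in
  \<open>Col\<close>, where neither determinism condition applies; the detour through
  \<open>Ha\<close> provides the other parity. The \<open>finish\<close> tiles close the bottom row;
  they need parity \<open>True\<close> because their bottom is white, and at the head they admit
  only the accepting state.\<close>

inductive_set fixed_tiles :: "tm \<Rightarrow> (col \<times> col \<times> col \<times> col) set" for M where
  corner: "(White, White, Id 0, Dum) \<in> fixed_tiles M"
| dummy: "(White, Dum, Id 0, White) \<in> fixed_tiles M"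
| fillGF: "(Ga, White, Fa, Sym 0) \<in> fixed_tiles M"
| fillFG: "(Fa, White, Ga, Sym 0) \<in> fixed_tiles M"
| fillF: "(Fa, White, White, Sym 0) \<in> fixed_tiles M"
| fillFH: "(Fa, White, Ha, Sym 0) \<in> fixed_tiles M"
| fillH: "(Ha, White, White, Sym 0) \<in> fixed_tiles M"
| conv_head: "a < nsyms M \<Longrightarrow> (Id 0, Sym a, White, Cell False True (Some 0) a) \<in> fixed_tiles M"
| conv: "a < nsyms M \<Longrightarrow> (White, Sym a, White, Cell False False None a) \<in> fixed_tiles M"
| copy_left: "a < nsyms M \<Longrightarrow> (Id 0, Cell p m None a, Id 0, Cell (\<not> p) m None a) \<in> fixed_tiles M"
| copy_right: "a < nsyms M \<Longrightarrow> (White, Cell p False None a, White, Cell (\<not> p) False None a) \<in> fixed_tiles M"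
| enter_left: "a < nsyms M \<Longrightarrow> q < nstates M \<Longrightarrow>
    (Id 0, Cell p m None a, Lt q, Cell (\<not> p) m (Some q) a) \<in> fixed_tiles M"
| enter_right: "a < nsyms M \<Longrightarrow> q < nstates M \<Longrightarrow>
    (Rt q, Cell p False None a, White, Cell (\<not> p) False (Some q) a) \<in> fixed_tiles M"
| head_halted: "a < nsyms M \<Longrightarrow> q < nstates M \<Longrightarrow> halted q \<Longrightarrow>
    (Id 0, Cell p m (Some q) a, White, Cell (\<not> p) m (Some q) a) \<in> fixed_tiles M"
| head_right: "a < nsyms M \<Longrightarrow> q < nstates M \<Longrightarrow> \<not> halted q \<Longrightarrow> delta M q a = (q', a', MoveR) \<Longrightarrow>
    (Id 0, Cell p m (Some q) a, Rt q', Cell (\<not> p) m None a') \<in> fixed_tiles M"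
| head_stay: "a < nsyms M \<Longrightarrow> q < nstates M \<Longrightarrow> \<not> halted q \<Longrightarrow> delta M q a = (q', a', d) \<Longrightarrow>
    d = Stay \<or> (d = MoveL \<and> m) \<Longrightarrow>
    (Id 0, Cell p m (Some q) a, White, Cell (\<not> p) m (Some q') a') \<in> fixed_tiles M"
| head_left: "a < nsyms M \<Longrightarrow> q < nstates M \<Longrightarrow> \<not> halted q \<Longrightarrow> delta M q a = (q', a', MoveL) \<Longrightarrow>
    (Lt q', Cell p False (Some q) a, White, Cell (\<not> p) False None a') \<in> fixed_tiles M"
| finish: "a < nsyms M \<Longrightarrow> (if m then Id 0 else Fin, Cell True m None a, Fin, White) \<in> fixed_tiles M"
| finish_head: "a < nsyms M \<Longrightarrow> (if m then Id 0 else Fin, Cell True m (Some 1) a, Fin, White) \<in> fixed_tiles M"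
| finish_end: "a < nsyms M \<Longrightarrow> (Fin, Cell True False None a, White, White) \<in> fixed_tiles M"

text \<open>The horizontal colour carries the position, so the left colour determines the
  letter.\<close>

definition letter_tile :: "bool list \<Rightarrow> nat \<Rightarrow> col \<times> col \<times> col \<times> col" where
  "letter_tile w j = (Id j, White, Id (Suc j), Sym (sym_of (w ! j)))"

definition end_tile :: "bool list \<Rightarrow> col \<times> col \<times> col \<times> col" where
  "end_tile w = (Id (length w), White, Ga, Sym 0)"

definition tiles :: "tm \<Rightarrow> bool list \<Rightarrow> (col \<times> col \<times> col \<times> col) set" where
  "tiles M w = fixed_tiles M \<union> letter_tile w ` {..<length w} \<union> {end_tile w}"

lemma tiles_not_White:
  "t \<noteq> White \<Longrightarrow> (l, t, r, b) \<in> tiles M w \<longleftrightarrow> (l, t, r, b) \<in> fixed_tiles M"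
  by (auto simp: tiles_def letter_tile_def end_tile_def)

lemmas fixed_tiles_intros = fixed_tiles.intros(1-17)
  finish[where m = True, simplified] finish[where m = False, simplified]
  finish_head[where m = True, simplified] finish_head[where m = False, simplified] finish_end

lemma fixed_tiles_White:
  "(l, White, r, b) \<in> fixed_tiles M \<longleftrightarrow> (l, r, b) \<in> {(White, Id 0, Dum), (Ga, Fa, Sym 0), (Fa, Ga, Sym 0),
     (Fa, White, Sym 0), (Fa, Ha, Sym 0), (Ha, White, Sym 0)}"
proof
  assume "(l, White, r, b) \<in> fixed_tiles M"
  then show "(l, r, b) \<in> {(White, Id 0, Dum), (Ga, Fa, Sym 0), (Fa, Ga, Sym 0),
     (Fa, White, Sym 0), (Fa, Ha, Sym 0), (Ha, White, Sym 0)}" by cases simp_all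
qed (auto intro: fixed_tiles_intros)

lemma tiles_White:
  "(l, White, r, b) \<in> tiles M w \<longleftrightarrow> (l, r, b) \<in> {(White, Id 0, Dum), (Ga, Fa, Sym 0), (Fa, Ga, Sym 0),
     (Fa, White, Sym 0), (Fa, Ha, Sym 0), (Ha, White, Sym 0), (Id (length w), Ga, Sym 0)} \<or>
     (\<exists>j<length w. (l, r, b) = (Id j, Id (Suc j), Sym (sym_of (w ! j))))"
proof -
  have 1: "(l, White, r, b) \<in> letter_tile w ` {..<length w} \<longleftrightarrow>
      (\<exists>j<length w. (l, r, b) = (Id j, Id (Suc j), Sym (sym_of (w ! j))))"
    by (auto simp: letter_tile_def)
  have 2: "(l, White, r, b) \<in> {end_tile w} \<longleftrightarrow> (l, r, b) = (Id (length w), Ga, Sym 0)"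
    by (simp add: end_tile_def)
  show ?thesis
    unfolding tiles_def Un_iff fixed_tiles_White 1 2 by (simp only: insert_iff empty_iff disj_assoc simp_thms disj_ac)
qed

lemma tiles_Dum: "(l, Dum, r, b) \<in> tiles M w \<longleftrightarrow> l = White \<and> r = Id 0 \<and> b = White"
  unfolding tiles_not_White[of Dum, simplified]
proof
  assume "(l, Dum, r, b) \<in> fixed_tiles M"
  then show "l = White \<and> r = Id 0 \<and> b = White" by cases simp_all
qed (auto intro: fixed_tiles_intros)

lemma tiles_Sym: "(l, Sym a, r, b) \<in> tiles M w \<longleftrightarrow> a < nsyms M \<and> r = White \<and>
    (l = Id 0 \<and> b = Cell False True (Some 0) a \<or> l = White \<and> b = Cell False False None a)"
  unfolding tiles_not_White[of "Sym a", simplified]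
proof
  assume "(l, Sym a, r, b) \<in> fixed_tiles M"
  then show "a < nsyms M \<and> r = White \<and>
    (l = Id 0 \<and> b = Cell False True (Some 0) a \<or> l = White \<and> b = Cell False False None a)" by cases simp_all
qed (auto intro: fixed_tiles_intros)

lemma tiles_cell: "(l, Cell p m None a, r, b) \<in> tiles M w \<longleftrightarrow> a < nsyms M \<and>
    (l = Id 0 \<and> r = Id 0 \<and> b = Cell (\<not> p) m None a \<or>
     l = White \<and> r = White \<and> \<not> m \<and> b = Cell (\<not> p) m None a \<or>
     (\<exists>q<nstates M. l = Id 0 \<and> r = Lt q \<and> b = Cell (\<not> p) m (Some q) a) \<or>
     (\<exists>q<nstates M. l = Rt q \<and> r = White \<and> \<not> m \<and> b = Cell (\<not> p) m (Some q) a) \<or>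
     p \<and> b = White \<and> (l = (if m then Id 0 else Fin) \<and> r = Fin \<or> l = Fin \<and> r = White \<and> \<not> m))"
  (is "_ \<longleftrightarrow> ?R")
  unfolding tiles_not_White[of "Cell p m None a", simplified]
proof
  assume "(l, Cell p m None a, r, b) \<in> fixed_tiles M"
  then show ?R by cases simp_all
qed (auto intro: fixed_tiles_intros)

lemma tiles_head: "(l, Cell p m (Some q) a, r, b) \<in> tiles M w \<longleftrightarrow> a < nsyms M \<and>
    (q < nstates M \<and> (if halted q then l = Id 0 \<and> r = White \<and> b = Cell (\<not> p) m (Some q) a
     else (case delta M q a of (q', a', d) \<Rightarrow> (case d of
        MoveR \<Rightarrow> l = Id 0 \<and> r = Rt q' \<and> b = Cell (\<not> p) m None a'
      | Stay \<Rightarrow> l = Id 0 \<and> r = White \<and> b = Cell (\<not> p) m (Some q') a'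
      | MoveL \<Rightarrow> (if m then l = Id 0 \<and> r = White \<and> b = Cell (\<not> p) m (Some q') a'
                 else l = Lt q' \<and> r = White \<and> b = Cell (\<not> p) m None a')))) \<or>
     p \<and> q = 1 \<and> b = White \<and> l = (if m then Id 0 else Fin) \<and> r = Fin)"
  (is "_ \<longleftrightarrow> ?R")
  unfolding tiles_not_White[of "Cell p m (Some q) a", simplified]
proof
  assume "(l, Cell p m (Some q) a, r, b) \<in> fixed_tiles M"
  then show ?R by cases (auto)
next
  assume R: ?R
  obtain q' a' d where d: "delta M q a = (q', a', d)" by (rule prod_cases3)
  show "(l, Cell p m (Some q) a, r, b) \<in> fixed_tiles M"
    using R d by (cases d) (auto split: if_splits intro: fixed_tiles_intros head_stay[of a M q q' a' d])
qed

subsection \<open>Determinism\<close>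

text \<open>Vertical colours alternate from row to row. Among the horizontal ones of the simulation,
  \<open>White\<close> and \<open>Rt\<close> spread to the right and lie in \<open>Col\<close>,
  while \<open>Id 0\<close> and \<open>Lt\<close> spread to the left and lie outside.\<close>

fun in_Col :: "col \<Rightarrow> bool" where
  "in_Col White = True"
| "in_Col Dum = False"
| "in_Col (Id j) = (j \<noteq> 0)"
| "in_Col (Rt q) = True"
| "in_Col (Lt q) = False"
| "in_Col Fin = False"
| "in_Col Ga = True"
| "in_Col Fa = False"
| "in_Col Ha = True"
| "in_Col (Sym a) = False"
| "in_Col (Cell p m q a) = (\<not> p)"

lemma tiles_alternate: "(l, t, r, b) \<in> tiles M w \<Longrightarrow> in_Col t \<longleftrightarrow> \<not> in_Col b"
  unfolding tiles_def by (auto simp: letter_tile_def end_tile_def elim: fixed_tiles.cases)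

lemma tiles_top: "(l, t, r, b) \<in> tiles M w \<Longrightarrow>
   t = White \<or> t = Dum \<or> (\<exists>a. t = Sym a) \<or> (\<exists>p m a. t = Cell p m None a) \<or> (\<exists>p m q a. t = Cell p m (Some q) a)"
proof (cases "t = White")
  case False
  assume "(l, t, r, b) \<in> tiles M w"
  then have "(l, t, r, b) \<in> fixed_tiles M" using False by (simp add: tiles_not_White)
  then show ?thesis by cases auto
qed simp

lemma tiles_det_left:
  assumes 1: "(l, t, r, b) \<in> tiles M w" and 2: "(l, t, r', b') \<in> tiles M w" and "in_Col l"
  shows "r = r' \<and> b = b'"
  using tiles_top[OF 1]
proof (elim disjE exE)
  fix p m q a assume "t = Cell p m (Some q) a"
  then show ?thesis using 1 2 \<open>in_Col l\<close> by (auto simp: tiles_head split: if_splits dir.splits prod.splits)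
qed (use 1 2 \<open>in_Col l\<close> in \<open>auto simp: tiles_White tiles_Dum tiles_Sym tiles_cell split: if_splits\<close>)

lemma tiles_det_right:
  assumes 1: "(l, t, r, b) \<in> tiles M w" and 2: "(l', t, r, b') \<in> tiles M w" and "\<not> in_Col r"
  shows "l = l' \<and> b = b'"
  using tiles_top[OF 1]
proof (elim disjE exE)
  fix p m q a assume "t = Cell p m (Some q) a"
  then show ?thesis using 1 2 \<open>\<not> in_Col r\<close> by (auto simp: tiles_head split: if_splits dir.splits prod.splits)
qed (use 1 2 \<open>\<not> in_Col r\<close> in \<open>auto simp: tiles_White tiles_Dum tiles_Sym tiles_cell split: if_splits\<close>)

subsection \<open>Rows of configurations\<close>

definition cell_col :: "bool \<Rightarrow> conf \<Rightarrow> nat \<Rightarrow> col" where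
  "cell_col p c j = Cell p (j = 0) (if j = chead c then Some (cstate c) else None) (ctape c j)"

definition good_conf :: "tm \<Rightarrow> conf \<Rightarrow> bool" where
  "good_conf M c \<longleftrightarrow> cstate c < nstates M \<and> (\<forall>j. ctape c j < nsyms M)"

lemma good_step: "wf_tm M \<Longrightarrow> good_conf M c \<Longrightarrow> good_conf M (step M c)"
  by (cases c) (fastforce simp: good_conf_def cstate_def ctape_def wf_tm_def split: prod.splits)

lemma good_run: "wf_tm M \<Longrightarrow> good_conf M (run M w t)"
proof (induction t)
  case 0
  then show ?case
    by (auto simp: run_def init_conf_def good_conf_def cstate_def ctape_def wf_tm_def sym_of_def)
next
  case (Suc t)
  then show ?case using good_step by (simp add: run_def)
qed

lemma run_Suc: "run M w (Suc t) = step M (run M w t)"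
  by (simp add: run_def)

text \<open>The horizontal colour to the left of cell \<open>j\<close> in the row that performs the step from \<open>c\<close>.\<close>

definition bd :: "tm \<Rightarrow> conf \<Rightarrow> nat \<Rightarrow> col" where
  "bd M c j = (case delta M (cstate c) (ctape c (chead c)) of (q', a', d) \<Rightarrow>
     (if j < chead c then Id 0
      else if j = chead c then (if \<not> halted (cstate c) \<and> d = MoveL \<and> j \<noteq> 0 then Lt q' else Id 0)
      else if j = Suc (chead c) then (if \<not> halted (cstate c) \<and> d = MoveR then Rt q' else White)
      else White))"

lemma row_complete:
  assumes M: "wf_tm M" and c: "good_conf M c"
  shows "(bd M c j, cell_col p c j, bd M c (Suc j), cell_col (\<not> p) (step M c) j) \<in> tiles M w"
proof -
  obtain q tp h where cc: "c = (q, tp, h)" by (rule prod_cases3)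
  obtain q' a' d where d: "delta M q (tp h) = (q', a', d)" by (rule prod_cases3)
  have g: "q < nstates M" "\<And>j. tp j < nsyms M" using c by (auto simp: good_conf_def cc cstate_def ctape_def)
  have g': "q' < nstates M" "a' < nsyms M"
    using M g(1) g(2)[of h] d unfolding wf_tm_def by force+
  show ?thesis
  proof (cases "halted q")
    case True
    then show ?thesis
      using g d by (auto simp: bd_def cell_col_def cc cstate_def ctape_def chead_def tiles_cell tiles_head)
  next
    case False
    show ?thesis
    proof (cases d)
      case MoveL
      then show ?thesis
        using False g g' d by (auto simp: bd_def cell_col_def cc cstate_def ctape_def chead_def tiles_cell tiles_head)
    next
      case Stay
      then show ?thesis
        using False g g' d by (auto simp: bd_def cell_col_def cc cstate_def ctape_def chead_def tiles_cell tiles_head)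
    next
      case MoveR
      then show ?thesis
        using False g g' d by (auto simp: bd_def cell_col_def cc cstate_def ctape_def chead_def tiles_cell tiles_head)
    qed
  qed
qed

text \<open>The tile at the head fixes the colours on both its sides, \<open>Id 0\<close> or
  \<open>Lt\<close> on the left and \<open>White\<close> or \<open>Rt\<close> on the right, and its
  neighbours pass the information outwards. Excluding state 1 bars the \<open>finish\<close> tile at
  the head. A colour \<open>Rt\<close> at the right end means that the head leaves the
  segment.\<close>

lemma row_sound:
  assumes row: "\<And>j. j < V \<Longrightarrow> (h j, cell_col p c j, h (Suc j), b j) \<in> tiles M w"
    and head: "chead c < V" and q: "cstate c \<noteq> 1"
  shows "(h V = White \<or> (\<exists>q. h V = Rt q)) \<and> (\<forall>j<V. b j = cell_col (\<not> p) (step M c) j) \<and>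
    (h V = White \<longrightarrow> chead (step M c) < V)"
proof -
  obtain q tp k where cc: "c = (q, tp, k)" by (rule prod_cases3)
  obtain q' a' d where d: "delta M q (tp k) = (q', a', d)" by (rule prod_cases3)
  have k: "k < V" "q \<noteq> 1" using head q by (auto simp: cc chead_def cstate_def)
  have cell: "cell_col p c j = Cell p (j = 0) (if j = k then Some q else None) (tp j)" for j
    by (simp add: cell_col_def cc cstate_def ctape_def chead_def)
  have hd: "(h k, Cell p (k = 0) (Some q) (tp k), h (Suc k), b k) \<in> tiles M w"
    using row[OF k(1)] by (simp add: cell)
  have nh: "(h j, Cell p (j = 0) None (tp j), h (Suc j), b j) \<in> tiles M w" if "j < V" "j \<noteq> k" for j
    using row[OF that(1)] that(2) by (simp add: cell)
  have hk: "h k = Id 0 \<or> (\<exists>q. h k = Lt q)"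
    using hd k(2) by (auto simp: tiles_head split: if_splits dir.splits prod.splits)
  have left: "h j = Id 0" if "j < k" for j
  proof -
    have "h (k - Suc i) = Id 0" if "i < k" for i
      using that
    proof (induction i)
      case 0
      then have "Suc (k - Suc 0) = k" by simp
      then show ?case using nh[of "k - Suc 0"] hk 0 k(1) by (auto simp: tiles_cell)
    next
      case (Suc i)
      then have "Suc (k - Suc (Suc i)) = k - Suc i" by simp
      then show ?case using nh[of "k - Suc (Suc i)"] Suc k(1) by (auto simp: tiles_cell)
    qed
    from this[of "k - Suc j"] show ?thesis using that by simp
  qed
  have hSk: "h (Suc k) = White \<or> (\<exists>q. h (Suc k) = Rt q)"
    using hd k(2) by (auto simp: tiles_head split: if_splits dir.splits prod.splits)
  have right: "h (Suc (Suc k + i)) = White" if "Suc k + i < V" for i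
    using that
  proof (induction i)
    case 0
    then show ?case using nh[of "Suc k"] hSk by (auto simp: tiles_cell)
  next
    case (Suc i)
    then show ?case using nh[of "Suc k + Suc i"] by (auto simp: tiles_cell)
  qed
  have right': "h j = White" if "Suc k < j" "j \<le> V" for j
  proof -
    obtain i where "j = Suc (Suc k + i)" using less_imp_Suc_add[OF \<open>Suc k < j\<close>] by blast
    then show ?thesis using right[of i] that(2) by simp
  qed
  have hV: "h V = White \<or> (\<exists>q. h V = Rt q)"
    using hSk right'[of V] k(1) by (cases "Suc k = V") auto
  have bl: "b j = (if Suc j = k \<and> h k \<noteq> Id 0 then (case h k of Lt q \<Rightarrow> Cell (\<not> p) (j = 0) (Some q) (tp j) | _ \<Rightarrow> White)
      else Cell (\<not> p) (j = 0) None (tp j))" if "j < k" for j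
  proof (cases "Suc j = k")
    case True
    then show ?thesis using nh[of j] hk that k(1) by (auto simp: tiles_cell left)
  next
    case False
    then have "h (Suc j) = Id 0" using left[of "Suc j"] that by simp
    then show ?thesis using nh[of j] that k(1) False by (auto simp: tiles_cell left)
  qed
  have br: "b j = (if j = Suc k \<and> h (Suc k) \<noteq> White then (case h (Suc k) of Rt q \<Rightarrow> Cell (\<not> p) (j = 0) (Some q) (tp j) | _ \<Rightarrow> White)
      else Cell (\<not> p) (j = 0) None (tp j))" if "k < j" "j < V" for j
  proof (cases "j = Suc k")
    case True
    then show ?thesis using nh[of j] hSk that by (auto simp: tiles_cell)
  next
    case False
    then have "h j = White" "h (Suc j) = White" using right'[of j] right'[of "Suc j"] that by auto
    then show ?thesis using nh[of j] that False by (auto simp: tiles_cell)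
  qed
  have st: "step M c = (if halted q then c else (q', tp(k := a'), move d k))"
    by (simp add: cc d)
  have "b j = cell_col (\<not> p) (step M c) j" if j: "j < V" for j
  proof -
    consider "j < k" | "j = k" | "k < j" by linarith
    then show ?thesis
    proof cases
      case 1
      show ?thesis unfolding bl[OF 1] st using hd k(2) 1
        by (cases d) (auto simp: tiles_head d cell_col_def cc cstate_def ctape_def chead_def split: if_splits)
    next
      case 2
      show ?thesis unfolding 2 st using hd k(2)
        by (cases d) (auto simp: tiles_head d cell_col_def cc cstate_def ctape_def chead_def split: if_splits)
    next
      case 3
      show ?thesis unfolding br[OF 3 j] st using hd k(2) 3
        by (cases d) (auto simp: tiles_head d cell_col_def cc cstate_def ctape_def chead_def split: if_splits)
    qed
  qed
  moreover have "chead (step M c) < V" if "h V = White"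
  proof (cases "Suc k = V")
    case True
    then show ?thesis unfolding st using hd k(2) that
      by (cases d) (auto simp: tiles_head d cc chead_def split: if_splits)
  next
    case False
    then show ?thesis unfolding st using k(1) by (cases d) (auto simp: cc chead_def)
  qed
  ultimately show ?thesis using hV by blast
qed

subsection \<open>Colourings\<close>

text \<open>Edges are coloured instead of tiles, so that neighbouring tiles match by
  construction.\<close>

definition colored :: "(col \<times> col \<times> col \<times> col) set \<Rightarrow> nat \<Rightarrow> nat \<Rightarrow> (nat \<Rightarrow> nat \<Rightarrow> col) \<Rightarrow> (nat \<Rightarrow> nat \<Rightarrow> col) \<Rightarrow> bool" where
  "colored T H W h v \<longleftrightarrow> (\<forall>i<H. \<forall>j<W. (h i j, v i j, h i (Suc j), v (Suc i) j) \<in> T) \<and>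
     (\<forall>i<H. h i 0 = White \<and> h i W = White) \<and> (\<forall>j<W. v 0 j = White \<and> v H j = White)"

definition init_tape :: "bool list \<Rightarrow> nat \<Rightarrow> nat" where
  "init_tape w j = (if j < length w then sym_of (w ! j) else 0)"

lemma run_0: "cstate (run M w 0) = 0" "chead (run M w 0) = 0" "ctape (run M w 0) = init_tape w"
  by (auto simp: run_def init_conf_def cstate_def chead_def ctape_def init_tape_def)

text \<open>If the machine never accepts, the vertical colours from level 2 on show a configuration,
  which is never white; so there is no place for the white bottom.\<close>

lemma coloring_sound:
  assumes M: "wf_tm M" and col: "colored (tiles M w) H W h v" and H: "1 \<le> H" and W: "1 \<le> W"
  shows "\<exists>t. cstate (run M w t) = 1"
proof (rule ccontr)
  assume "\<nexists>t. cstate (run M w t) = 1"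
  then have nacc: "cstate (run M w t) \<noteq> 1" for t by blast
  let ?n = "length w"
  have tile: "(h i j, v i j, h i (Suc j), v (Suc i) j) \<in> tiles M w" if "i < H" "j < W" for i j
    using col that by (simp add: colored_def)
  have lb: "h i 0 = White" "h i W = White" if "i < H" for i using col that by (auto simp: colored_def)
  have tb: "v 0 j = White" "v H j = White" if "j < W" for j using col that by (auto simp: colored_def)
  have c0: "h 0 1 = Id 0" "v 1 0 = Dum"
    using tile[of 0 0] H W lb(1)[of 0] tb(1)[of 0] by (auto simp: tiles_White)
  \<comment> \<open>White may occur inside the first row, after which the corner tile can open a new
    block. Only the first block is followed, with cells 0 to \<open>V - 1\<close>. The column after
    it alternates between \<open>White\<close> and \<open>Dum\<close> like column 0 and thus keeps a
    white border.\<close>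
  define W1 where "W1 = (LEAST j. 1 \<le> j \<and> h 0 j = White)"
  have W1: "1 \<le> W1" "h 0 W1 = White" "W1 \<le> W"
    using LeastI[of "\<lambda>j. 1 \<le> j \<and> h 0 j = White" W] Least_le[of "\<lambda>j. 1 \<le> j \<and> h 0 j = White" W] W lb(2)[of 0] H
    by (auto simp: W1_def)
  have nW: "h 0 j \<noteq> White" if "1 \<le> j" "j < W1" for j
    using not_less_Least[of j "\<lambda>j. 1 \<le> j \<and> h 0 j = White"] that by (auto simp: W1_def)
  define V where "V = W1 - 1"
  have V: "W1 = Suc V" "1 \<le> V" "V < W"
  proof -
    have "W1 \<noteq> 1" using c0 W1(2) by auto
    then show "W1 = Suc V" "1 \<le> V" "V < W" using W1 by (auto simp: V_def)
  qed
  have row0: "j < V \<Longrightarrow> (if j \<le> ?n then h 0 (Suc j) = Id j else h 0 (Suc j) \<in> {Ga, Fa, Ha})" for j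
  proof (induction j)
    case 0
    then show ?case using c0 by simp
  next
    case (Suc j)
    have "v 0 (Suc j) = White" using tb(1)[of "Suc j"] Suc.prems V by simp
    then have "(h 0 (Suc j), White, h 0 (Suc (Suc j)), v 1 (Suc j)) \<in> tiles M w"
      using tile[of 0 "Suc j"] H Suc.prems V by simp
    moreover have "h 0 (Suc (Suc j)) \<noteq> White" using nW[of "Suc (Suc j)"] Suc.prems V by simp
    ultimately show ?case
      using Suc by (auto simp: tiles_White split: if_splits)
  qed
  have bot0: "v 1 (Suc j) = Sym (init_tape w j)" if "j < V" for j
  proof -
    have "v 0 (Suc j) = White" using tb(1)[of "Suc j"] that V by simp
    then have "(h 0 (Suc j), White, h 0 (Suc (Suc j)), v 1 (Suc j)) \<in> tiles M w"
      using tile[of 0 "Suc j"] H that V by simp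
    then show ?thesis
      using row0[OF that] by (auto simp: tiles_White init_tape_def split: if_splits)
  qed
  have side0: "v 1 (Suc V) = Dum" if "Suc V < W"
    using tile[of 0 "Suc V"] H that W1(2) V(1) tb(1)[of "Suc V"] by (auto simp: tiles_White)
  have "H \<noteq> 1" using c0(2) tb(2)[of 0] W by auto
  then have H2: "2 \<le> H" using H by simp
  \<comment> \<open>Two rows of tiles set up the initial configuration, so level \<open>i\<close>
    shows time \<open>i - 2\<close>.\<close>
  define Inv where "Inv i \<longleftrightarrow> v i 0 = (if odd i then Dum else White) \<and>
     (\<forall>j<V. v i (Suc j) = cell_col (odd i) (run M w (i - 2)) j) \<and> chead (run M w (i - 2)) < V \<and>
     (Suc V < W \<longrightarrow> v i (Suc V) = (if odd i then Dum else White))" for i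
  have inv2: "Inv 2"
  proof -
    have d: "h 1 1 = Id 0" "v 2 0 = White"
      using tile[of 1 0] H2 W c0 lb(1)[of 1] by (auto simp: tiles_Dum numeral_2_eq_2)
    have t: "(h 1 (Suc j), Sym (init_tape w j), h 1 (Suc (Suc j)), v 2 (Suc j)) \<in> tiles M w" if "j < V" for j
      using tile[of 1 "Suc j"] H2 that V bot0[OF that] by (simp add: numeral_2_eq_2)
    have w: "h 1 (Suc (Suc j)) = White" if "j < V" for j
      using t[OF that] by (simp add: tiles_Sym)
    have "v 2 (Suc j) = cell_col False (run M w 0) j" if "j < V" for j
    proof (cases j)
      case 0
      then show ?thesis using t[OF that] d by (auto simp: tiles_Sym cell_col_def run_0)
    next
      case (Suc i)
      then show ?thesis using t[OF that] w[of i] that by (auto simp: tiles_Sym cell_col_def run_0)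
    qed
    moreover have "v 2 (Suc V) = White" if "Suc V < W"
      using tile[of 1 "Suc V"] H2 that side0 by (auto simp: tiles_Dum numeral_2_eq_2)
    ultimately show ?thesis using d V by (simp add: Inv_def run_0)
  qed
  have invS: "Inv (Suc i)" if i: "2 \<le> i" "i < H" "Inv i" for i
  proof -
    let ?c = "run M w (i - 2)"
    have "Suc i - 2 = Suc (i - 2)" using i(1) by simp
    then have st: "run M w (Suc i - 2) = step M ?c" by (simp only: run_Suc)
    have d: "h i 1 = Id 0" "v (Suc i) 0 = (if odd (Suc i) then Dum else White)"
      using tile[of i 0] i W lb(1)[of i] by (auto simp: tiles_Dum tiles_White Inv_def split: if_splits)
    have "(h i (Suc V) = White \<or> (\<exists>q. h i (Suc V) = Rt q)) \<and>
       (\<forall>j<V. v (Suc i) (Suc j) = cell_col (\<not> odd i) (step M ?c) j) \<and>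
       (h i (Suc V) = White \<longrightarrow> chead (step M ?c) < V)"
    proof (rule row_sound[where h = "\<lambda>j. h i (Suc j)" and b = "\<lambda>j. v (Suc i) (Suc j)"])
      show "(h i (Suc j), cell_col (odd i) ?c j, h i (Suc (Suc j)), v (Suc i) (Suc j)) \<in> tiles M w" if "j < V" for j
        using tile[of i "Suc j"] i that V by (simp add: Inv_def)
    qed (use i nacc in \<open>auto simp: Inv_def\<close>)
    note r = this
    have side: "h i (Suc V) = White \<and> (Suc V < W \<longrightarrow> v (Suc i) (Suc V) = (if odd (Suc i) then Dum else White))"
    proof (cases "Suc V < W")
      case True
      have "(h i (Suc V), if odd i then Dum else White, h i (Suc (Suc V)), v (Suc i) (Suc V)) \<in> tiles M w"
        using tile[of i "Suc V"] i True by (simp add: Inv_def)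
      then show ?thesis using r by (auto simp: tiles_Dum tiles_White split: if_splits)
    next
      case False
      then have "W = Suc V" using V by simp
      then show ?thesis using lb(2)[of i] i by simp
    qed
    show ?thesis
      unfolding Inv_def st using d r side by simp
  qed
  have "Inv H"
    using H2 by (induction rule: dec_induct) (rule inv2, rule invS)
  then have "v H 1 = cell_col (odd H) (run M w (H - 2)) 0"
    using H2 V by (simp add: Inv_def)
  then show False using tb(2)[of 1] V by (simp add: cell_col_def)
qed

text \<open>The last row of tiles has index \<open>H - 1\<close> and reads the configuration at time
  \<open>H - 3\<close>; its index must be odd for the \<open>finish\<close> tiles to apply, hence
  the parity of \<open>H\<close>.\<close>

lemma coloring_complete:
  assumes M: "wf_tm M" and acc: "cstate (run M w (H - 3)) = 1" and H: "4 \<le> H" "even H"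
    and W: "length w + 5 \<le> W" and heads: "\<And>t. chead (run M w t) + 3 < W"
  shows "\<exists>h v. colored (tiles M w) H W h v"
proof -
  let ?n = "length w"
  \<comment> \<open>The colour to the left of column \<open>j\<close>: after the input
    \<open>Ga\<close> and \<open>Fa\<close> alternate, and if the last column would get
    \<open>Ga\<close>, it gets \<open>Ha\<close>.\<close>
  define row0 where "row0 j = (if j \<le> ?n + 1 then Id (j - 1) else if even (j - ?n)
     then (if j = W - 1 then Ha else Ga) else Fa)" for j
  define v where "v i j = (if j = 0 then (if odd i then Dum else White) else if i = 0 \<or> i = H then White
     else if i = 1 then Sym (init_tape w (j - 1)) else cell_col (odd i) (run M w (i - 2)) (j - 1))" for i j
  define h where "h i j = (if j = 0 \<or> j = W then White else if i = 0 then row0 j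
     else if i = 1 then (if j = 1 then Id 0 else White)
     else if i = H - 1 then (if j = 1 then Id 0 else Fin) else bd M (run M w (i - 2)) (j - 1))" for i j
  have sy: "init_tape w j < nsyms M" for j
    using M by (auto simp: init_tape_def sym_of_def wf_tm_def)
  have good: "good_conf M (run M w t)" for t by (rule good_run[OF M])
  have tile: "(h i j, v i j, h i (Suc j), v (Suc i) j) \<in> tiles M w" if i: "i < H" and j: "j < W" for i j
  proof -
    consider "i = 0" | "i = 1" | "2 \<le> i" "i < H - 1" | "i = H - 1" using i by linarith
    then show ?thesis
    proof cases
      case 1
      show ?thesis
      proof (cases "j = 0")
        case True
        then show ?thesis using 1 W by (simp add: h_def v_def row0_def tiles_White)
      next
        case False
        have "v 1 j = Sym (init_tape w (j - 1))" using False H by (simp add: v_def)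
        moreover have "v 0 j = White" using False by (simp add: v_def)
        moreover have "h 0 j = row0 j" "h 0 (Suc j) = (if Suc j = W then White else row0 (Suc j))"
          using False j by (auto simp: h_def)
        moreover have "(row0 j, White, if Suc j = W then White else row0 (Suc j), Sym (init_tape w (j - 1))) \<in> tiles M w"
        proof (cases "j \<le> ?n")
          case True
          then obtain j' where j': "j = Suc j'" "j' < ?n" using False by (cases j) auto
          then show ?thesis using W by (simp add: row0_def tiles_White init_tape_def)
        next
          case F: False
          show ?thesis
          proof (cases "j = ?n + 1")
            case True
            then show ?thesis using W by (simp add: row0_def tiles_White init_tape_def)
          next
            case F2: False
            define e where "e = j - (?n + 2)"
            have e: "j = ?n + 2 + e" using F F2 by (simp add: e_def)
            have it: "init_tape w (j - 1) = 0" by (simp add: init_tape_def e)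
            show ?thesis
              unfolding it using W by (cases "even e") (auto simp: row0_def tiles_White e)
          qed
        qed
        ultimately show ?thesis using 1 by simp
      qed
    next
      case 2
      show ?thesis
      proof (cases "j = 0")
        case True
        then show ?thesis using 2 W H by (simp add: h_def v_def tiles_Dum)
      next
        case False
        then obtain j' where j': "j = Suc j'" by (cases j) auto
        have "v 1 j = Sym (init_tape w j')" "v 2 j = cell_col False (run M w 0) j'"
          using H j' by (auto simp: v_def)
        moreover have "h 1 j = (if j' = 0 then Id 0 else White)" "h 1 (Suc j) = White"
          using j j' by (auto simp: h_def)
        ultimately show ?thesis
          using 2 sy by (auto simp: tiles_Sym cell_col_def run_0 numeral_2_eq_2)
      qed
    next
      case 3
      let ?c = "run M w (i - 2)"
      have "Suc i - 2 = Suc (i - 2)" using 3 by simp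
      then have st: "run M w (Suc i - 2) = step M ?c" by (simp only: run_Suc)
      have b0: "bd M ?c 0 = Id 0" by (auto simp: bd_def split: prod.splits)
      have b1: "bd M ?c (W - 1) = White" using heads[of "i - 2"] by (auto simp: bd_def split: prod.splits)
      have hi: "h i (Suc j) = bd M ?c j"
      proof (cases "Suc j = W")
        case True
        then show ?thesis using b1 by (simp add: h_def True[symmetric])
      next
        case False
        then show ?thesis using 3 j by (simp add: h_def)
      qed
      show ?thesis
      proof (cases "j = 0")
        case True
        have "h i 0 = White" by (simp add: h_def)
        moreover have "v i 0 = (if odd i then Dum else White)" "v (Suc i) 0 = (if odd i then White else Dum)"
          by (auto simp: v_def)
        ultimately show ?thesis using True hi b0 by (auto simp: tiles_Dum tiles_White)
      next
        case False
        then obtain j' where j': "j = Suc j'" by (cases j) auto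
        have "h i j = bd M ?c j'" using 3 j j' by (simp add: h_def)
        moreover have "i \<noteq> 0" "i \<noteq> 1" "i \<noteq> H" "Suc i \<noteq> H" using 3 by auto
        then have "v i j = cell_col (odd i) ?c j'" "v (Suc i) j = cell_col (\<not> odd i) (step M ?c) j'"
          using j' st by (simp_all add: v_def)
        ultimately show ?thesis using hi j' row_complete[OF M good[of "i - 2"], of j' "odd i" w] by simp
      qed
    next
      case 4
      let ?c = "run M w (H - 3)"
      have i2: "i - 2 = H - 3" "odd i" "Suc i = H" "2 \<le> i" using 4 H by auto
      have g: "cstate ?c < nstates M" "\<And>j. ctape ?c j < nsyms M" using good[of "H - 3"] by (auto simp: good_conf_def)
      show ?thesis
      proof (cases "j = 0")
        case True
        then show ?thesis using 4 i2 W H by (auto simp: h_def v_def tiles_Dum)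
      next
        case False
        then obtain j' where j': "j = Suc j'" by (cases j) auto
        have v1: "v i j = cell_col True ?c j'" using i2 j' by (simp add: v_def)
        have v2: "v (Suc i) j = White" using i2 j' by (simp add: v_def)
        have h1: "h i j = (if j' = 0 then Id 0 else Fin)" using 4 i2 j j' by (auto simp: h_def)
        have h2: "h i (Suc j) = (if Suc j = W then White else Fin)" using 4 i2 j j' by (auto simp: h_def)
        show ?thesis
        proof (cases "j' = chead ?c")
          case True
          then have "Suc j \<noteq> W" using heads[of "H - 3"] j' by auto
          then show ?thesis unfolding v1 v2 h1 h2 using True acc g by (simp add: cell_col_def tiles_head)
        next
          case False
          have "Suc j = W \<longrightarrow> j' \<noteq> 0" using j' W by auto
          then show ?thesis unfolding v1 v2 h1 h2 using False g by (auto simp: cell_col_def tiles_cell)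
        qed
      qed
    qed
  qed
  then have "colored (tiles M w) H W h v"
    unfolding colored_def using H by (auto simp: h_def v_def)
  then show ?thesis by blast
qed

subsection \<open>Running time in bounded space\<close>

lemma run_add: "run M w (m + t) = (step M ^^ m) (run M w t)"
  by (simp add: run_def funpow_add)

lemma halted_stays: "halted (cstate (run M w t)) \<Longrightarrow> run M w (t + m) = run M w t"
proof (induction m)
  case (Suc m)
  obtain q tp h where c: "run M w t = (q, tp, h)" by (rule prod_cases3)
  then show ?case using Suc by (simp add: run_Suc cstate_def)
qed simp

text \<open>The space bound concerns head positions only and may be smaller than the input. Cells
  beyond it are never visited and keep their content, so the part below \<open>S\<close> determines
  the tape.\<close>

lemma ctape_outside:
  assumes "\<And>t. chead (run M w t) < S" "S \<le> j"
  shows "ctape (run M w t) j = init_tape w j"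
proof (induction t)
  case 0
  show ?case by (simp add: run_0)
next
  case (Suc t)
  obtain q tp h where c: "run M w t = (q, tp, h)" by (rule prod_cases3)
  have "h \<noteq> j" using assms(1)[of t] assms(2) c by (simp add: chead_def)
  then show ?case using Suc c by (auto simp: run_Suc ctape_def split: prod.splits)
qed

text \<open>Up to the first halting time all configurations are distinct; the bound counts states,
  tape contents on \<open>S\<close> cells and head positions.\<close>

lemma halting_time:
  assumes M: "wf_tm M" and heads: "\<And>t. chead (run M w t) < S" and halt: "halted (cstate (run M w t))"
  shows "\<exists>t < nstates M * nsyms M ^ S * S. halted (cstate (run M w t))"
proof -
  define t0 where "t0 = (LEAST t. halted (cstate (run M w t)))"
  have t0: "halted (cstate (run M w t0))" unfolding t0_def by (rule LeastI[where P = "\<lambda>t. halted (cstate (run M w t))", OF halt])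
  have least: "\<not> halted (cstate (run M w t))" if "t < t0" for t
    using not_less_Least[of t "\<lambda>t. halted (cstate (run M w t))"] that by (simp add: t0_def)
  \<comment> \<open>If the configurations at times \<open>i < j\<close> were equal, the machine
    would halt \<open>j - i\<close> steps earlier.\<close>
  have neq: "run M w i \<noteq> run M w j" if "i < j" "j \<le> t0" for i j
  proof
    assume eq: "run M w i = run M w j"
    have "run M w (t0 - j + i) = run M w (t0 - j + j)" unfolding run_add eq ..
    then have "halted (cstate (run M w (t0 - j + i)))" using t0 that by simp
    moreover have "t0 - j + i < t0" using that by simp
    ultimately show False using least by blast
  qed
  define f where "f t = (cstate (run M w t), restrict (ctape (run M w t)) {..<S}, chead (run M w t))" for t
  have inj: "inj_on f {..t0}"
  proof (rule inj_onI)
    fix i j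
    assume ij: "i \<in> {..t0}" "j \<in> {..t0}" "f i = f j"
    have "ctape (run M w i) x = ctape (run M w j) x" for x
    proof (cases "x < S")
      case True
      then show ?thesis using ij(3) by (auto simp: f_def restrict_def fun_eq_iff split: if_splits)
    next
      case False
      then show ?thesis using ctape_outside[OF heads] by simp
    qed
    then have "run M w i = run M w j"
      using ij(3) by (cases "run M w i"; cases "run M w j") (auto simp: f_def cstate_def ctape_def chead_def fun_eq_iff)
    then show "i = j" using neq[of i j] neq[of j i] ij by (cases i j rule: linorder_cases) auto
  qed
  let ?X = "{..<nstates M} \<times> ({..<S} \<rightarrow>\<^sub>E {..<nsyms M}) \<times> {..<S}"
  have "restrict (ctape (run M w t)) {..<S} \<in> {..<S} \<rightarrow>\<^sub>E {..<nsyms M}" for t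
    unfolding restrict_PiE_iff using good_run[OF M, of w t] by (simp add: good_conf_def)
  then have sub: "f ` {..t0} \<subseteq> ?X"
    using good_run[OF M] heads unfolding f_def good_conf_def by blast
  have "card {..t0} = card (f ` {..t0})" using card_image[OF inj] by simp
  also have "\<dots> \<le> card ?X" by (rule card_mono[OF _ sub]) (auto intro!: finite_PiE)
  also have "\<dots> = nstates M * nsyms M ^ S * S" by (simp add: card_cartesian_product card_PiE)
  finally have "t0 < nstates M * nsyms M ^ S * S" by simp
  then show ?thesis using t0 by blast
qed

section \<open>Encoding the colours\<close>

definition used_cols :: "tm \<Rightarrow> col set" where
  "used_cols M = {White, Dum, Fin, Ga, Fa, Ha} \<union> Rt ` {..<nstates M} \<union> Lt ` {..<nstates M} \<union> Sym ` {..<nsyms M} \<union>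
     (\<Union>p. \<Union>m. \<Union>q \<in> insert None (Some ` {..<nstates M}). Cell p m q ` {..<nsyms M})"

definition all_cols :: "tm \<Rightarrow> col set" where
  "all_cols M = used_cols M \<union> range Id"

lemma finite_used_cols: "finite (used_cols M)"
  by (auto simp: used_cols_def)

lemma all_cols_simps [simp]:
  "White \<in> all_cols M" "Dum \<in> all_cols M" "Fin \<in> all_cols M" "Ga \<in> all_cols M" "Fa \<in> all_cols M"
  "Ha \<in> all_cols M" "Id j \<in> all_cols M"
  "Rt q \<in> all_cols M \<longleftrightarrow> q < nstates M" "Lt q \<in> all_cols M \<longleftrightarrow> q < nstates M"
  "Sym a \<in> all_cols M \<longleftrightarrow> a < nsyms M"
  "Cell p m None a \<in> all_cols M \<longleftrightarrow> a < nsyms M"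
  "Cell p m (Some q) a \<in> all_cols M \<longleftrightarrow> q < nstates M \<and> a < nsyms M"
  by (auto simp: all_cols_def used_cols_def) blast

lemma fixed_tiles_cols:
  assumes "wf_tm M" "(l, t, r, b) \<in> fixed_tiles M"
  shows "l \<in> all_cols M \<and> t \<in> all_cols M \<and> r \<in> all_cols M \<and> b \<in> all_cols M"
proof -
  have M: "0 < nsyms M" "0 < nstates M" "1 < nstates M"
    using assms(1) by (auto simp: wf_tm_def)
  have d: "q' < nstates M \<and> a' < nsyms M" if "q < nstates M" "a < nsyms M" "delta M q a = (q', a', d)" for q a q' a' d
  proof -
    have "case delta M q a of (q', a', d) \<Rightarrow> q' < nstates M \<and> a' < nsyms M"
      by (rule assms(1)[unfolded wf_tm_def, THEN conjunct2, THEN conjunct2, rule_format, OF that(1,2)])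
    then show ?thesis using that(3) by simp
  qed
  from assms(2) show ?thesis
  proof cases
    case (head_right a q q' a' p m)
    then show ?thesis using d[of q a q' a' MoveR] by simp
  next
    case (head_stay a q q' a' e m p)
    then show ?thesis using d[of q a q' a' e] by simp
  next
    case (head_left a q q' a' p)
    then show ?thesis using d[of q a q' a' MoveL] by simp
  qed (use M in simp_all)
qed

lemma tiles_cols:
  assumes "wf_tm M" "(l, t, r, b) \<in> tiles M w"
  shows "l \<in> all_cols M \<and> t \<in> all_cols M \<and> r \<in> all_cols M \<and> b \<in> all_cols M"
proof -
  have M: "0 < nsyms M" "sym_of b < nsyms M" for b
    using assms(1) by (auto simp: wf_tm_def sym_of_def)
  show ?thesis
    using assms fixed_tiles_cols[OF assms(1), of l t r b] M
    by (auto simp: tiles_def letter_tile_def end_tile_def)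
qed

lemma finite_fixed_tiles:
  assumes "wf_tm M"
  shows "finite (fixed_tiles M)"
proof (rule finite_subset)
  let ?X = "insert (Id 0) (used_cols M)"
  show "finite (?X \<times> ?X \<times> ?X \<times> ?X)" using finite_used_cols by simp
  have "l \<in> ?X \<and> t \<in> ?X \<and> r \<in> ?X \<and> b \<in> ?X" if t: "(l, t, r, b) \<in> fixed_tiles M" for l t r b
  proof -
    define Q where "Q x \<longleftrightarrow> (\<forall>j. x = Id j \<longrightarrow> j = 0)" for x
    have X: "x \<in> ?X" if "x \<in> all_cols M" "Q x" for x
      using that unfolding all_cols_def Q_def by auto
    have i: "Q l \<and> Q t \<and> Q r \<and> Q b"
      using t by cases (simp_all add: Q_def)
    show ?thesis
      by (intro conjI X) (use fixed_tiles_cols[OF assms t] i in \<open>simp_all only:\<close>)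
  qed
  then have X: "(l, t, r, b) \<in> ?X \<times> ?X \<times> ?X \<times> ?X" if "(l, t, r, b) \<in> fixed_tiles M" for l t r b
    unfolding mem_Times_iff fst_conv snd_conv using that .
  show "fixed_tiles M \<subseteq> ?X \<times> ?X \<times> ?X \<times> ?X"
  proof (rule subsetI)
    fix x
    assume "x \<in> fixed_tiles M"
    then show "x \<in> ?X \<times> ?X \<times> ?X \<times> ?X" using X by (cases x) (simp only:)
  qed
qed

text \<open>The colours \<open>Id j\<close> grow in number with the input. As powers of two they
  have codes that a stack program writes from a unary counter; the offset \<open>a\<close> moves
  them beyond the finitely many other colours.\<close>

definition enc_col :: "nat \<Rightarrow> (col \<Rightarrow> nat) \<Rightarrow> col \<Rightarrow> nat" where
  "enc_col a g c = (case c of Id j \<Rightarrow> 2 ^ (a + j) | _ \<Rightarrow> g c)"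

lemma enc_col_Id: "enc_col a g (Id j) = 2 ^ (a + j)"
  by (simp add: enc_col_def)

lemma enc_col_exists:
  "\<exists>a g. inj_on (enc_col a g) (all_cols M) \<and> enc_col a g White = 0"
proof -
  obtain g :: "col \<Rightarrow> nat" where g: "inj_on g (used_cols M)" "g White = 0"
    using finite_inj_prescribed[OF finite_used_cols[of M], of White White White] by blast
  define a where "a = Max (g ` used_cols M) + 1"
  have ga: "g c < 2 ^ (a + j)" if "c \<in> used_cols M" for c j
  proof -
    have "g c \<le> Max (g ` used_cols M)" using that finite_used_cols by simp
    also have "\<dots> < a" by (simp add: a_def)
    also have "a < 2 ^ a" by (rule less_exp)
    also have "(2::nat) ^ a \<le> 2 ^ (a + j)" by (rule power_increasing) auto
    finally show ?thesis .
  qed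
  have noId: "Id j \<notin> used_cols M" for j by (auto simp: used_cols_def)
  have u: "enc_col a g c = g c" if "c \<in> used_cols M" for c
    using that noId by (auto simp: enc_col_def split: col.split)
  have "inj_on (enc_col a g) (all_cols M)"
  proof (rule inj_onI)
    fix x y
    assume xy: "x \<in> all_cols M" "y \<in> all_cols M" "enc_col a g x = enc_col a g y"
    show "x = y"
    proof (cases "x \<in> used_cols M"; cases "y \<in> used_cols M")
      assume "x \<in> used_cols M" "y \<in> used_cols M"
      then show ?thesis using xy(3) u g(1) by (auto dest: inj_onD)
    next
      assume c: "x \<in> used_cols M" "y \<notin> used_cols M"
      then obtain j where "y = Id j" using xy(2) by (auto simp: all_cols_def)
      then show ?thesis using xy(3) u[OF c(1)] ga[OF c(1), of j] by (simp add: enc_col_Id)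
    next
      assume c: "x \<notin> used_cols M" "y \<in> used_cols M"
      then obtain j where "x = Id j" using xy(1) by (auto simp: all_cols_def)
      then show ?thesis using xy(3) u[OF c(2)] ga[OF c(2), of j] by (simp add: enc_col_Id)
    next
      assume "x \<notin> used_cols M" "y \<notin> used_cols M"
      then show ?thesis using xy by (auto simp: all_cols_def enc_col_Id)
    qed
  qed
  moreover have "enc_col a g White = 0" using g(2) by (simp add: enc_col_def)
  ultimately show ?thesis by blast
qed

fun map_tile :: "(col \<Rightarrow> nat) \<Rightarrow> col \<times> col \<times> col \<times> col \<Rightarrow> tile" where
  "map_tile \<iota> (l, t, r, b) = (\<iota> l, \<iota> t, \<iota> r, \<iota> b)"

lemma tiling_colored:
  assumes inj: "inj_on \<iota> X" and T: "\<And>l t r b. (l, t, r, b) \<in> T \<Longrightarrow> l \<in> X \<and> t \<in> X \<and> r \<in> X \<and> b \<in> X"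
    and W0: "White \<in> X" "\<iota> White = 0" and H: "1 \<le> H" and W: "1 \<le> W"
  shows "(\<exists>\<tau>. is_tiling (map_tile \<iota> ` T) H W \<tau>) \<longleftrightarrow> (\<exists>h v. colored T H W h v)"
proof
  assume "\<exists>h v. colored T H W h v"
  then obtain h v where c: "colored T H W h v" by blast
  define \<tau> where "\<tau> i j = map_tile \<iota> (h (i - 1) (j - 1), v (i - 1) (j - 1), h (i - 1) j, v i (j - 1))" for i j
  have "\<tau> i j \<in> map_tile \<iota> ` T" if ij: "i \<in> {1..H}" "j \<in> {1..W}" for i j
  proof -
    obtain i' j' where "i = Suc i'" "j = Suc j'" using ij by (cases i; cases j) auto
    then show ?thesis using c ij unfolding \<tau>_def colored_def by (intro imageI) simp
  qed
  then have "is_tiling (map_tile \<iota> ` T) H W \<tau>"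
    unfolding is_tiling_def using c W0 H W by (auto simp: \<tau>_def colored_def white_def)
  then show "\<exists>\<tau>. is_tiling (map_tile \<iota> ` T) H W \<tau>" by blast
next
  assume "\<exists>\<tau>. is_tiling (map_tile \<iota> ` T) H W \<tau>"
  then obtain \<tau> where \<tau>: "is_tiling (map_tile \<iota> ` T) H W \<tau>" by blast
  have "\<forall>i j. \<exists>l t r b. i < H \<and> j < W \<longrightarrow> (l, t, r, b) \<in> T \<and> \<tau> (Suc i) (Suc j) = (\<iota> l, \<iota> t, \<iota> r, \<iota> b)"
  proof (intro allI)
    fix i j
    show "\<exists>l t r b. i < H \<and> j < W \<longrightarrow> (l, t, r, b) \<in> T \<and> \<tau> (Suc i) (Suc j) = (\<iota> l, \<iota> t, \<iota> r, \<iota> b)"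
    proof (cases "i < H \<and> j < W")
      case True
      then have "\<tau> (Suc i) (Suc j) \<in> map_tile \<iota> ` T" using \<tau> by (simp add: is_tiling_def)
      then obtain l t r b where "(l, t, r, b) \<in> T" "\<tau> (Suc i) (Suc j) = (\<iota> l, \<iota> t, \<iota> r, \<iota> b)" by auto
      then show ?thesis by blast
    qed blast
  qed
  then obtain L P R B where t: "\<And>i j. i < H \<Longrightarrow> j < W \<Longrightarrow> (L i j, P i j, R i j, B i j) \<in> T"
    "\<And>i j. i < H \<Longrightarrow> j < W \<Longrightarrow> \<tau> (Suc i) (Suc j) = (\<iota> (L i j), \<iota> (P i j), \<iota> (R i j), \<iota> (B i j))"
    by metis
  note X = T[OF t(1)]
  have eq: "x = y" if "\<iota> x = \<iota> y" "x \<in> X" "y \<in> X" for x y using inj that by (auto dest: inj_onD)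
  have Lz: "L i 0 = White" if "i < H" for i
  proof (rule eq)
    have "tleft (\<tau> (Suc i) 1) = 0" using \<tau> that by (simp add: is_tiling_def white_def)
    then show "\<iota> (L i 0) = \<iota> White" using t(2)[of i 0] that W W0 by simp
  qed (use X[of i 0] that W W0 in auto)
  have Rz: "R i (W - 1) = White" if "i < H" for i
  proof (rule eq)
    obtain W' where W': "W = Suc W'" using W by (cases W) auto
    then have "tright (\<tau> (Suc i) (Suc W')) = 0" using \<tau> that by (simp add: is_tiling_def white_def)
    then show "\<iota> (R i (W - 1)) = \<iota> White" using t(2)[of i W'] that W' W0 by simp
  qed (use X[of i "W - 1"] that W W0 in auto)
  have Pz: "P 0 j = White" if "j < W" for j
  proof (rule eq)
    have "ttop (\<tau> 1 (Suc j)) = 0" using \<tau> that by (simp add: is_tiling_def white_def)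
    then show "\<iota> (P 0 j) = \<iota> White" using t(2)[of 0 j] that H W0 by simp
  qed (use X[of 0 j] that H W0 in auto)
  have Bz: "B (H - 1) j = White" if "j < W" for j
  proof (rule eq)
    obtain H' where H': "H = Suc H'" using H by (cases H) auto
    then have "tbottom (\<tau> (Suc H') (Suc j)) = 0" using \<tau> that by (simp add: is_tiling_def white_def)
    then show "\<iota> (B (H - 1) j) = \<iota> White" using t(2)[of H' j] that H' W0 by simp
  qed (use X[of "H - 1" j] that H W0 in auto)
  have LR: "R i j = L i (Suc j)" if "i < H" "Suc j < W" for i j
  proof (rule eq)
    have "tright (\<tau> (Suc i) (Suc j)) = tleft (\<tau> (Suc i) (Suc (Suc j)))" using \<tau> that by (simp add: is_tiling_def)
    then show "\<iota> (R i j) = \<iota> (L i (Suc j))" using t(2)[of i j] t(2)[of i "Suc j"] that by simp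
  qed (use X[of i j] X[of i "Suc j"] that in auto)
  have PB: "B i j = P (Suc i) j" if "Suc i < H" "j < W" for i j
  proof (rule eq)
    have "tbottom (\<tau> (Suc i) (Suc j)) = ttop (\<tau> (Suc (Suc i)) (Suc j))" using \<tau> that by (simp add: is_tiling_def)
    then show "\<iota> (B i j) = \<iota> (P (Suc i) j)" using t(2)[of i j] t(2)[of "Suc i" j] that by simp
  qed (use X[of i j] X[of "Suc i" j] that in auto)
  define h where "h i j = (if j = 0 then White else R i (j - 1))" for i j
  define v where "v i j = (if i = 0 then White else B (i - 1) j)" for i j
  have "h i j = L i j" if "i < H" "j < W" for i j
    using Lz LR that by (cases j) (auto simp: h_def)
  moreover have "v i j = P i j" if "i < H" "j < W" for i j
    using Pz PB that by (cases i) (auto simp: v_def)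
  ultimately have "colored T H W h v"
    unfolding colored_def using t(1) Rz Bz H W by (auto simp: h_def v_def)
  then show "\<exists>h v. colored T H W h v" by blast
qed

lemma deterministic_tiles:
  assumes M: "wf_tm M" and inj: "inj_on \<iota> (all_cols M)" and W0: "\<iota> White = 0"
  shows "deterministic (map_tile \<iota> ` tiles M w)"
proof -
  define Col where "Col = \<iota> ` {c \<in> all_cols M. in_Col c}"
  have iC: "\<iota> c \<in> Col \<longleftrightarrow> in_Col c" if "c \<in> all_cols M" for c
    using inj that unfolding Col_def by (auto dest: inj_onD)
  have eq: "x = y" if "\<iota> x = \<iota> y" "x \<in> all_cols M" "y \<in> all_cols M" for x y
    using inj that by (auto dest: inj_onD)
  note X = tiles_cols[OF M]
  show ?thesis
    unfolding deterministic_def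
  proof (intro exI[of _ Col] conjI ballI allI impI)
    show "white \<in> Col" using iC[of White] W0 by (simp add: white_def)
  next
    fix t
    assume "t \<in> map_tile \<iota> ` tiles M w"
    then obtain l p r b where t: "(l, p, r, b) \<in> tiles M w" "t = map_tile \<iota> (l, p, r, b)" by auto
    then show "ttop t \<in> Col \<longleftrightarrow> tbottom t \<notin> Col" using X[OF t(1)] iC tiles_alternate[OF t(1)] by simp
  next
    fix c c' t1 t2
    assume a: "c \<in> Col" "t1 \<in> map_tile \<iota> ` tiles M w" "t2 \<in> map_tile \<iota> ` tiles M w"
      "tleft t1 = c \<and> ttop t1 = c' \<and> tleft t2 = c \<and> ttop t2 = c'"
    obtain l p r b where t1: "(l, p, r, b) \<in> tiles M w" "t1 = map_tile \<iota> (l, p, r, b)" using a(2) by auto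
    obtain l' p' r' b' where t2: "(l', p', r', b') \<in> tiles M w" "t2 = map_tile \<iota> (l', p', r', b')" using a(3) by auto
    have "l' = l" "p' = p" using a(4) t1 t2 X[OF t1(1)] X[OF t2(1)] by (auto intro: eq)
    moreover have "in_Col l" using a(1,4) t1 X[OF t1(1)] iC[of l] by auto
    ultimately show "t1 = t2" using tiles_det_left[OF t1(1), of r' b'] t1 t2 by simp
  next
    fix c c' t1 t2
    assume a: "c \<in> - Col" "t1 \<in> map_tile \<iota> ` tiles M w" "t2 \<in> map_tile \<iota> ` tiles M w"
      "tright t1 = c \<and> ttop t1 = c' \<and> tright t2 = c \<and> ttop t2 = c'"
    obtain l p r b where t1: "(l, p, r, b) \<in> tiles M w" "t1 = map_tile \<iota> (l, p, r, b)" using a(2) by auto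
    obtain l' p' r' b' where t2: "(l', p', r', b') \<in> tiles M w" "t2 = map_tile \<iota> (l', p', r', b')" using a(3) by auto
    have "r' = r" "p' = p" using a(4) t1 t2 X[OF t1(1)] X[OF t2(1)] by (auto intro: eq)
    moreover have "\<not> in_Col r" using a(1,4) t1 X[OF t1(1)] iC[of r] by auto
    ultimately show "t1 = t2" using tiles_det_right[OF t1(1), of l' b'] t1 t2 by simp
  qed
qed

section \<open>Unique decoding of instances\<close>

lemma no_marker: "enc_tile t @ v \<noteq> False # True # u" "False # True # u \<noteq> enc_tile t @ v"
proof -
  obtain l p r b where t: "t = (l, p, r, b)" by (cases t)
  have "enc_nat l @ x \<noteq> False # True # u" for x
    by (cases "l = 0") (auto simp: enc_nat_0 enc_nat_pos)
  then show 1: "enc_tile t @ v \<noteq> False # True # u" by (simp add: t)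
  then show "False # True # u \<noteq> enc_tile t @ v" by metis
qed

lemma enc_tiles_inj:
  "concat (map enc_tile Ts) @ False # True # u = concat (map enc_tile Ts') @ False # True # u' \<Longrightarrow> Ts = Ts' \<and> u = u'"
proof (induction Ts arbitrary: Ts')
  case Nil
  then show ?case by (cases Ts') (auto simp: no_marker)
next
  case (Cons t Ts)
  show ?case
  proof (cases Ts')
    case Nil
    then show ?thesis using Cons.prems by (simp add: no_marker)
  next
    case (Cons t' Ts'')
    then have "enc_tile t @ (concat (map enc_tile Ts) @ False # True # u) = enc_tile t' @ (concat (map enc_tile Ts'') @ False # True # u')"
      using Cons.prems by simp
    from enc_tile_prefix[OF this] show ?thesis using Cons.IH Cons by blast
  qed
qed

text \<open>An encoded number starts with \<open>True\<close> or with two \<open>False\<close>, so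
  the separator cannot be mistaken for a tile. Uniqueness matters because membership in the
  languages only asks for some decoding of the word.\<close>

lemma enc_inst_inj: "enc_inst n Ts t = enc_inst n' Ts' t' \<Longrightarrow> n = n' \<and> Ts = Ts'"
proof -
  assume e: "enc_inst n Ts t = enc_inst n' Ts' t'"
  have r: "replicate n True @ False # u = replicate n' True @ False # u' \<Longrightarrow> n = n' \<and> u = u'" for u u'
  proof (induction n arbitrary: n')
    case 0
    then show ?case by (cases n') auto
  next
    case (Suc n)
    then show ?case by (cases n') auto
  qed
  have "n = n' \<and> concat (map enc_tile Ts) @ False # True # enc_tile t = concat (map enc_tile Ts') @ False # True # enc_tile t'"
    by (rule r) (use e in \<open>simp add: enc_inst_def\<close>)
  then show ?thesis using enc_tiles_inj by blast
qed

section \<open>The reduction program\<close>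

text \<open>Only time is counted here; the stack height follows by
  \<open>exec_space_le_time\<close>.\<close>

definition runs :: "nat \<Rightarrow> com \<Rightarrow> stacks \<Rightarrow> stacks \<Rightarrow> bool" where
  "runs T c \<sigma> \<sigma>' \<longleftrightarrow> (\<exists>t \<le> T. exec None c \<sigma> t \<sigma>')"

lemma runs_Skip: "runs 1 Skip \<sigma> \<sigma>"
  unfolding runs_def by (intro exI[of _ "Suc 0"]) (auto intro: exec_Skip)

lemma runs_Push: "\<sigma>(r := b # \<sigma> r) = \<sigma>' \<Longrightarrow> runs 1 (Push r b) \<sigma> \<sigma>'"
  unfolding runs_def by (intro exI[of _ "Suc 0"]) (auto intro!: exec_Push simp: fits_def)

lemma runs_Pop: "\<sigma>(r := tl (\<sigma> r)) = \<sigma>' \<Longrightarrow> runs 1 (Pop r) \<sigma> \<sigma>'"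
  unfolding runs_def by (intro exI[of _ "Suc 0"]) (auto intro!: exec_Pop)

lemma runs_Seq: "runs T c \<sigma> \<sigma>' \<Longrightarrow> runs U d \<sigma>' \<sigma>'' \<Longrightarrow> runs (T + U + 1) (c ;; d) \<sigma> \<sigma>''"
  unfolding runs_def
proof (elim exE conjE)
  fix t u
  assume "t \<le> T" "u \<le> U" "exec None c \<sigma> t \<sigma>'" "exec None d \<sigma>' u \<sigma>''"
  then show "\<exists>t \<le> T + U + 1. exec None (c ;; d) \<sigma> t \<sigma>''"
    by (intro exI[of _ "Suc (t + u)"]) (auto intro: exec_Seq)
qed

lemma runs_mono: "runs T c \<sigma> \<sigma>' \<Longrightarrow> T \<le> U \<Longrightarrow> runs U c \<sigma> \<sigma>'"
  unfolding runs_def by (elim exE conjE, rule exI, rule conjI, erule (1) order_trans)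

lemma runs_drain:
  assumes body: "\<And>pre x ys. xs = pre @ x # ys \<Longrightarrow>
      runs T (if x then cT else cF) ((S pre (x # ys))(r := ys)) (S (pre @ [x]) ys)"
    and r: "\<And>pre ys. S pre ys r = ys"
  shows "runs (length xs * (T + 4) + 1) (drain r cF cT) (S [] xs) (S xs [])"
proof -
  have "xs = pre @ ys \<Longrightarrow> runs (length ys * (T + 4) + 1) (drain r cF cT) (S pre ys) (S xs [])" for pre ys
  proof (induction ys arbitrary: pre)
    case Nil
    have "exec None (drain r cF cT) (S pre []) (Suc 0) (S pre [])"
      unfolding drain_def by (rule exec_While_Nil) (simp add: r)
    then show ?case unfolding runs_def using Nil by (intro exI[of _ "Suc 0"]) simp
  next
    case (Cons x ys)
    obtain t where t: "t \<le> T" "exec None (if x then cT else cF) ((S pre (x # ys))(r := ys)) t (S (pre @ [x]) ys)"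
      using body[OF Cons.prems] by (auto simp: runs_def)
    obtain u where u: "u \<le> length ys * (T + 4) + 1" "exec None (drain r cF cT) (S (pre @ [x]) ys) u (S xs [])"
      using Cons.IH[of "pre @ [x]"] Cons.prems by (auto simp: runs_def)
    have "exec None (Pop r) (S pre (x # ys)) (Suc 0) ((S pre (x # ys))(r := ys))"
      using exec_Pop[of None r "S pre (x # ys)"] r by simp
    note sq = exec_Seq[OF this t(2)]
    have "exec None (If3 r Skip (Pop r ;; cF) (Pop r ;; cT)) (S pre (x # ys)) (Suc (Suc (Suc 0 + t))) (S (pre @ [x]) ys)"
    proof (cases x)
      case True
      then show ?thesis using exec_If_True[of "S pre (x # ys)" r ys] sq r by simp
    next
      case False
      then show ?thesis using exec_If_False[of "S pre (x # ys)" r ys] sq r by simp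
    qed
    from exec_While[OF _ this u(2)[unfolded drain_def]]
    have "exec None (drain r cF cT) (S pre (x # ys)) (Suc (Suc (Suc (Suc 0 + t)) + u)) (S xs [])"
      unfolding drain_def using r by simp
    moreover have "Suc (Suc (Suc (Suc 0 + t)) + u) \<le> length (x # ys) * (T + 4) + 1"
      using t(1) u(1) by simp
    ultimately show ?case unfolding runs_def by blast
  qed
  then show ?thesis by blast
qed

fun pushs :: "nat \<Rightarrow> bool list \<Rightarrow> com" where
  "pushs r [] = Skip"
| "pushs r (x # xs) = pushs r xs ;; Push r x"

lemma runs_pushs: "\<sigma>(r := xs @ \<sigma> r) = \<sigma>' \<Longrightarrow> runs (2 * length xs + 1) (pushs r xs) \<sigma> \<sigma>'"
proof (induction xs arbitrary: \<sigma>')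
  case Nil
  then show ?case using runs_Skip[of \<sigma>] by simp
next
  case (Cons x xs)
  have "runs (2 * length xs + 1) (pushs r xs) \<sigma> (\<sigma>(r := xs @ \<sigma> r))"
    by (rule Cons.IH) simp
  moreover have "runs 1 (Push r x) (\<sigma>(r := xs @ \<sigma> r)) \<sigma>'"
    by (rule runs_Push) (use Cons.prems in auto)
  ultimately have "runs (2 * length xs + 1 + 1 + 1) (pushs r xs ;; Push r x) \<sigma> \<sigma>'"
    by (rule runs_Seq)
  then show ?case by simp
qed

lemma enc_nat_power: "enc_nat (2 ^ m) = concat (replicate m [True, False]) @ [True, True, False, False]"
proof (induction m)
  case 0
  then show ?case by (simp add: enc_nat_pos enc_nat_0)
next
  case (Suc m)
  have "enc_nat (2 ^ Suc m) = True # odd (2 ^ Suc m :: nat) # enc_nat (2 ^ Suc m div 2)"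
    by (rule enc_nat_pos) simp
  then show ?case using Suc by simp
qed

text \<open>The exponent is \<open>a\<close> plus the unary content of stack 4, which is parked on
  stack 5 and moved back. Output grows to the left, so the repeated blocks of
  \<open>enc_nat_power\<close> are pushed after the fixed tail.\<close>

definition emit_id :: "nat \<Rightarrow> com" where
  "emit_id a = pushs 0 (enc_nat (2 ^ a)) ;;
     drain 4 Skip (pushs 0 [True, False] ;; Push 5 True) ;; drain 5 Skip (Push 4 True)"

lemma runs_emit_id:
  assumes "\<sigma> 4 = replicate u True" "\<sigma> 5 = []"
  shows "runs (16 * u + 2 * length (enc_nat (2 ^ a)) + 10) (emit_id a) \<sigma> (\<sigma>(0 := enc_nat (2 ^ (a + u)) @ \<sigma> 0))"
proof -
  let ?a = "\<sigma>(0 := enc_nat (2 ^ a) @ \<sigma> 0)"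
  have 1: "runs (2 * length (enc_nat (2 ^ a)) + 1) (pushs 0 (enc_nat (2 ^ a))) \<sigma> ?a"
    by (rule runs_pushs) simp
  let ?S = "\<lambda>(pre :: bool list) ys. \<sigma>(0 := concat (replicate (length pre) [True, False]) @ enc_nat (2 ^ a) @ \<sigma> 0,
      4 := ys, 5 := replicate (length pre) True)"
  have 2: "runs (length (replicate u True) * (7 + 4) + 1) (drain 4 Skip (pushs 0 [True, False] ;; Push 5 True))
     (?S [] (replicate u True)) (?S (replicate u True) [])"
  proof (rule runs_drain[where S = ?S])
    fix pre x ys
    assume xs: "replicate u True = pre @ x # ys"
    have "x \<in> set (replicate u True)" unfolding xs by simp
    then have x: "x" by (simp split: if_splits)
    have "runs (5 + 1 + 1) (pushs 0 [True, False] ;; Push 5 True) ((?S pre (x # ys))(4 := ys)) (?S (pre @ [x]) ys)"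
      by (rule runs_Seq[OF runs_mono[OF runs_pushs[OF refl]] runs_Push]) (auto simp: fun_eq_iff)
    then show "runs 7 (if x then pushs 0 [True, False] ;; Push 5 True else Skip)
        ((?S pre (x # ys))(4 := ys)) (?S (pre @ [x]) ys)"
      using x by simp
  qed simp
  let ?R = "\<lambda>(pre :: bool list) ys. \<sigma>(0 := concat (replicate u [True, False]) @ enc_nat (2 ^ a) @ \<sigma> 0,
      4 := replicate (length pre) True, 5 := ys)"
  have 3: "runs (length (replicate u True) * (1 + 4) + 1) (drain 5 Skip (Push 4 True))
     (?R [] (replicate u True)) (?R (replicate u True) [])"
  proof (rule runs_drain[where S = ?R])
    fix pre x ys
    assume xs: "replicate u True = pre @ x # ys"
    have "x \<in> set (replicate u True)" unfolding xs by simp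
    then have x: "x" by (simp split: if_splits)
    have "runs 1 (Push 4 True) ((?R pre (x # ys))(5 := ys)) (?R (pre @ [x]) ys)"
      by (rule runs_Push) (auto simp: fun_eq_iff)
    then show "runs 1 (if x then Push 4 True else Skip) ((?R pre (x # ys))(5 := ys)) (?R (pre @ [x]) ys)"
      using x by simp
  qed simp
  have e1: "?S [] (replicate u True) = ?a" using assms by (auto simp: fun_eq_iff)
  have e2: "?S (replicate u True) [] = ?R [] (replicate u True)" by (auto simp: fun_eq_iff)
  have e3: "?R (replicate u True) [] = \<sigma>(0 := enc_nat (2 ^ (a + u)) @ \<sigma> 0)"
  proof -
    have "enc_nat (2 ^ (a + u)) = concat (replicate u [True, False]) @ enc_nat (2 ^ a)"
      unfolding enc_nat_power by (simp add: add.commute[of a u] replicate_add)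
    then show ?thesis using assms by (auto simp: fun_eq_iff)
  qed
  from runs_Seq[OF 1 runs_Seq[OF 2[unfolded e1 e2] 3[unfolded e3]]]
  show ?thesis unfolding emit_id_def by (rule runs_mono) simp
qed

text \<open>Nested loops: stack 6 keeps \<open>m\<close> in unary, stack \<open>7 + d\<close> is the
  counter of the loop that encloses \<open>power_loop d\<close>, stack 5 serves for copying. The
  \<open>m ^ d\<close> pushes create a unary number.\<close>

fun power_loop :: "nat \<Rightarrow> com" where
  "power_loop 0 = Push 0 True"
| "power_loop (Suc d) = drain 6 Skip (Push 5 True) ;;
     drain 5 Skip (Push 6 True ;; Push (7 + d) True) ;; drain (7 + d) Skip (power_loop d)"

fun power_time :: "nat \<Rightarrow> nat \<Rightarrow> nat" where
  "power_time 0 m = 1"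
| "power_time (Suc d) m = m * (power_time d m + 16) + 5"

lemma runs_power_loop:
  "\<sigma> 6 = replicate m True \<Longrightarrow> \<sigma> 5 = [] \<Longrightarrow> (\<And>i. i < d \<Longrightarrow> \<sigma> (7 + i) = []) \<Longrightarrow>
    runs (power_time d m) (power_loop d) \<sigma> (\<sigma>(0 := replicate (m ^ d) True @ \<sigma> 0))"
proof (induction d arbitrary: \<sigma>)
  case 0
  show ?case unfolding power_loop.simps power_time.simps by (rule runs_Push) (simp add: fun_eq_iff)
next
  case (Suc d)
  have tr: "x" if "replicate m True = pre @ x # ys" for pre x ys
  proof -
    have "x \<in> set (replicate m True)" unfolding that by simp
    then show ?thesis by (simp split: if_splits)
  qed
  let ?A = "\<lambda>(pre :: bool list) ys. \<sigma>(6 := ys, 5 := replicate (length pre) True)"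
  have 1: "runs (length (replicate m True) * (1 + 4) + 1) (drain 6 Skip (Push 5 True))
     (?A [] (replicate m True)) (?A (replicate m True) [])"
  proof (rule runs_drain[where S = ?A])
    fix pre x ys
    assume xs: "replicate m True = pre @ x # ys"
    have "runs 1 (Push 5 True) ((?A pre (x # ys))(6 := ys)) (?A (pre @ [x]) ys)"
      by (rule runs_Push) (auto simp: fun_eq_iff)
    then show "runs 1 (if x then Push 5 True else Skip) ((?A pre (x # ys))(6 := ys)) (?A (pre @ [x]) ys)"
      using tr[OF xs] by simp
  qed simp
  let ?B = "\<lambda>(pre :: bool list) ys. \<sigma>(6 := replicate (length pre) True, 5 := ys, 7 + d := replicate (length pre) True)"
  have 2: "runs (length (replicate m True) * (3 + 4) + 1) (drain 5 Skip (Push 6 True ;; Push (7 + d) True))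
     (?B [] (replicate m True)) (?B (replicate m True) [])"
  proof (rule runs_drain[where S = ?B])
    fix pre x ys
    assume xs: "replicate m True = pre @ x # ys"
    have "runs (1 + 1 + 1) (Push 6 True ;; Push (7 + d) True) ((?B pre (x # ys))(5 := ys)) (?B (pre @ [x]) ys)"
      by (rule runs_Seq[OF runs_Push[OF refl] runs_Push]) (auto simp: fun_eq_iff)
    from runs_mono[OF this, of 3] show "runs 3 (if x then Push 6 True ;; Push (7 + d) True else Skip)
        ((?B pre (x # ys))(5 := ys)) (?B (pre @ [x]) ys)"
      using tr[OF xs] by simp
  qed simp
  let ?C = "\<lambda>(pre :: bool list) ys. \<sigma>(7 + d := ys, 0 := replicate (length pre * m ^ d) True @ \<sigma> 0)"
  have 3: "runs (length (replicate m True) * (power_time d m + 4) + 1) (drain (7 + d) Skip (power_loop d))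
     (?C [] (replicate m True)) (?C (replicate m True) [])"
  proof (rule runs_drain[where S = ?C])
    fix pre x ys
    assume xs: "replicate m True = pre @ x # ys"
    let ?s = "(?C pre (x # ys))(7 + d := ys)"
    have "runs (power_time d m) (power_loop d) ?s (?s(0 := replicate (m ^ d) True @ ?s 0))"
      by (rule Suc.IH) (use Suc.prems in auto)
    moreover have "?s(0 := replicate (m ^ d) True @ ?s 0) = ?C (pre @ [x]) ys"
      by (auto simp: fun_eq_iff replicate_add)
    ultimately show "runs (power_time d m) (if x then power_loop d else Skip) ?s (?C (pre @ [x]) ys)"
      using tr[OF xs] by (simp del: fun_upd_apply)
  qed simp
  have e1: "?A [] (replicate m True) = \<sigma>" using Suc.prems by (auto simp: fun_eq_iff)
  have e2: "?A (replicate m True) [] = ?B [] (replicate m True)" using Suc.prems by (auto simp: fun_eq_iff)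
  have e3: "?B (replicate m True) [] = ?C [] (replicate m True)" using Suc.prems by (auto simp: fun_eq_iff)
  have e4: "?C (replicate m True) [] = \<sigma>(0 := replicate (m ^ Suc d) True @ \<sigma> 0)"
    using Suc.prems(3)[of d] by (auto simp: fun_eq_iff)
  from runs_Seq[OF 1[unfolded e1 e2] runs_Seq[OF 2[unfolded e3] 3[unfolded e4]]]
  show ?case unfolding power_loop.simps by (rule runs_mono) (simp add: algebra_simps)
qed

text \<open>Stack 0 is emptied first and then receives the output from right to left.\<close>

definition reduction :: "nat \<Rightarrow> (bool \<Rightarrow> bool list) \<Rightarrow> bool list \<Rightarrow> bool list \<Rightarrow> nat \<Rightarrow> nat \<Rightarrow> com" where
  "reduction a sy post pre c D =
     drain 0 (Push 3 False ;; Push 4 True ;; Push 6 True) (Push 3 True ;; Push 4 True ;; Push 6 True) ;;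
     pushs 0 post ;; emit_id a ;;
     drain 3 (pushs 0 (sy False) ;; emit_id a ;; pushs 0 [False, False] ;; Pop 4 ;; emit_id a)
             (pushs 0 (sy True) ;; emit_id a ;; pushs 0 [False, False] ;; Pop 4 ;; emit_id a) ;;
     pushs 0 pre ;; pushs 6 (replicate c True) ;; power_loop D ;; clear 6"

text \<open>\<open>[False, False]\<close> is the code of white, the top of a letter tile. In the
  application \<open>pre\<close> consists of the delimiter of the unary prefix and the fixed tiles,
  and \<open>post\<close> completes the end tile and appends the distinguished tile.\<close>

definition reduction_out :: "nat \<Rightarrow> (bool \<Rightarrow> bool list) \<Rightarrow> bool list \<Rightarrow> bool list \<Rightarrow> nat \<Rightarrow> nat \<Rightarrow> bool list \<Rightarrow> bool list" where
  "reduction_out a sy post pre c D w = replicate ((length w + c) ^ D) True @ pre @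
     concat (map (\<lambda>j. enc_nat (2 ^ (a + j)) @ [False, False] @ enc_nat (2 ^ (a + Suc j)) @ sy (w ! j)) [0..<length w]) @
     enc_nat (2 ^ (a + length w)) @ post"

definition reduction_time :: "nat \<Rightarrow> (bool \<Rightarrow> bool list) \<Rightarrow> bool list \<Rightarrow> bool list \<Rightarrow> nat \<Rightarrow> nat \<Rightarrow> nat \<Rightarrow> nat" where
  "reduction_time a sy post pre c D n =
     n * 9 + 2 * length post + 2 * length pre + 2 * c + (16 * n + 2 * length (enc_nat (2 ^ a)) + 10) +
     n * (2 * (length (sy False) + length (sy True)) + 2 * (16 * n + 2 * length (enc_nat (2 ^ a)) + 10) + 15) +
     power_time D (n + c) + (n + c) * 5 + 20"

lemma runs_reduction:
  "runs (reduction_time a sy post pre c D (length w)) (reduction a sy post pre c D) (init_stacks w)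
     (init_stacks (reduction_out a sy post pre c D w))"
proof -
  let ?n = "length w"
  let ?K = "2 * length (enc_nat (2 ^ a)) + 10"
  let ?Y = "length (sy False) + length (sy True)"
  define Z :: stacks where "Z = (\<lambda>_. [])"
  let ?A = "\<lambda>pr ys. Z(0 := ys, 3 := rev pr, 4 := replicate (length pr) True, 6 := replicate (length pr) True)"
  have 1: "runs (?n * (5 + 4) + 1) (drain 0 (Push 3 False ;; Push 4 True ;; Push 6 True) (Push 3 True ;; Push 4 True ;; Push 6 True))
     (?A [] w) (?A w [])"
  proof (rule runs_drain[where S = ?A])
    fix pr x ys
    have "runs (1 + (1 + 1 + 1) + 1) (Push 3 x ;; Push 4 True ;; Push 6 True) ((?A pr (x # ys))(0 := ys)) (?A (pr @ [x]) ys)"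
      by (rule runs_Seq[OF runs_Push[OF refl] runs_Seq[OF runs_Push[OF refl] runs_Push]]) (auto simp: fun_eq_iff)
    from runs_mono[OF this, of 5] show "runs 5 (if x then Push 3 True ;; Push 4 True ;; Push 6 True else Push 3 False ;; Push 4 True ;; Push 6 True)
        ((?A pr (x # ys))(0 := ys)) (?A (pr @ [x]) ys)"
      by (cases x) simp_all
  qed simp
  let ?s1 = "Z(3 := rev w, 4 := replicate ?n True, 6 := replicate ?n True)"
  have e1: "?A [] w = init_stacks w" by (auto simp: Z_def init_stacks_def fun_eq_iff)
  have e2: "?A w [] = ?s1" by (auto simp: Z_def fun_eq_iff)
  have 2: "runs (2 * length post + 1) (pushs 0 post) ?s1 (?s1(0 := post))"
    by (rule runs_pushs) (simp add: Z_def)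
  define O1 where "O1 = enc_nat (2 ^ (a + ?n)) @ post"
  have 3: "runs (16 * ?n + ?K) (emit_id a) (?s1(0 := post)) (?s1(0 := O1))"
    using runs_emit_id[of "?s1(0 := post)" ?n a] by (simp add: Z_def O1_def add.assoc)
  define lt where "lt = (\<lambda>j. enc_nat (2 ^ (a + j)) @ [False, False] @ enc_nat (2 ^ (a + Suc j)) @ sy (w ! j))"
  \<comment> \<open>Letters are treated from the last to the first. With \<open>ys\<close> left,
    stack 4 holds \<open>length ys\<close> in unary, the index in the right colour of the next
    letter tile; one pop later it is the index in the left colour.\<close>
  let ?B = "\<lambda>(pr :: bool list) ys. Z(0 := concat (map lt [length ys..<?n]) @ O1, 3 := ys, 4 := replicate (length ys) True, 6 := replicate ?n True)"
  let ?bd = "\<lambda>x. pushs 0 (sy x) ;; emit_id a ;; pushs 0 [False, False] ;; Pop 4 ;; emit_id a"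
  let ?Tb = "2 * ?Y + 2 * (16 * ?n + ?K) + 11"
  have 4: "runs (length (rev w) * (?Tb + 4) + 1) (drain 3 (?bd False) (?bd True)) (?B [] (rev w)) (?B (rev w) [])"
  proof (rule runs_drain[where S = ?B])
    fix pr x ys
    assume xs: "rev w = pr @ x # ys"
    then have w: "w = rev ys @ x # rev pr" by (metis append.assoc append_Cons append_Nil rev.simps(2) rev_append rev_rev_ident)
    let ?j = "length ys"
    have jn: "?j < ?n" and wj: "w ! ?j = x" by (auto simp: w nth_append)
    let ?O = "concat (map lt [Suc ?j..<?n]) @ O1"
    let ?c0 = "(?B pr (x # ys))(3 := ys)"
    let ?c1 = "?c0(0 := sy x @ ?O)"
    let ?c2 = "?c0(0 := enc_nat (2 ^ (a + Suc ?j)) @ sy x @ ?O)"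
    let ?c3 = "?c0(0 := [False, False] @ enc_nat (2 ^ (a + Suc ?j)) @ sy x @ ?O)"
    let ?c4 = "?c3(4 := replicate ?j True)"
    have b1: "runs (2 * length (sy x) + 1) (pushs 0 (sy x)) ?c0 ?c1"
      by (rule runs_pushs) (simp add: fun_eq_iff)
    have b2: "runs (16 * Suc ?j + ?K) (emit_id a) ?c1 ?c2"
      using runs_emit_id[of ?c1 "Suc ?j" a] by (simp add: Z_def add.assoc del: power_Suc)
    have b3: "runs (2 * length [False, False] + 1) (pushs 0 [False, False]) ?c2 ?c3"
      by (rule runs_pushs) (simp add: fun_eq_iff)
    have b4: "runs 1 (Pop 4) ?c3 ?c4"
      by (rule runs_Pop) (simp add: fun_eq_iff)
    have b5: "runs (16 * ?j + ?K) (emit_id a) ?c4 (?c4(0 := enc_nat (2 ^ (a + ?j)) @ ?c4 0))"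
      using runs_emit_id[of ?c4 ?j a] by (simp add: Z_def add.assoc)
    have "[?j..<?n] = ?j # [Suc ?j..<?n]" using jn by (rule upt_conv_Cons)
    then have "?c4(0 := enc_nat (2 ^ (a + ?j)) @ ?c4 0) = ?B (pr @ [x]) ys"
      by (auto simp: fun_eq_iff lt_def wj)
    with runs_Seq[OF b1 runs_Seq[OF b2 runs_Seq[OF b3 runs_Seq[OF b4 b5]]]]
    have "runs (2 * length (sy x) + 1 + (16 * Suc ?j + ?K + (2 * length [False, False] + 1 + (1 + (16 * ?j + ?K) + 1) + 1) + 1) + 1)
       (?bd x) ?c0 (?B (pr @ [x]) ys)" by (simp only:)
    moreover have "length (sy x) \<le> ?Y" by (cases x) auto
    ultimately have "runs ?Tb (?bd x) ?c0 (?B (pr @ [x]) ys)"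
      by (elim runs_mono) (use jn in simp)
    then show "runs ?Tb (if x then ?bd True else ?bd False) ?c0 (?B (pr @ [x]) ys)"
      by (cases x) simp_all
  qed simp
  have e3: "?B [] (rev w) = ?s1(0 := O1)" by (auto simp: fun_eq_iff)
  define O2 where "O2 = concat (map lt [0..<?n]) @ O1"
  let ?s2 = "Z(6 := replicate ?n True)"
  have e4: "?B (rev w) [] = ?s2(0 := O2)" by (auto simp: fun_eq_iff Z_def O2_def)
  have 5: "runs (2 * length pre + 1) (pushs 0 pre) (?s2(0 := O2)) (?s2(0 := pre @ O2))"
    by (rule runs_pushs) simp
  let ?s3 = "Z(6 := replicate (?n + c) True)"
  have 6: "runs (2 * length (replicate c True) + 1) (pushs 6 (replicate c True)) (?s2(0 := pre @ O2)) (?s3(0 := pre @ O2))"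
    by (rule runs_pushs) (simp add: fun_eq_iff replicate_add[symmetric] add.commute)
  have 7: "runs (power_time D (?n + c)) (power_loop D) (?s3(0 := pre @ O2))
      (?s3(0 := replicate ((?n + c) ^ D) True @ pre @ O2))"
    using runs_power_loop[of "?s3(0 := pre @ O2)" "?n + c" D] by (simp add: Z_def)
  let ?s4 = "?s3(0 := replicate ((?n + c) ^ D) True @ pre @ O2)"
  have "runs (length (replicate (?n + c) True) * (1 + 4) + 1) (drain 6 Skip Skip) (?s4(6 := replicate (?n + c) True)) (?s4(6 := []))"
    by (rule runs_drain[where S = "\<lambda>(pr :: bool list) ys. ?s4(6 := ys)"]) (use runs_Skip in auto)
  then have 8: "runs ((?n + c) * 5 + 1) (clear 6) ?s4 (?s4(6 := []))"
    by (simp add: clear_def fun_upd_twist)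
  have "?s4(6 := []) = init_stacks (reduction_out a sy post pre c D w)"
    by (auto simp: fun_eq_iff Z_def init_stacks_def reduction_out_def O2_def O1_def lt_def)
  with runs_Seq[OF 1[unfolded e1 e2] runs_Seq[OF 2 runs_Seq[OF 3 runs_Seq[OF 4[unfolded e3 e4]
         runs_Seq[OF 5 runs_Seq[OF 6 runs_Seq[OF 7 8]]]]]]]
  show ?thesis unfolding reduction_def
    by (elim subst, elim runs_mono) (simp add: reduction_time_def algebra_simps)
qed

section \<open>Polynomial running time of the reduction\<close>

lemma is_poly_poly: "is_poly (\<lambda>n. poly P n)"
proof -
  have "poly P n = (\<Sum>i<length (map (coeff P) [0..<Suc (degree P)]). map (coeff P) [0..<Suc (degree P)] ! i * n ^ i)" for n
    unfolding poly_altdef by (simp add: lessThan_Suc_atMost nth_append del: upt_Suc)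
  then show ?thesis unfolding is_poly_def by blast
qed

lemma power_time_poly: "\<exists>P. \<forall>n. power_time D (n + c) = poly P n"
proof (induction D)
  case 0
  show ?case by (intro exI[of _ 1]) simp
next
  case (Suc D)
  then obtain P where "\<forall>n. power_time D (n + c) = poly P n" by blast
  then show ?case
    by (intro exI[of _ "[:c, 1:] * (P + [:16:]) + [:5:]"]) (simp add: algebra_simps)
qed

text \<open>Formal polynomials supply the closure properties of \<open>is_poly\<close>. The machine
  is slower than the program by a factor linear in the stack height, which is at most the input
  length plus the running time.\<close>

lemma reduction_computable:
  "\<exists>M p. is_poly p \<and> computes_in_time M (reduction_out a sy post pre c D) p"
proof -
  obtain M where M: "wf_tm M"
    and run: "\<And>w B t \<sigma>. exec (Some B) (reduction a sy post pre c D) (init_stacks w) t \<sigma> \<Longrightarrow> length w \<le> B \<Longrightarrow>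
      \<exists>n \<le> t * (2 * B + 6) + 2. cstate (run M w n) = (if \<sigma> 1 = [] then 1 else 2) \<and>
        (\<forall>i. chead (run M w i) \<le> B) \<and>
        ((\<forall>r > 0. \<sigma> r = []) \<longrightarrow> (\<forall>i < length (\<sigma> 0). ctape (run M w n) i = sym_of (\<sigma> 0 ! i)) \<and>
           ctape (run M w n) (length (\<sigma> 0)) = 0)"
    by (rule compile_stacks[of "reduction a sy post pre c D"], rule that)
  let ?T = "reduction_time a sy post pre c D"
  define p where "p n = ?T n * (2 * (n + ?T n) + 6) + 2" for n
  obtain P where P: "\<forall>n. power_time D (n + c) = poly P n" using power_time_poly by blast
  define T' where "T' = [:0, 9:] + [:2 * length post + 2 * length pre + 2 * c:] + [:2 * length (enc_nat (2 ^ a)) + 10, 16:] +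
     [:0, 1:] * ([:2 * (length (sy False) + length (sy True)) + 15:] + [:2:] * [:2 * length (enc_nat (2 ^ a)) + 10, 16:]) +
     P + [:5 * c, 5:] + [:20:]"
  have T': "?T n = poly T' n" for n
    using P[rule_format, of n] by (simp add: reduction_time_def T'_def algebra_simps)
  have "p n = poly (T' * ([:2:] * ([:0, 1:] + T') + [:6:]) + [:2:]) n" for n
    by (simp add: p_def T' algebra_simps)
  then have poly: "is_poly p"
    using is_poly_poly[of "T' * ([:2:] * ([:0, 1:] + T') + [:6:]) + [:2:]"] by presburger
  have "computes_in_time M (reduction_out a sy post pre c D) p"
    unfolding computes_in_time_def
  proof (intro conjI allI M)
    fix w
    let ?f = "reduction_out a sy post pre c D w"
    obtain t where t: "t \<le> ?T (length w)" "exec None (reduction a sy post pre c D) (init_stacks w) t (init_stacks ?f)"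
      using runs_reduction[of a sy post pre c D w] by (auto simp: runs_def)
    let ?B = "length w + ?T (length w)"
    have "exec (Some ?B) (reduction a sy post pre c D) (init_stacks w) t (init_stacks ?f)"
      by (rule exec_space_le_time[OF t(2)]) (use t(1) in \<open>auto simp: init_stacks_def\<close>)
    from run[OF this] obtain n where n: "n \<le> t * (2 * ?B + 6) + 2"
      "cstate (run M w n) = (if init_stacks ?f 1 = [] then 1 else 2)"
      "(\<forall>r > 0. init_stacks ?f r = []) \<longrightarrow> (\<forall>i < length (init_stacks ?f 0). ctape (run M w n) i = sym_of (init_stacks ?f 0 ! i)) \<and>
           ctape (run M w n) (length (init_stacks ?f 0)) = 0"
      by auto
    have "t * (2 * ?B + 6) + 2 \<le> p (length w)"
      unfolding p_def using t(1) by (intro add_right_mono mult_le_mono1)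
    then show "\<exists>t \<le> p (length w). cstate (run M w t) = 1 \<and> (\<forall>i < length ?f. ctape (run M w t) i = sym_of (?f ! i)) \<and>
       ctape (run M w t) (length ?f) = 0"
      using n by (intro exI[of _ n]) (auto simp: init_stacks_def)
  qed
  then show ?thesis using poly by blast
qed

section \<open>Hardness\<close>

lemma expk_add: "expk j m + c \<le> expk j (m + c)"
proof (induction j)
  case (Suc j)
  have "expk j m + c \<le> expk j (m + c)" by (rule Suc)
  then have "(2::nat) ^ (expk j m + c) \<le> 2 ^ expk j (m + c)" by (rule power_increasing) simp
  moreover have "2 ^ expk j m + c \<le> (2::nat) ^ (expk j m + c)"
  proof (induction c)
    case (Suc c)
    have "1 \<le> (2::nat) ^ (expk j m + c)" by simp
    then show ?case unfolding add_Suc_right power_Suc using Suc.IH by linarith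
  qed simp
  ultimately show ?case unfolding expk.simps by linarith
qed simp

text \<open>Adding \<open>c\<close> at the bottom of the tower gains a factor \<open>2 ^ c\<close>
  at the top, enough to absorb the constants of the simulated machine.\<close>

lemma expk_shift: "1 \<le> k \<Longrightarrow> 2 ^ c * expk k m \<le> expk k (m + c)"
proof -
  assume "1 \<le> k"
  then obtain j where k: "k = Suc j" by (cases k) auto
  have "(2::nat) ^ (expk j m + c) \<le> 2 ^ expk j (m + c)" by (rule power_increasing[OF expk_add]) simp
  then show ?thesis by (simp add: k power_add mult.commute)
qed

text \<open>The reduction writes unary numbers of the form \<open>(n + c) ^ D\<close>, so an
  arbitrary polynomial is traded for a bound of similar shape.\<close>

lemma poly_bound:
  assumes "is_poly p"
  shows "\<exists>S D. \<forall>n. p n \<le> S * (n + 1) ^ D"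
proof -
  obtain cs :: "nat list" where p: "\<And>n. p n = (\<Sum>i<length cs. cs ! i * n ^ i)" using assms by (auto simp: is_poly_def)
  have "p n \<le> (\<Sum>i<length cs. cs ! i) * (n + 1) ^ length cs" for n
    unfolding p sum_distrib_right
  proof (rule sum_mono, rule mult_le_mono2)
    fix i
    assume "i \<in> {..<length cs}"
    have "n ^ i \<le> (n + 1) ^ i" by (rule power_mono) auto
    also have "\<dots> \<le> (n + 1) ^ length cs" by (rule power_increasing) (use \<open>i \<in> _\<close> in auto)
    finally show "n ^ i \<le> (n + 1) ^ length cs" .
  qed
  then show ?thesis by blast
qed

theorem tiling_lang_hard:
  assumes k: "1 \<le> k" and L: "L \<in> kEXPSPACE k"
  shows "poly_reducible L (tiling_lang star k)"
proof -
  obtain M p where p: "is_poly p" and dec: "decides_in_space M L (\<lambda>n. expk k (p n))"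
    using L by (auto simp: kEXPSPACE_def)
  have M: "wf_tm M" using dec by (simp add: decides_in_space_def)
  obtain a g where inj: "inj_on (enc_col a g) (all_cols M)" and W0: "enc_col a g White = 0"
    using enc_col_exists by blast
  define \<iota> where "\<iota> = enc_col a g"
  obtain fx where fx: "set fx = fixed_tiles M" using finite_list[OF finite_fixed_tiles[OF M]] by blast
  define tl where "tl w = map (map_tile \<iota>) (fx @ map (letter_tile w) [0..<length w] @ [end_tile w])" for w
  define t0 where "t0 = map_tile \<iota> (White, White, Id 0, Dum)"
  have stl: "set (tl w) = map_tile \<iota> ` tiles M w" for w
    by (auto simp: tl_def tiles_def fx)
  obtain S D where SD: "\<And>n. p n \<le> S * (n + 1) ^ D" using poly_bound[OF p] by blast
  \<comment> \<open>Added to \<open>p n + n\<close> in the parameter, this makes \<open>W\<close>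
    exceed the space bound by the factor \<open>nstates M + nsyms M + 3\<close> and the input length
    by 5.\<close>
  define c1 where "c1 = nstates M + nsyms M + 5"
  define c where "c = S + c1 + 2"
  \<comment> \<open>\<open>S * (n + 1) ^ D + n + c1\<close> is at most
    \<open>(n + S + c1) * (n + 1) ^ D\<close>; the first factor accounts for the exponent
    \<open>Suc D\<close>.\<close>
  define n' where "n' n = (n + c) ^ Suc D" for n
  have n': "p n + n + c1 \<le> n' n" for n
  proof -
    have "1 \<le> (n + 1) ^ D" by simp
    then have "n \<le> n * (n + 1) ^ D" "c1 \<le> c1 * (n + 1) ^ D" by (metis mult.right_neutral mult_le_mono2)+
    then have "p n + n + c1 \<le> S * (n + 1) ^ D + n * (n + 1) ^ D + c1 * (n + 1) ^ D" using SD[of n] by linarith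
    also have "\<dots> = (n + (S + c1)) * (n + 1) ^ D" by (simp add: algebra_simps)
    also have "\<dots> \<le> (n + c) * (n + c) ^ D" by (intro mult_le_mono power_mono) (auto simp: c_def)
    finally show ?thesis by (simp add: n'_def)
  qed
  define f where "f w = enc_inst (n' (length w)) (tl w) t0" for w
  let ?sy = "\<lambda>b. enc_nat (\<iota> (Sym (sym_of b)))"
  let ?post = "enc_nat 0 @ enc_nat (\<iota> Ga) @ enc_nat (\<iota> (Sym 0)) @ [False, True] @ enc_tile t0"
  let ?pre = "False # concat (map enc_tile (map (map_tile \<iota>) fx))"
  have out: "reduction_out a ?sy ?post ?pre c (Suc D) = f"
  proof
    fix w
    have "enc_tile (map_tile \<iota> (letter_tile w j)) =
        enc_nat (2 ^ (a + j)) @ [False, False] @ enc_nat (2 ^ (a + Suc j)) @ ?sy (w ! j)" for j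
      using W0 by (simp add: letter_tile_def \<iota>_def enc_col_Id enc_nat_0 del: power_Suc)
    moreover have "enc_tile (map_tile \<iota> (end_tile w)) = enc_nat (2 ^ (a + length w)) @ enc_nat 0 @ enc_nat (\<iota> Ga) @ enc_nat (\<iota> (Sym 0))"
      using W0 by (simp add: end_tile_def \<iota>_def enc_col_Id)
    ultimately show "reduction_out a ?sy ?post ?pre c (Suc D) w = f w"
      by (simp add: reduction_out_def f_def enc_inst_def n'_def tl_def o_def del: power_Suc enc_tile.simps)
  qed
  obtain M' p' where "is_poly p'" "computes_in_time M' f p'"
    using reduction_computable[of a ?sy ?post ?pre c "Suc D"] unfolding out by blast
  moreover have "w \<in> L \<longleftrightarrow> f w \<in> tiling_lang star k" for w
  proof -
    let ?n = "length w"
    let ?s = "expk k (p ?n)"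
    define W where "W = expk k (n' ?n)"
    define H where "H = (2::nat) ^ W"
    have s1: "1 \<le> ?s" by (rule expk_pos[OF k])
    have "2 ^ (?n + c1) * ?s \<le> expk k (p ?n + (?n + c1))" by (rule expk_shift[OF k])
    also have "\<dots> \<le> W" unfolding W_def by (rule expk_mono) (use n'[of ?n] in simp)
    finally have W: "2 ^ (?n + c1) * ?s \<le> W" .
    have Wn: "?n + 5 \<le> W"
    proof -
      have "?n + 5 \<le> ?n + c1" by (simp add: c1_def)
      also have "\<dots> \<le> 2 ^ (?n + c1)" by (rule less_imp_le[OF less_exp])
      also have "\<dots> \<le> 2 ^ (?n + c1) * ?s" using s1 by simp
      finally show ?thesis using W by linarith
    qed
    have Ws: "(nstates M + nsyms M + 3) * ?s \<le> W"
    proof -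
      have "nstates M + nsyms M + 3 \<le> ?n + c1" by (simp add: c1_def)
      also have "\<dots> \<le> 2 ^ (?n + c1)" by (rule less_imp_le[OF less_exp])
      finally have "(nstates M + nsyms M + 3) * ?s \<le> 2 ^ (?n + c1) * ?s" by (rule mult_le_mono1)
      then show ?thesis using W by linarith
    qed
    have heads: "chead (run M w t) < ?s" for t using dec by (simp add: decides_in_space_def)
    have MM: "3 \<le> nstates M" "3 \<le> nsyms M" using M by (auto simp: wf_tm_def)
    have hW: "chead (run M w t) + 3 < W" for t
    proof -
      have "9 * ?s \<le> (nstates M + nsyms M + 3) * ?s" using MM by (intro mult_le_mono1) simp
      then show ?thesis using heads[of t] s1 Ws by linarith
    qed
    \<comment> \<open>The bottom row of tiles reads time \<open>H - 3\<close>, which must not come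
      before the halting time. The number of configurations has binary logarithm below
      \<open>W\<close> thanks to \<open>Ws\<close>.\<close>
    have Hbig: "nstates M * nsyms M ^ ?s * ?s + 3 \<le> H"
    proof -
      let ?x = "nstates M * nsyms M ^ ?s * ?s"
      have "nstates M \<le> 2 ^ nstates M" "?s \<le> 2 ^ ?s" by (rule less_imp_le[OF less_exp])+
      moreover have "nsyms M ^ ?s \<le> 2 ^ (nsyms M * ?s)" by (rule power_le_two_power)
      ultimately have "?x \<le> 2 ^ nstates M * 2 ^ (nsyms M * ?s) * 2 ^ ?s" by (intro mult_le_mono)
      also have "\<dots> = 2 ^ (nstates M + nsyms M * ?s + ?s)" by (simp add: power_add)
      finally have x: "?x \<le> 2 ^ (nstates M + nsyms M * ?s + ?s)" .
      have "?x + 3 \<le> 2 ^ (nstates M + nsyms M * ?s + ?s) * 4"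
        using x one_le_power[of "2::nat" "nstates M + nsyms M * ?s + ?s"] by linarith
      also have "\<dots> = 2 ^ (nstates M + nsyms M * ?s + ?s + 2)" by (simp add: power_add)
      also have "\<dots> \<le> H" unfolding H_def
      proof (rule power_increasing)
        have "nstates M \<le> nstates M * ?s" "2 \<le> 2 * ?s" using s1 by auto
        moreover have "(nstates M + nsyms M + 3) * ?s = nstates M * ?s + nsyms M * ?s + 3 * ?s"
          by (simp add: algebra_simps)
        ultimately show "nstates M + nsyms M * ?s + ?s + 2 \<le> W" using Ws by linarith
      qed simp
      finally show ?thesis .
    qed
    have W2: "2 \<le> W" using Wn by simp
    then obtain W' where "W = Suc (Suc W')" by (metis Suc_le_D numeral_2_eq_2 Suc_le_mono)
    then have H4: "4 \<le> H" "even H" by (auto simp: H_def)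
    have same: "cstate (run M w t) = cstate (run M w t')" if "halted (cstate (run M w t))" "halted (cstate (run M w t'))" for t t'
      using halted_stays[OF that(1), of t'] halted_stays[OF that(2), of t] by (simp add: add.commute)
    obtain t1 where t1: "halted (cstate (run M w t1))" "cstate (run M w t1) = 1 \<longleftrightarrow> w \<in> L"
      using dec by (auto simp: decides_in_space_def)
    have acc: "w \<in> L \<longleftrightarrow> (\<exists>t. cstate (run M w t) = 1)"
    proof
      assume "\<exists>t. cstate (run M w t) = 1"
      then obtain t where t: "cstate (run M w t) = 1" by blast
      then have "halted (cstate (run M w t))" by (simp add: halted_def)
      from same[OF t1(1) this] show "w \<in> L" using t1(2) t by simp
    qed (use t1 in blast)
    have col: "(\<exists>h v. colored (tiles M w) H W h v)" if "w \<in> L"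
    proof -
      obtain t2 where t2: "t2 < nstates M * nsyms M ^ ?s * ?s" "halted (cstate (run M w t2))"
        using halting_time[OF M heads t1(1)] by blast
      have "t2 + (H - 3 - t2) = H - 3" using t2(1) Hbig by linarith
      then have "run M w (H - 3) = run M w t2" using halted_stays[OF t2(2), of "H - 3 - t2"] by simp
      then have "cstate (run M w (H - 3)) = 1" using same[OF t2(2) t1(1)] t1(2) that by simp
      then show ?thesis by (rule coloring_complete[OF M _ H4 Wn hW])
    qed
    have W1: "1 \<le> W" "1 \<le> H" using Wn H4 by auto
    let ?T = "map_tile \<iota> ` tiles M w"
    have inj': "inj_on \<iota> (all_cols M)" "\<iota> White = 0" using inj W0 by (auto simp: \<iota>_def)
    have tiling: "(\<exists>\<tau>. is_tiling ?T h W \<tau>) \<longleftrightarrow> (\<exists>hc v. colored (tiles M w) h W hc v)" if "1 \<le> h" for h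
      by (rule tiling_colored[OF inj'(1) tiles_cols[OF M] _ inj'(2) that W1(1)]) auto
    have det: "deterministic ?T" by (rule deterministic_tiles[OF M inj'])
    have corner: "\<tau> 1 1 = t0" if "is_tiling ?T h W \<tau>" "1 \<le> h" for \<tau> h
    proof -
      have "(\<iota> White, \<iota> White, \<iota> (Id 0), \<iota> Dum) \<in> ?T"
        by (rule image_eqI[of _ _ "(White, White, Id 0, Dum)"]) (auto simp: tiles_def fixed_tiles.corner)
      then show ?thesis
        using tiling_corner[OF det that W1(1), of "\<iota> White" "\<iota> White" "\<iota> (Id 0)" "\<iota> Dum"] inj'(2) by (simp add: t0_def)
    qed
    have lang: "f w \<in> tiling_lang star k \<longleftrightarrow> (if star then \<exists>h \<ge> 1. \<exists>\<tau>. is_tiling ?T h W \<tau> else \<exists>\<tau>. is_tiling ?T H W \<tau>)"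
    proof
      assume "f w \<in> tiling_lang star k"
      then have "\<exists>m Ts t. f w = enc_inst m Ts t \<and>
        (if star then \<exists>h \<ge> 1. \<exists>\<tau>. is_tiling (set Ts) h (expk k m) \<tau> \<and> \<tau> 1 1 = t
         else \<exists>\<tau>. is_tiling (set Ts) (2 ^ expk k m) (expk k m) \<tau> \<and> \<tau> 1 1 = t)"
        unfolding tiling_lang_def detTILING_def detTILING_star_def by (cases star) (simp, blast)+
      then obtain m Ts t where m: "f w = enc_inst m Ts t"
        "if star then \<exists>h \<ge> 1. \<exists>\<tau>. is_tiling (set Ts) h (expk k m) \<tau> \<and> \<tau> 1 1 = t
         else \<exists>\<tau>. is_tiling (set Ts) (2 ^ expk k m) (expk k m) \<tau> \<and> \<tau> 1 1 = t"
        by (elim exE conjE)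
      have "m = n' ?n \<and> Ts = tl w"
        using enc_inst_inj[of m Ts t "n' ?n" "tl w" t0] m(1) by (simp add: f_def)
      then show "if star then \<exists>h \<ge> 1. \<exists>\<tau>. is_tiling ?T h W \<tau> else \<exists>\<tau>. is_tiling ?T H W \<tau>"
        using m(2) stl by (auto simp: W_def H_def split: if_splits)
    next
      assume t: "if star then \<exists>h \<ge> 1. \<exists>\<tau>. is_tiling ?T h W \<tau> else \<exists>\<tau>. is_tiling ?T H W \<tau>"
      show "f w \<in> tiling_lang star k"
      proof (cases star)
        case True
        then obtain h \<tau> where "1 \<le> h" "is_tiling ?T h W \<tau>" using t by auto
        then have "1 \<le> h \<and> is_tiling (set (tl w)) h (expk k (n' ?n)) \<tau> \<and> \<tau> 1 1 = t0"
          using corner[of h \<tau>] stl by (simp add: W_def)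
        moreover have "deterministic (set (tl w))" unfolding stl by (rule det)
        ultimately have "f w \<in> detTILING_star (expk k)"
          unfolding detTILING_star_def f_def by blast
        then show ?thesis using True by (simp add: tiling_lang_def)
      next
        case False
        then obtain \<tau> where "is_tiling ?T H W \<tau>" using t by auto
        then have "is_tiling (set (tl w)) (expk (k + 1) (n' ?n)) (expk k (n' ?n)) \<tau> \<and> \<tau> 1 1 = t0"
          using corner[of H \<tau>] stl W1 by (simp add: W_def H_def)
        moreover have "deterministic (set (tl w))" unfolding stl by (rule det)
        ultimately have "f w \<in> detTILING (expk (k + 1)) (expk k)"
          unfolding detTILING_def f_def by blast
        then show ?thesis using False by (simp add: tiling_lang_def)
      qed
    qed
    \<comment> \<open>An accepted input gives a tiling of height \<open>H\<close>, which serves both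
      problems, and soundness holds for every height.\<close>
    show ?thesis
    proof
      assume "w \<in> L"
      then have "\<exists>\<tau>. is_tiling ?T H W \<tau>" using col tiling[OF W1(2)] by simp
      then show "f w \<in> tiling_lang star k" unfolding lang using W1(2) by (cases star) auto
    next
      assume "f w \<in> tiling_lang star k"
      then obtain h where "1 \<le> h" "\<exists>\<tau>. is_tiling ?T h W \<tau>" unfolding lang using W1(2) by (auto split: if_splits)
      then obtain hc v where "colored (tiles M w) h W hc v" using tiling by blast
      from coloring_sound[OF M this \<open>1 \<le> h\<close> W1(1)] show "w \<in> L" using acc by blast
    qed
  qed
  ultimately show ?thesis unfolding poly_reducible_def by blast
qed

theorem theorem15:
  fixes k :: nat
  assumes "k \<ge> 1"
  shows "complete_for (detTILING (expk (k+1)) (expk k)) (kEXPSPACE k) \<and>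
         complete_for (detTILING_star (expk k)) (kEXPSPACE k)"
proof -
  have "complete_for (tiling_lang star k) (kEXPSPACE k)" for star
    unfolding complete_for_def using tiling_lang_in_kEXPSPACE[OF assms] tiling_lang_hard[OF assms] by blast
  from this[of False] this[of True] show ?thesis by (simp add: tiling_lang_def)
qed

end
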